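(* Let $k$ be a field, let $\Lambda=C\oplus I$ be a cleft extension $k$-algebra and suppose $I$ is a projective $C$-bimodule. The following is a resolution of $K^1_C(\Lambda)$ by projective $\Lambda$-bimodules: $$\cdots\xrightarrow{d}\Lambda\otimes_CI\otimes_CI\otimes_C\Lambda\xrightarrow{d}\Lambda\otimes_CI\otimes_C\Lambda\xrightarrow{d}K^1_C(\Lambda)\to 0,$$ where for $n\geq 1$, $l,l'\in\Lambda$ and $x_1,\dots,x_n\in I$, $$d(l\otimes x_1\otimes\cdots\otimes x_n\otimes l')=lx_1\otimes x_2\otimes\cdots\otimes x_n\otimes l'+\sum_{i=1}^{n-1}(-1)^i\,l\otimes x_1\otimes\cdots\otimes x_ix_{i+1}\otimes\cdots\otimes x_n\otimes l'+(-1)^n\,l\otimes x_1\otimes\cdots\otimes x_{n-1}\otimes x_nl'.$$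
   Context: A cleft extension algebra is a $k$-algebra $\Lambda$ with a vector space decomposition $\Lambda=C\oplus I$ where $C$ is a subalgebra and $I$ is a two-sided ideal of $\Lambda$. $K^1_C(\Lambda)=\ker(\Lambda\otimes_C\Lambda\to\Lambda)$ is the kernel of the map given by the product of $\Lambda$, a $\Lambda$-bimodule. For $n=1$ the displayed formula reads $d(l\otimes x_1\otimes l')=lx_1\otimes l'-l\otimes x_1l'$, with values in $K^1_C(\Lambda)\subset\Lambda\otimes_C\Lambda$. *)

theory Defs
  imports Complex_Main "HOL-Algebra.Free_Abelian_Groups" "HOL-Algebra.AbelCoset"
begin

section \<open>Algebras and cleft extensions\<close>

text \<open>The sort \<open>{ring, monoid_mult}\<close> is \<open>ring_1\<close> without \<open>0 \<noteq> 1\<close>, so that the zero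
  algebra is not excluded.\<close>

locale k_algebra = vector_space scale
  for scale :: "'k::field \<Rightarrow> 'a::{ring, monoid_mult} \<Rightarrow> 'a" +
  assumes scale_mult_left: "scale c x * y = scale c (x * y)"
    and scale_mult_right: "x * scale c y = scale c (x * y)"
begin

text \<open>Subalgebras contain the unit of the ambient algebra.\<close>

definition subalgebra :: "'a set \<Rightarrow> bool" where
  "subalgebra A \<longleftrightarrow> subspace A \<and> 1 \<in> A \<and> (\<forall>x\<in>A. \<forall>y\<in>A. x * y \<in> A)"

definition two_sided_ideal :: "'a set \<Rightarrow> bool" where
  "two_sided_ideal J \<longleftrightarrow> subspace J \<and> (\<forall>x\<in>J. \<forall>l. l * x \<in> J \<and> x * l \<in> J)"

end

locale cleft_extension = k_algebra scale
  for scale :: "'k::field \<Rightarrow> 'a::{ring, monoid_mult} \<Rightarrow> 'a" and C I :: "'a set" +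
  assumes subalgebra_C: "subalgebra C"
    and two_sided_ideal_I: "two_sided_ideal I"
    and sum_C_I: "\<forall>l. \<exists>c\<in>C. \<exists>x\<in>I. l = c + x"
    and inter_C_I: "C \<inter> I = {0}"


section \<open>Bimodules and projectivity\<close>

text \<open>As in \<open>HOL-Algebra.Module\<close>, the record extends \<open>ring\<close>, but only its additive part
  is relevant; the fields \<open>mult\<close> and \<open>one\<close> are arbitrary.\<close>

record ('a, 'm) bimodule = "'m ring" +
  lact :: "'a \<Rightarrow> 'm \<Rightarrow> 'm"
  ract :: "'m \<Rightarrow> 'a \<Rightarrow> 'm"

text \<open>Bimodules over a subalgebra \<open>A\<close> of the ambient \<open>k\<close>-algebra. The last assumption is
  the usual convention that \<open>k\<close> acts in the same way on both sides, i.e. bimodules are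
  modules over the enveloping algebra of \<open>A\<close> over \<open>k\<close>.\<close>

locale bimodule = abelian_group M
  for scale :: "'k::field \<Rightarrow> 'a::{ring, monoid_mult} \<Rightarrow> 'a"
    and A :: "'a set" and M :: "('a, 'm) bimodule" (structure) +
  assumes lact_closed: "a \<in> A \<Longrightarrow> m \<in> carrier M \<Longrightarrow> lact M a m \<in> carrier M"
    and ract_closed: "a \<in> A \<Longrightarrow> m \<in> carrier M \<Longrightarrow> ract M m a \<in> carrier M"
    and lact_add: "a \<in> A \<Longrightarrow> m \<in> carrier M \<Longrightarrow> m' \<in> carrier M \<Longrightarrow>
      lact M a (m \<oplus> m') = lact M a m \<oplus> lact M a m'"
    and ract_add: "a \<in> A \<Longrightarrow> m \<in> carrier M \<Longrightarrow> m' \<in> carrier M \<Longrightarrow>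
      ract M (m \<oplus> m') a = ract M m a \<oplus> ract M m' a"
    and add_lact: "a \<in> A \<Longrightarrow> b \<in> A \<Longrightarrow> m \<in> carrier M \<Longrightarrow>
      lact M (a + b) m = lact M a m \<oplus> lact M b m"
    and add_ract: "a \<in> A \<Longrightarrow> b \<in> A \<Longrightarrow> m \<in> carrier M \<Longrightarrow>
      ract M m (a + b) = ract M m a \<oplus> ract M m b"
    and mult_lact: "a \<in> A \<Longrightarrow> b \<in> A \<Longrightarrow> m \<in> carrier M \<Longrightarrow>
      lact M (a * b) m = lact M a (lact M b m)"
    and mult_ract: "a \<in> A \<Longrightarrow> b \<in> A \<Longrightarrow> m \<in> carrier M \<Longrightarrow>
      ract M m (a * b) = ract M (ract M m a) b"
    and one_lact: "m \<in> carrier M \<Longrightarrow> lact M 1 m = m"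
    and one_ract: "m \<in> carrier M \<Longrightarrow> ract M m 1 = m"
    and lact_ract: "a \<in> A \<Longrightarrow> b \<in> A \<Longrightarrow> m \<in> carrier M \<Longrightarrow>
      ract M (lact M a m) b = lact M a (ract M m b)"
    and central: "m \<in> carrier M \<Longrightarrow> lact M (scale c 1) m = ract M m (scale c 1)"

definition bimodule_hom :: "'a set \<Rightarrow> ('a, 'm) bimodule \<Rightarrow> ('a, 'n) bimodule \<Rightarrow> ('m \<Rightarrow> 'n) set"
  where
  "bimodule_hom A M N = {f \<in> carrier M \<rightarrow> carrier N.
     (\<forall>x\<in>carrier M. \<forall>y\<in>carrier M. f (x \<oplus>\<^bsub>M\<^esub> y) = f x \<oplus>\<^bsub>N\<^esub> f y) \<and>
     (\<forall>a\<in>A. \<forall>x\<in>carrier M. f (lact M a x) = lact N a (f x) \<and> f (ract M x a) = ract N (f x) a)}"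

text \<open>The lifting property against surjections of \<open>A\<close>-bimodules. A HOL formula cannot
  quantify over types, so the type \<open>'u\<close> in which the test bimodules \<open>M\<close> and \<open>N\<close> have
  their carriers is a parameter. A bimodule is projective iff this holds for all types
  \<open>'u\<close>, equivalently for one type \<open>'u\<close> that is large enough to contain a copy of \<open>P\<close> and
  of the free bimodule on the underlying set of \<open>P\<close>. In a theorem, a conclusion should
  thus have a type variable for \<open>'u\<close>, whereas in a hypothesis any fixed type is
  implied by projectivity.\<close>

definition projective_bimodule ::
  "'u itself \<Rightarrow> ('k::field \<Rightarrow> 'a \<Rightarrow> 'a) \<Rightarrow> 'a::{ring, monoid_mult} set \<Rightarrow> ('a, 'p) bimodule \<Rightarrow> bool"
  where
  "projective_bimodule U scale A P \<longleftrightarrow> bimodule scale A P \<and>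
     (\<forall>(M :: ('a, 'u) bimodule) (N :: ('a, 'u) bimodule).
        bimodule scale A M \<longrightarrow> bimodule scale A N \<longrightarrow>
        (\<forall>f \<in> bimodule_hom A M N. \<forall>g \<in> bimodule_hom A P N.
           f ` carrier M = carrier N \<longrightarrow>
           (\<exists>h \<in> bimodule_hom A P M. \<forall>x\<in>carrier P. f (h x) = g x)))"

text \<open>\<open>\<dots> \<rightarrow> P 2 \<rightarrow> P 1 \<rightarrow> P 0 \<rightarrow> M \<rightarrow> 0\<close> with differentials \<open>d n : P (n + 1) \<rightarrow> P n\<close> and
  augmentation \<open>e : P 0 \<rightarrow> M\<close>; the parameter \<open>U\<close> is as above.\<close>

definition projective_resolution ::
  "'u itself \<Rightarrow> ('k::field \<Rightarrow> 'a \<Rightarrow> 'a) \<Rightarrow> 'a::{ring, monoid_mult} set \<Rightarrow> ('a, 'm) bimodule \<Rightarrow>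
   (nat \<Rightarrow> ('a, 'p) bimodule) \<Rightarrow> (nat \<Rightarrow> 'p \<Rightarrow> 'p) \<Rightarrow> ('p \<Rightarrow> 'm) \<Rightarrow> bool"
  where
  "projective_resolution U scale A M P d e \<longleftrightarrow>
     bimodule scale A M \<and>
     (\<forall>n. projective_bimodule U scale A (P n)) \<and>
     e \<in> bimodule_hom A (P 0) M \<and>
     (\<forall>n. d n \<in> bimodule_hom A (P (Suc n)) (P n)) \<and>
     e ` carrier (P 0) = carrier M \<and>
     a_kernel (P 0) M e = d 0 ` carrier (P 1) \<and>
     (\<forall>n. a_kernel (P (Suc n)) (P n) (d n) = d (Suc n) ` carrier (P (Suc (Suc n))))"

text \<open>An additive subgroup \<open>X\<close> of the ambient algebra, with the actions by multiplication.\<close>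

definition sub_bimodule :: "'a::{ring, monoid_mult} set \<Rightarrow> ('a, 'a) bimodule" where
  "sub_bimodule X = \<lparr>carrier = X, mult = (*), one = 1, zero = 0, add = (+), lact = (*), ract = (*)\<rparr>"


section \<open>Tensor products\<close>

text \<open>For \<open>C\<close>-sub-bimodules \<open>X\<^sub>0, \<dots>, X\<^sub>m\<close> of the ambient algebra, the tensor product
  \<open>X\<^sub>0 \<otimes>\<^sub>C \<dots> \<otimes>\<^sub>C X\<^sub>m\<close> is the quotient of the free abelian group on the tuples in
  \<open>X\<^sub>0 \<times> \<dots> \<times> X\<^sub>m\<close>, encoded as lists, by additivity in each entry and
  \<open>C\<close>-balancedness in adjacent entries. (The \<open>k\<close>-structure comes from \<open>k \<cdot> 1 \<subseteq> C\<close>.)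
  All these groups live in one type, whatever the number of factors.\<close>

type_synonym 'a tens = "('a list \<Rightarrow>\<^sub>0 int) set"

definition tensor_relations :: "'a::ring set \<Rightarrow> 'a set list \<Rightarrow> ('a list \<Rightarrow>\<^sub>0 int) set" where
  "tensor_relations C Xs =
     {frag_of (us @ (x + y) # vs) - frag_of (us @ x # vs) - frag_of (us @ y # vs) | us x y vs.
        us @ x # vs \<in> listset Xs \<and> us @ y # vs \<in> listset Xs} \<union>
     {frag_of (us @ (x * c) # y # vs) - frag_of (us @ x # (c * y) # vs) | us x c y vs.
        c \<in> C \<and> us @ x # y # vs \<in> listset Xs}"

definition tensor_kernel :: "'a::ring set \<Rightarrow> 'a set list \<Rightarrow> ('a list \<Rightarrow>\<^sub>0 int) set" where
  "tensor_kernel C Xs = generate (free_Abelian_group (listset Xs)) (tensor_relations C Xs)"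

text \<open>The quotient group is written additively, as the additive part of a \<open>ring\<close> record.\<close>

definition tensor_group :: "'a::ring set \<Rightarrow> 'a set list \<Rightarrow> 'a tens ring" where
  "tensor_group C Xs =
     (let Q = free_Abelian_group (listset Xs) Mod tensor_kernel C Xs
      in \<lparr>carrier = carrier Q, mult = undefined, one = undefined, zero = \<one>\<^bsub>Q\<^esub>, add = mult Q\<rparr>)"

text \<open>\<open>pure_tensor C Xs [x\<^sub>0, \<dots>, x\<^sub>m]\<close> is \<open>x\<^sub>0 \<otimes> \<dots> \<otimes> x\<^sub>m\<close>.\<close>

definition pure_tensor :: "'a::ring set \<Rightarrow> 'a set list \<Rightarrow> 'a list \<Rightarrow> 'a tens" where
  "pure_tensor C Xs xs = tensor_kernel C Xs #>\<^bsub>free_Abelian_group (listset Xs)\<^esub> frag_of xs"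

text \<open>The additive map on a tensor product with values in \<open>M\<close> that is given by \<open>\<phi>\<close> on pure
  tensors: the common value, on all representatives in the coset \<open>q\<close>, of the linear
  extension of \<open>\<phi>\<close>. It is meaningful only if \<open>\<phi>\<close> is multiadditive and balanced.\<close>

definition tensor_lift :: "('m, 'x) ring_scheme \<Rightarrow> ('a list \<Rightarrow> 'm) \<Rightarrow> 'a tens \<Rightarrow> 'm" where
  "tensor_lift M \<phi> q = the_elem
     ((\<lambda>c. \<Oplus>\<^bsub>M\<^esub>xs\<in>Poly_Mapping.keys c. [Poly_Mapping.lookup c xs] \<cdot>\<^bsub>M\<^esub> \<phi> xs) ` q)"

text \<open>The outer bimodule structure, when the first and the last factor are the whole algebra.\<close>

definition tensor_bimodule :: "'a::{ring, monoid_mult} set \<Rightarrow> 'a set list \<Rightarrow> ('a, 'a tens) bimodule"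
  where
  "tensor_bimodule C Xs =
     (let T = tensor_group C Xs
      in \<lparr>carrier = carrier T, mult = mult T, one = one T, zero = zero T, add = add T,
          lact = (\<lambda>a. tensor_lift T (\<lambda>xs. pure_tensor C Xs ((a * hd xs) # tl xs))),
          ract = (\<lambda>q a. tensor_lift T (\<lambda>xs. pure_tensor C Xs (butlast xs @ [last xs * a])) q)\<rparr>)"


section \<open>The complex\<close>

text \<open>With \<open>\<Lambda> = UNIV\<close>: the kernel of the product \<open>\<Lambda> \<otimes>\<^sub>C \<Lambda> \<rightarrow> \<Lambda>\<close>.\<close>

definition product_map :: "'a::{ring, monoid_mult} tens \<Rightarrow> 'a" where
  "product_map = tensor_lift (sub_bimodule UNIV) (\<lambda>xs. xs ! 0 * xs ! 1)"

definition K1 :: "'a::{ring, monoid_mult} set \<Rightarrow> ('a, 'a tens) bimodule" where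
  "K1 C = (let T = tensor_bimodule C [UNIV, UNIV]
           in T\<lparr>carrier := a_kernel T (sub_bimodule (UNIV :: 'a set)) product_map\<rparr>)"

text \<open>\<open>\<Lambda> \<otimes>\<^sub>C I \<otimes>\<^sub>C \<dots> \<otimes>\<^sub>C I \<otimes>\<^sub>C \<Lambda>\<close> with \<open>n\<close> factors \<open>I\<close>.\<close>

definition bar_factors :: "'a set \<Rightarrow> nat \<Rightarrow> 'a set list" where
  "bar_factors I n = UNIV # replicate n I @ [UNIV]"

definition bar_bimodule :: "'a::{ring, monoid_mult} set \<Rightarrow> 'a set \<Rightarrow> nat \<Rightarrow> ('a, 'a tens) bimodule"
  where
  "bar_bimodule C I n = tensor_bimodule C (bar_factors I n)"

definition merge :: "nat \<Rightarrow> 'a::times list \<Rightarrow> 'a list" where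
  "merge i xs = take i xs @ (xs ! i * xs ! Suc i) # drop (i + 2) xs"

text \<open>For \<open>n \<ge> 1\<close>, the map \<open>d\<close> from the term with \<open>n\<close> factors \<open>I\<close> to the one with \<open>n - 1\<close>
  factors. On \<open>l \<otimes> x\<^sub>1 \<otimes> \<dots> \<otimes> x\<^sub>n \<otimes> l'\<close>, represented by the list \<open>l # xs @ [l']\<close>, the
  summands \<open>i = 0\<close> and \<open>i = n\<close> are the outer terms, with \<open>l x\<^sub>1\<close> and with \<open>x\<^sub>n l'\<close>.\<close>

definition bar_diff :: "'a::{ring, monoid_mult} set \<Rightarrow> 'a set \<Rightarrow> nat \<Rightarrow> 'a tens \<Rightarrow> 'a tens" where
  "bar_diff C I n =
     (let T = bar_bimodule C I (n - 1)
      in tensor_lift T (\<lambda>xs. \<Oplus>\<^bsub>T\<^esub>i\<in>{0..n}.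
           [((- 1) ^ i :: int)] \<cdot>\<^bsub>T\<^esub> pure_tensor C (bar_factors I (n - 1)) (merge i xs)))"

end

(* Write d_n for the differential out of the term with n factors I, and let d_0 be the product map
   onto \<Lambda>. With p the projection of \<Lambda> = C \<oplus> I onto I, the map
   h(l \<otimes> x_1 \<otimes> ... \<otimes> l') = 1 \<otimes> p(l) \<otimes> x_1 \<otimes> ... \<otimes> l' satisfies d h + h d = 1, since p(l x_1) = l x_1 (in
   the last degree, h(l) = 1 \<otimes> l); the relation d d = 0 follows from this, and so does exactness, without any projectivity.
   For projectivity, split the multiplication C \<otimes>_k I \<otimes>_k C \<rightarrow> I by a bimodule map \<sigma>, and choose a
   k-linear section s of a surjection f: M \<rightarrow> N. A map g into N lifts to M in two steps. Applying \<sigma> to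
   the last factor I, with value \<Sum> d \<otimes> z \<otimes> d', one sets
   r(... \<otimes> x_n \<otimes> l') = \<Sum> s(g(... \<otimes> d z \<otimes> 1)) d' l', which is right \<Lambda>-linear and lifts g. Applying
   \<sigma> to the first factor I, with value \<Sum> c \<otimes> y \<otimes> c', the map
   l \<otimes> x_1 \<otimes> ... \<mapsto> \<Sum> l c r(1 \<otimes> y c' \<otimes> ...) is a bimodule map and still lifts g. *)

theory Submission
  imports Defs
begin

section \<open>Additive maps\<close>

text \<open>A map out of a tensor product over \<open>C\<close> must be balanced at every tensor
  sign and linear at both ends, but the section s is only k-linear. The composite s g is still
  balanced everywhere, being a function of tensors; what it lacks is linearity, and taking an end
  factor out of its argument breaks the balancing next to that end. This is what \<sigma> repairs:
  it is a \<open>C\<close>-bimodule map, so an element of \<open>C\<close> standing beside the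
  expanded factor of \<open>I\<close> reappears in an outer entry of the value and passes from there
  to the neighbour, while the value itself lies in a tensor product over k, where k-linearity of s
  suffices. One expansion frees one end only, hence two steps; the second keeps the right linearity
  already gained. Both steps still lift g because \<Sum> c y c' = x when \<sigma> x = \<Sum> c
  \<otimes> y \<otimes> c'. Each step needs a factor from \<open>I\<close> to expand, which the
  terms with n \<ge> 1 have. Tensors are cosets in a free abelian group, not sums with chosen
  summands, so formulas on pure tensors enter through the universal property and carry a proof of
  balancing.\<close>

definition additive_maps :: "('m, 'x) ring_scheme \<Rightarrow> ('n, 'y) ring_scheme \<Rightarrow> ('m \<Rightarrow> 'n) set" where
  "additive_maps M N = {f \<in> carrier M \<rightarrow> carrier N.
     \<forall>x\<in>carrier M. \<forall>y\<in>carrier M. f (x \<oplus>\<^bsub>M\<^esub> y) = f x \<oplus>\<^bsub>N\<^esub> f y}"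

lemma additive_mapsI:
  assumes "\<And>x. x \<in> carrier M \<Longrightarrow> f x \<in> carrier N"
    and "\<And>x y. x \<in> carrier M \<Longrightarrow> y \<in> carrier M \<Longrightarrow> f (x \<oplus>\<^bsub>M\<^esub> y) = f x \<oplus>\<^bsub>N\<^esub> f y"
  shows "f \<in> additive_maps M N"
  using assms by (auto simp: additive_maps_def)

lemma additive_maps_closed: "f \<in> additive_maps M N \<Longrightarrow> x \<in> carrier M \<Longrightarrow> f x \<in> carrier N"
  by (auto simp: additive_maps_def)

lemma additive_maps_add:
  "f \<in> additive_maps M N \<Longrightarrow> x \<in> carrier M \<Longrightarrow> y \<in> carrier M \<Longrightarrow> f (x \<oplus>\<^bsub>M\<^esub> y) = f x \<oplus>\<^bsub>N\<^esub> f y"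
  by (auto simp: additive_maps_def)

lemma additive_maps_comp:
  "f \<in> additive_maps L M \<Longrightarrow> g \<in> additive_maps M N \<Longrightarrow> (\<lambda>x. g (f x)) \<in> additive_maps L N"
  by (auto simp: additive_maps_def Pi_iff)

lemma additive_maps_id: "(\<lambda>x. x) \<in> additive_maps M M"
  by (auto simp: additive_maps_def)

locale additive_map = M: abelian_group M + N: abelian_group N
  for M :: "('m, 'x) ring_scheme" (structure) and N :: "('n, 'y) ring_scheme" (structure) +
  fixes f :: "'m \<Rightarrow> 'n"
  assumes additive: "f \<in> additive_maps M N"
begin

lemma closed: "x \<in> carrier M \<Longrightarrow> f x \<in> carrier N"
  using additive by (rule additive_maps_closed)

lemma add: "x \<in> carrier M \<Longrightarrow> y \<in> carrier M \<Longrightarrow> f (x \<oplus>\<^bsub>M\<^esub> y) = f x \<oplus>\<^bsub>N\<^esub> f y"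
  using additive by (rule additive_maps_add)

sublocale hom: abelian_group_hom M N f
  by (rule abelian_group_homI)
    (auto simp: hom_def closed add intro!: M.abelian_group_axioms N.abelian_group_axioms group_hom.intro
      M.a_group N.a_group group_hom_axioms.intro)

lemma zero: "f \<zero>\<^bsub>M\<^esub> = \<zero>\<^bsub>N\<^esub>"
  by (rule hom.hom_zero)

lemma a_inv: "x \<in> carrier M \<Longrightarrow> f (\<ominus>\<^bsub>M\<^esub> x) = \<ominus>\<^bsub>N\<^esub> f x"
  by (rule hom.hom_a_inv)

lemma diff: "x \<in> carrier M \<Longrightarrow> y \<in> carrier M \<Longrightarrow> f (x \<ominus>\<^bsub>M\<^esub> y) = f x \<ominus>\<^bsub>N\<^esub> f y"
  by (simp add: a_minus_def add a_inv)

lemma finsum: "g \<in> A \<rightarrow> carrier M \<Longrightarrow> f (\<Oplus>\<^bsub>M\<^esub>i\<in>A. g i) = (\<Oplus>\<^bsub>N\<^esub>i\<in>A. f (g i))"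
proof (induction A rule: infinite_finite_induct)
  case (insert i A)
  then show ?case
    by (simp add: Pi_iff M.finsum_insert N.finsum_insert closed add)
qed (simp_all add: zero M.finsum_infinite N.finsum_infinite)

lemma int_mult: "x \<in> carrier M \<Longrightarrow> f ([(k::int)] \<cdot>\<^bsub>M\<^esub> x) = [k] \<cdot>\<^bsub>N\<^esub> f x"
  unfolding add_pow_def
  using hom.a_group_hom by (rule group_hom.hom_int_pow[simplified]) simp

end

section \<open>Linear extension\<close>

context abelian_group
begin

lemma int_mult_zero: "[(0::int)] \<cdot> x = \<zero>"
  by (simp add: add_pow_def)

text \<open>The map under the image in \<open>tensor_lift\<close>, named so that a tensor lift can
  be handled as the one value that this homomorphism takes on a coset.\<close>

definition frag_lift :: "('s \<Rightarrow> 'a) \<Rightarrow> ('s \<Rightarrow>\<^sub>0 int) \<Rightarrow> 'a" where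
  "frag_lift \<phi> c = (\<Oplus>s\<in>Poly_Mapping.keys c. [Poly_Mapping.lookup c s] \<cdot> \<phi> s)"

text \<open>Keys may cancel in a sum, so values are compared over a common finite superset, where
  each additional term is a zero multiple.\<close>

lemma frag_lift_superset:
  assumes "finite A" "Poly_Mapping.keys c \<subseteq> A" "\<phi> \<in> A \<rightarrow> carrier G"
  shows "frag_lift \<phi> c = (\<Oplus>s\<in>A. [Poly_Mapping.lookup c s] \<cdot> \<phi> s)"
  unfolding frag_lift_def
  using assms
  by (intro add.finprod_mono_neutral_cong_left)
    (auto simp: in_keys_iff int_mult_zero intro!: add.int_pow_closed)

lemma int_mult_closed: "x \<in> carrier G \<Longrightarrow> [(k::int)] \<cdot> x \<in> carrier G"
  by (rule add.int_pow_closed)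

lemma int_mult_add: "x \<in> carrier G \<Longrightarrow> [(k + l::int)] \<cdot> x = [k] \<cdot> x \<oplus> [l] \<cdot> x"
  by (rule add.int_pow_mult)

lemma int_mult_distrib:
  "x \<in> carrier G \<Longrightarrow> y \<in> carrier G \<Longrightarrow> [(k::int)] \<cdot> (x \<oplus> y) = [k] \<cdot> x \<oplus> [k] \<cdot> y"
  by (rule add.int_pow_distrib)

lemma int_mult_uminus: "x \<in> carrier G \<Longrightarrow> [(- k::int)] \<cdot> x = \<ominus> ([k] \<cdot> x)"
  by (rule add.int_pow_neg)

lemma int_mult_one: "x \<in> carrier G \<Longrightarrow> [(1::int)] \<cdot> x = x"
  by (rule add.int_pow_1)

lemma frag_lift_closed:
  "Poly_Mapping.keys c \<subseteq> S \<Longrightarrow> \<phi> \<in> S \<rightarrow> carrier G \<Longrightarrow> frag_lift \<phi> c \<in> carrier G"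
  unfolding frag_lift_def by (intro finsum_closed) (auto intro!: int_mult_closed)

lemma frag_lift_add:
  assumes "Poly_Mapping.keys c \<subseteq> S" "Poly_Mapping.keys d \<subseteq> S" "\<phi> \<in> S \<rightarrow> carrier G"
  shows "frag_lift \<phi> (c + d) = frag_lift \<phi> c \<oplus> frag_lift \<phi> d"
proof -
  let ?A = "Poly_Mapping.keys c \<union> Poly_Mapping.keys d"
  have \<phi>: "\<phi> \<in> ?A \<rightarrow> carrier G"
    using assms by auto
  have "frag_lift \<phi> (c + d) = (\<Oplus>s\<in>?A. [Poly_Mapping.lookup (c + d) s] \<cdot> \<phi> s)"
    using \<phi> by (intro frag_lift_superset) (auto dest: subsetD[OF keys_add])
  also have "\<dots> = (\<Oplus>s\<in>?A. [Poly_Mapping.lookup c s] \<cdot> \<phi> s \<oplus> [Poly_Mapping.lookup d s] \<cdot> \<phi> s)"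
    using \<phi> by (intro finsum_cong') (auto simp: lookup_add Pi_iff intro!: int_mult_add int_mult_closed)
  also have "\<dots> = (\<Oplus>s\<in>?A. [Poly_Mapping.lookup c s] \<cdot> \<phi> s) \<oplus> (\<Oplus>s\<in>?A. [Poly_Mapping.lookup d s] \<cdot> \<phi> s)"
    using \<phi> by (intro finsum_addf) (auto intro!: int_mult_closed)
  also have "\<dots> = frag_lift \<phi> c \<oplus> frag_lift \<phi> d"
    using \<phi> by (simp add: frag_lift_superset[of ?A])
  finally show ?thesis .
qed

lemma frag_lift_of: "\<phi> s \<in> carrier G \<Longrightarrow> frag_lift \<phi> (frag_of s) = \<phi> s"
  by (simp add: frag_lift_def finsum_insert[of "{}"] int_mult_one)

lemma frag_lift_hom:
  "\<phi> \<in> S \<rightarrow> carrier G \<Longrightarrow> frag_lift \<phi> \<in> hom (free_Abelian_group S) (add_monoid G)"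
  by (auto simp: hom_def frag_lift_closed frag_lift_add)

lemma frag_lift_diff:
  assumes "Poly_Mapping.keys c \<subseteq> S" "Poly_Mapping.keys d \<subseteq> S" "\<phi> \<in> S \<rightarrow> carrier G"
  shows "frag_lift \<phi> (c - d) = frag_lift \<phi> c \<ominus> frag_lift \<phi> d"
proof -
  have "Poly_Mapping.keys (c - d) \<subseteq> S"
    using assms keys_diff[of c d] by blast
  then have "frag_lift \<phi> c = frag_lift \<phi> (c - d) \<oplus> frag_lift \<phi> d"
    using frag_lift_add[of "c - d" S d \<phi>] assms by simp
  then show ?thesis
    using assms \<open>Poly_Mapping.keys (c - d) \<subseteq> S\<close> by (simp add: frag_lift_closed a_minus_def a_assoc r_neg)
qed

end

section \<open>Tensor products\<close>

lemma listset_iff: "xs \<in> listset Xs \<longleftrightarrow> list_all2 (\<in>) xs Xs"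
  by (induction Xs arbitrary: xs) (auto simp: set_Cons_def list_all2_Cons2)

text \<open>The conditions under which \<open>frag_lift \<phi>\<close> kills both families in
  \<open>tensor_relations\<close>. The set \<open>D\<close> is left open because tensor products
  over \<open>C\<close> and, with \<open>D\<close> the scalars, over k both occur.\<close>

definition multilinear :: "'a::ring set \<Rightarrow> 'a set list \<Rightarrow> ('m, 'x) ring_scheme \<Rightarrow> ('a list \<Rightarrow> 'm) \<Rightarrow> bool"
  where
  "multilinear D Xs M \<phi> \<longleftrightarrow>
     (\<forall>xs\<in>listset Xs. \<phi> xs \<in> carrier M) \<and>
     (\<forall>us x y vs. us @ x # vs \<in> listset Xs \<longrightarrow> us @ y # vs \<in> listset Xs \<longrightarrow>
        \<phi> (us @ (x + y) # vs) = \<phi> (us @ x # vs) \<oplus>\<^bsub>M\<^esub> \<phi> (us @ y # vs)) \<and>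
     (\<forall>us x c y vs. c \<in> D \<longrightarrow> us @ x # y # vs \<in> listset Xs \<longrightarrow>
        \<phi> (us @ (x * c) # y # vs) = \<phi> (us @ x # (c * y) # vs))"

lemma multilinearI:
  assumes "\<And>xs. xs \<in> listset Xs \<Longrightarrow> \<phi> xs \<in> carrier M"
    and "\<And>us x y vs. us @ x # vs \<in> listset Xs \<Longrightarrow> us @ y # vs \<in> listset Xs \<Longrightarrow>
        \<phi> (us @ (x + y) # vs) = \<phi> (us @ x # vs) \<oplus>\<^bsub>M\<^esub> \<phi> (us @ y # vs)"
    and "\<And>us x c y vs. c \<in> D \<Longrightarrow> us @ x # y # vs \<in> listset Xs \<Longrightarrow>
        \<phi> (us @ (x * c) # y # vs) = \<phi> (us @ x # (c * y) # vs)"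
  shows "multilinear D Xs M \<phi>"
  using assms unfolding multilinear_def by blast

lemma multilinear_closed: "multilinear D Xs M \<phi> \<Longrightarrow> xs \<in> listset Xs \<Longrightarrow> \<phi> xs \<in> carrier M"
  unfolding multilinear_def by blast

lemma multilinear_add:
  "multilinear D Xs M \<phi> \<Longrightarrow> us @ x # vs \<in> listset Xs \<Longrightarrow> us @ y # vs \<in> listset Xs \<Longrightarrow>
     \<phi> (us @ (x + y) # vs) = \<phi> (us @ x # vs) \<oplus>\<^bsub>M\<^esub> \<phi> (us @ y # vs)"
  unfolding multilinear_def by blast

lemma multilinear_balanced:
  "multilinear D Xs M \<phi> \<Longrightarrow> c \<in> D \<Longrightarrow> us @ x # y # vs \<in> listset Xs \<Longrightarrow>
     \<phi> (us @ (x * c) # y # vs) = \<phi> (us @ x # (c * y) # vs)"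
  unfolding multilinear_def by blast

lemma multilinear_comp:
  "multilinear D Xs M \<phi> \<Longrightarrow> f \<in> additive_maps M N \<Longrightarrow> multilinear D Xs N (\<lambda>xs. f (\<phi> xs))"
  unfolding multilinear_def by (auto simp: additive_maps_def Pi_iff)

lemma (in abelian_group) multilinear_int_mult:
  "multilinear D Xs G \<phi> \<Longrightarrow> multilinear D Xs G (\<lambda>xs. [(k::int)] \<cdot> \<phi> xs)"
  by (rule multilinear_comp, assumption, rule additive_mapsI)
    (auto intro: int_mult_closed int_mult_distrib)

lemma (in abelian_group) add_diff_diff:
  assumes "x \<in> carrier G" "y \<in> carrier G"
  shows "x \<oplus> y \<ominus> x \<ominus> y = \<zero>"
  using assms a_comm[of x y] by (simp add: minus_eq a_assoc r_neg)

lemma (in abelian_group) diff_eqI: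
  assumes "x \<in> carrier G" "y \<in> carrier G" "x \<oplus> y = z"
  shows "x = z \<ominus> y"
  using assms by (auto simp: minus_eq a_assoc r_neg)

lemma abelian_groupI_add_monoid:
  assumes "comm_group (add_monoid M)"
  shows "abelian_group M"
  using assms by (simp add: abelian_group_def abelian_group_axioms_def abelian_monoid_def comm_group_def)

section \<open>The tensor product as a quotient group, and induction over pure tensors\<close>

locale tensor_product =
  fixes D :: "'a::ring set" and Xs :: "'a set list"
  assumes factor_add: "X \<in> set Xs \<Longrightarrow> x \<in> X \<Longrightarrow> y \<in> X \<Longrightarrow> x + y \<in> X"
    and factor_left: "X \<in> set Xs \<Longrightarrow> x \<in> X \<Longrightarrow> c \<in> D \<Longrightarrow> c * x \<in> X"
    and factor_right: "X \<in> set Xs \<Longrightarrow> x \<in> X \<Longrightarrow> c \<in> D \<Longrightarrow> x * c \<in> X"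
begin

abbreviation T :: "'a tens ring" where "T \<equiv> tensor_group D Xs"
abbreviation F :: "('a list \<Rightarrow>\<^sub>0 int) monoid" where "F \<equiv> free_Abelian_group (listset Xs)"
abbreviation K :: "('a list \<Rightarrow>\<^sub>0 int) set" where "K \<equiv> tensor_kernel D Xs"
abbreviation pure :: "'a list \<Rightarrow> 'a tens" where "pure \<equiv> pure_tensor D Xs"

text \<open>The position of the entry is not tracked: whichever factor contains \<open>x\<close> is
  a member of \<open>Xs\<close>, so a closure property shared by all factors is enough.\<close>

lemma listset_update:
  assumes "us @ x # vs \<in> listset Xs" and "\<And>X. X \<in> set Xs \<Longrightarrow> x \<in> X \<Longrightarrow> y \<in> X"
  shows "us @ y # vs \<in> listset Xs"
proof -
  obtain Us X Vs where "Xs = Us @ X # Vs" "list_all2 (\<in>) us Us" "x \<in> X" "list_all2 (\<in>) vs Vs"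
    using assms(1) by (auto simp: listset_iff list_all2_append1 list_all2_Cons1)
  then show ?thesis
    using assms(2)[of X] by (simp add: listset_iff list_all2_appendI)
qed

lemma listset_add:
  assumes "us @ x # vs \<in> listset Xs" "us @ y # vs \<in> listset Xs"
  shows "us @ (x + y) # vs \<in> listset Xs"
proof -
  obtain Us X Vs where *: "Xs = Us @ X # Vs" "list_all2 (\<in>) us Us" "x \<in> X" "list_all2 (\<in>) vs Vs"
    using assms(1) by (auto simp: listset_iff list_all2_append1 list_all2_Cons1)
  then have "y \<in> X"
    using assms(2) by (auto simp: listset_iff list_all2_append dest: list_all2_lengthD)
  then show ?thesis
    using * factor_add[of X x y] by (simp add: listset_iff list_all2_appendI)
qed

lemma listset_right: "us @ x # vs \<in> listset Xs \<Longrightarrow> c \<in> D \<Longrightarrow> us @ (x * c) # vs \<in> listset Xs"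
  by (erule listset_update) (auto intro: factor_right)

lemma listset_left: "us @ x # vs \<in> listset Xs \<Longrightarrow> c \<in> D \<Longrightarrow> us @ (c * x) # vs \<in> listset Xs"
  by (erule listset_update) (auto intro: factor_left)

lemma relations_carrier: "tensor_relations D Xs \<subseteq> carrier F"
proof -
  have *: "us @ x # (c * y) # vs \<in> listset Xs" if "us @ x # y # vs \<in> listset Xs" "c \<in> D"
    for us x c y vs
    using listset_left[of "us @ [x]" y vs c] that by simp
  show ?thesis
    unfolding tensor_relations_def
    by (auto simp: listset_add listset_right * dest!: subsetD[OF keys_diff])
qed

lemma subgroup_K: "subgroup K F"
  unfolding tensor_kernel_def by (rule group.generate_is_subgroup[OF group_free_Abelian_group relations_carrier])

lemma add_monoid_T: "add_monoid T = F Mod K"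
  by (simp add: tensor_group_def Let_def FactGroup_def)

lemma abelian_group_T: "abelian_group T"
proof (rule abelian_groupI_add_monoid)
  show "comm_group (add_monoid T)"
    unfolding add_monoid_T by (rule comm_group.abelian_FactGroup[OF abelian_free_Abelian_group subgroup_K])
qed

sublocale T: abelian_group T
  by (rule abelian_group_T)

lemma normal_K: "K \<lhd> F"
  using comm_group.normal_iff_subgroup[OF abelian_free_Abelian_group] subgroup_K by blast

lemma K_subset: "K \<subseteq> carrier F"
  by (rule subgroup.subset[OF subgroup_K])

lemma frag_add_carrier: "c \<in> carrier F \<Longrightarrow> d \<in> carrier F \<Longrightarrow> c + d \<in> carrier F"
  using subsetD[OF keys_add[of c d]] by auto

lemma carrier_T: "carrier T = (\<lambda>c. K #>\<^bsub>F\<^esub> c) ` carrier F"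
  using arg_cong[OF add_monoid_T, of carrier] by (auto simp: FactGroup_def RCOSETS_def)

lemma coset_add:
  "c \<in> carrier F \<Longrightarrow> d \<in> carrier F \<Longrightarrow> K #>\<^bsub>F\<^esub> (c + d) = (K #>\<^bsub>F\<^esub> c) \<oplus>\<^bsub>T\<^esub> (K #>\<^bsub>F\<^esub> d)"
  using arg_cong[OF add_monoid_T, of mult] normal.rcos_sum[OF normal_K, of c d] by (simp add: FactGroup_def)

lemma coset_zero: "K #>\<^bsub>F\<^esub> 0 = \<zero>\<^bsub>T\<^esub>"
  using arg_cong[OF add_monoid_T, of one] group.coset_mult_one[OF group_free_Abelian_group K_subset] by (simp add: FactGroup_def)

lemma coset_kernel: "k \<in> K \<Longrightarrow> K #>\<^bsub>F\<^esub> k = \<zero>\<^bsub>T\<^esub>"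
  using group.coset_join2[OF group_free_Abelian_group _ subgroup_K, of k] subsetD[OF K_subset]
    group.coset_mult_one[OF group_free_Abelian_group K_subset] by (simp flip: coset_zero)

lemma coset_diff:
  assumes "c \<in> carrier F" "d \<in> carrier F"
  shows "K #>\<^bsub>F\<^esub> (c - d) = (K #>\<^bsub>F\<^esub> c) \<ominus>\<^bsub>T\<^esub> (K #>\<^bsub>F\<^esub> d)"
proof -
  have cd: "c - d \<in> carrier F"
    using assms keys_diff[of c d] by auto
  then have "(K #>\<^bsub>F\<^esub> (c - d)) \<oplus>\<^bsub>T\<^esub> (K #>\<^bsub>F\<^esub> d) = K #>\<^bsub>F\<^esub> c"
    using assms coset_add[of "c - d" d] by simp
  then show ?thesis
    using assms cd by (intro T.diff_eqI) (auto simp: carrier_T)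
qed

lemma coset_carrier: "c \<in> carrier F \<Longrightarrow> K #>\<^bsub>F\<^esub> c \<in> carrier T"
  by (auto simp: carrier_T)

lemma pure_closed: "xs \<in> listset Xs \<Longrightarrow> pure xs \<in> carrier T"
  by (auto simp: pure_tensor_def intro!: coset_carrier)

text \<open>Each defining relation lies in \<open>K\<close>, so its coset is zero; adding the
  subtracted terms back on both sides gives the identity.\<close>

lemma multilinear_pure: "multilinear D Xs T pure"
proof (rule multilinearI)
  fix us x y vs
  assume *: "us @ x # vs \<in> listset Xs" "us @ y # vs \<in> listset Xs"
  let ?a = "frag_of (us @ (x + y) # vs)"
  let ?b = "frag_of (us @ x # vs)"
  let ?c = "frag_of (us @ y # vs)"
  have "?a - ?b - ?c \<in> tensor_relations D Xs"
    unfolding tensor_relations_def using * by blast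
  then have k: "?a - ?b - ?c \<in> K"
    unfolding tensor_kernel_def by (rule generate.incl)
  moreover from k have "?a - ?b - ?c \<in> carrier F"
    using K_subset by blast
  moreover have "?b + ?c \<in> carrier F"
    using * by (intro frag_add_carrier) simp_all
  ultimately have "K #>\<^bsub>F\<^esub> (?a - ?b - ?c + (?b + ?c)) = \<zero>\<^bsub>T\<^esub> \<oplus>\<^bsub>T\<^esub> (K #>\<^bsub>F\<^esub> (?b + ?c))"
    by (simp only: coset_add coset_kernel)
  moreover have "?a - ?b - ?c + (?b + ?c) = ?a"
    by simp
  ultimately have "pure (us @ (x + y) # vs) = \<zero>\<^bsub>T\<^esub> \<oplus>\<^bsub>T\<^esub> (K #>\<^bsub>F\<^esub> (?b + ?c))"
    by (simp only: pure_tensor_def)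
  then show "pure (us @ (x + y) # vs) = pure (us @ x # vs) \<oplus>\<^bsub>T\<^esub> pure (us @ y # vs)"
    using * coset_add[of ?b ?c] \<open>?b + ?c \<in> carrier F\<close> coset_carrier[of "?b + ?c"]
    by (simp add: pure_tensor_def)
next
  fix us x c y vs
  assume *: "c \<in> D" "us @ x # y # vs \<in> listset Xs"
  let ?a = "frag_of (us @ (x * c) # y # vs)"
  let ?b = "frag_of (us @ x # (c * y) # vs)"
  have "?a - ?b \<in> tensor_relations D Xs"
    unfolding tensor_relations_def using * by blast
  then have k: "?a - ?b \<in> K"
    unfolding tensor_kernel_def by (rule generate.incl)
  moreover have b: "?b \<in> carrier F"
    using * listset_left[of "us @ [x]" y vs c] by simp
  moreover from k have "?a - ?b \<in> carrier F"
    using K_subset by blast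
  ultimately have "K #>\<^bsub>F\<^esub> (?a - ?b + ?b) = \<zero>\<^bsub>T\<^esub> \<oplus>\<^bsub>T\<^esub> (K #>\<^bsub>F\<^esub> ?b)"
    by (simp only: coset_add coset_kernel)
  moreover have "?a - ?b + ?b = ?a"
    by simp
  ultimately have "pure (us @ (x * c) # y # vs) = \<zero>\<^bsub>T\<^esub> \<oplus>\<^bsub>T\<^esub> pure (us @ x # (c * y) # vs)"
    by (simp only: pure_tensor_def)
  then show "pure (us @ (x * c) # y # vs) = pure (us @ x # (c * y) # vs)"
    using b coset_carrier[of ?b] by (simp add: pure_tensor_def)
qed (rule pure_closed)

lemmas pure_add = multilinear_add[OF multilinear_pure]
lemmas pure_balanced = multilinear_balanced[OF multilinear_pure]

text \<open>Pure tensors generate the group. Closure under differences instead of sums covers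
  negatives without a case of their own.\<close>

lemma tensor_induct [consumes 1, case_names pure zero diff]:
  assumes "q \<in> carrier T"
    and "\<And>xs. xs \<in> listset Xs \<Longrightarrow> P (pure xs)"
    and "P \<zero>\<^bsub>T\<^esub>"
    and "\<And>p q. p \<in> carrier T \<Longrightarrow> q \<in> carrier T \<Longrightarrow> P p \<Longrightarrow> P q \<Longrightarrow> P (p \<ominus>\<^bsub>T\<^esub> q)"
  shows "P q"
proof -
  obtain c where c: "Poly_Mapping.keys c \<subseteq> listset Xs" "q = K #>\<^bsub>F\<^esub> c"
    using assms(1) by (auto simp: carrier_T)
  have "P (K #>\<^bsub>F\<^esub> c)"
  proof (rule free_Abelian_group_induct[OF c(1), where P = "\<lambda>c. P (K #>\<^bsub>F\<^esub> c)"])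
    fix c d :: "'a list \<Rightarrow>\<^sub>0 int"
    assume "Poly_Mapping.keys c \<subseteq> listset Xs" "Poly_Mapping.keys d \<subseteq> listset Xs"
      "P (K #>\<^bsub>F\<^esub> c)" "P (K #>\<^bsub>F\<^esub> d)"
    then show "P (K #>\<^bsub>F\<^esub> (c - d))"
      using coset_carrier[of c] coset_carrier[of d] by (simp add: coset_diff assms(4))
  qed (auto simp: coset_zero assms(3) assms(2)[unfolded pure_tensor_def])
  then show ?thesis
    using c(2) by simp
qed

text \<open>The main tool for identities between maps on tensors, from the bimodule laws to the
  homotopy formula: once both sides are additive, a computation with lists remains.\<close>

lemma tensor_hom_eq:
  assumes "abelian_group M" "f \<in> additive_maps T M" "g \<in> additive_maps T M"
    and eq: "\<And>xs. xs \<in> listset Xs \<Longrightarrow> f (pure xs) = g (pure xs)"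
    and "q \<in> carrier T"
  shows "f q = g q"
proof -
  interpret f: additive_map T M f
    using assms by (simp add: additive_map_def additive_map_axioms_def T.abelian_group_axioms)
  interpret g: additive_map T M g
    using assms by (simp add: additive_map_def additive_map_axioms_def T.abelian_group_axioms)
  from \<open>q \<in> carrier T\<close> show ?thesis
    by (induction rule: tensor_induct) (simp_all add: eq f.zero g.zero f.diff g.diff)
qed

end

section \<open>The universal property of the tensor product\<close>

locale multilinear_map = tensor_product D Xs + M: abelian_group M
  for D :: "'a::ring set" and Xs :: "'a set list" and M :: "('m, 'x) ring_scheme" +
  fixes \<phi> :: "'a list \<Rightarrow> 'm"
  assumes \<phi>: "multilinear D Xs M \<phi>"
begin

lemma frag_lift_relation:
  assumes "r \<in> tensor_relations D Xs"
  shows "M.frag_lift \<phi> r = \<zero>\<^bsub>M\<^esub>"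
proof -
  have \<phi>_in: "\<phi> \<in> listset Xs \<rightarrow> carrier M"
    using \<phi> by (auto intro: multilinear_closed)
  note cl = multilinear_closed[OF \<phi>]
  consider us x y vs where "r = frag_of (us @ (x + y) # vs) - frag_of (us @ x # vs) - frag_of (us @ y # vs)"
      "us @ x # vs \<in> listset Xs" "us @ y # vs \<in> listset Xs"
    | us x c y vs where "r = frag_of (us @ (x * c) # y # vs) - frag_of (us @ x # (c * y) # vs)"
      "c \<in> D" "us @ x # y # vs \<in> listset Xs"
    using assms unfolding tensor_relations_def by blast
  then show ?thesis
  proof cases
    case 1
    have "Poly_Mapping.keys (frag_of (us @ (x + y) # vs) - frag_of (us @ x # vs)) \<subseteq> listset Xs"
      using 1 listset_add by (auto dest!: subsetD[OF keys_diff])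
    then show ?thesis
      using 1 listset_add[OF 1(2,3)] multilinear_add[OF \<phi> 1(2,3)]
      by (simp add: M.frag_lift_diff[OF _ _ \<phi>_in] M.frag_lift_of cl M.add_diff_diff)
  next
    case 2
    have *: "us @ x # (c * y) # vs \<in> listset Xs"
      using 2 listset_left[of "us @ [x]" y vs c] by simp
    then show ?thesis
      using 2 listset_right[OF 2(3,2)] multilinear_balanced[OF \<phi> 2(2,3)]
      by (simp add: M.frag_lift_diff[OF _ _ \<phi>_in] M.frag_lift_of cl M.minus_eq M.r_neg)
  qed
qed

text \<open>The homomorphism \<open>frag_lift \<phi>\<close> kills the relations, hence the subgroup
  \<open>K\<close> that they generate, so it is constant on each coset. Its image on a coset is thus
  a singleton, which gives \<open>the_elem\<close> its meaning.\<close>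

lemma tensor_lift_coset:
  assumes "c \<in> carrier F"
  shows "tensor_lift M \<phi> (K #>\<^bsub>F\<^esub> c) = M.frag_lift \<phi> c"
proof -
  have \<phi>_in: "\<phi> \<in> listset Xs \<rightarrow> carrier M"
    using \<phi> by (auto intro: multilinear_closed)
  have "group_hom F (add_monoid M) (M.frag_lift \<phi>)"
    by (intro group_hom.intro group_hom_axioms.intro group_free_Abelian_group M.a_group M.frag_lift_hom \<phi>_in)
  note ker = group_hom.subgroup_kernel[OF this]
  have "K \<subseteq> kernel F (add_monoid M) (M.frag_lift \<phi>)"
    unfolding tensor_kernel_def
  proof (rule group.generate_subgroup_incl[OF group_free_Abelian_group subsetI ker])
    fix r
    assume "r \<in> tensor_relations D Xs"
    then show "r \<in> kernel F (add_monoid M) (M.frag_lift \<phi>)"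
      using subsetD[OF relations_carrier] frag_lift_relation by (simp only: kernel_def) simp
  qed
  then have "M.frag_lift \<phi> (k + c) = M.frag_lift \<phi> c" if "k \<in> K" for k
    using that assms \<phi>_in by (auto simp: kernel_def M.frag_lift_add[OF _ _ \<phi>_in] M.frag_lift_closed)
  \<comment> \<open>An empty coset would have an empty image instead of a singleton.\<close>
  moreover have "K \<noteq> {}"
    using subgroup.one_closed[OF subgroup_K] by auto
  ultimately have "M.frag_lift \<phi> ` (K #>\<^bsub>F\<^esub> c) = {M.frag_lift \<phi> c}"
    by (auto simp: r_coset_def image_UN)
  then show ?thesis
    by (simp add: tensor_lift_def M.frag_lift_def[abs_def])
qed

lemma tensor_lift_pure: "xs \<in> listset Xs \<Longrightarrow> tensor_lift M \<phi> (pure xs) = \<phi> xs"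
  by (simp add: pure_tensor_def tensor_lift_coset M.frag_lift_of multilinear_closed[OF \<phi>])

lemma tensor_lift_additive: "tensor_lift M \<phi> \<in> additive_maps T M"
proof (rule additive_mapsI)
  have \<phi>_in: "\<phi> \<in> listset Xs \<rightarrow> carrier M"
    using \<phi> by (auto intro: multilinear_closed)
  fix p
  assume "p \<in> carrier T"
  then obtain c where c: "c \<in> carrier F" "p = K #>\<^bsub>F\<^esub> c"
    unfolding carrier_T by blast
  then show "tensor_lift M \<phi> p \<in> carrier M"
    by (simp add: tensor_lift_coset M.frag_lift_closed[OF _ \<phi>_in])
  fix q
  assume "q \<in> carrier T"
  then obtain d where d: "d \<in> carrier F" "q = K #>\<^bsub>F\<^esub> d"
    unfolding carrier_T by blast
  have cd: "c + d \<in> carrier F"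
    using c(1) d(1) by (rule frag_add_carrier)
  have "tensor_lift M \<phi> (p \<oplus>\<^bsub>T\<^esub> q) = M.frag_lift \<phi> (c + d)"
    using c d tensor_lift_coset[OF cd] coset_add[of c d] by simp
  also have "\<dots> = tensor_lift M \<phi> p \<oplus>\<^bsub>M\<^esub> tensor_lift M \<phi> q"
    using c d by (simp add: tensor_lift_coset M.frag_lift_add[OF _ _ \<phi>_in])
  finally show "tensor_lift M \<phi> (p \<oplus>\<^bsub>T\<^esub> q) = tensor_lift M \<phi> p \<oplus>\<^bsub>M\<^esub> tensor_lift M \<phi> q" .
qed

end

context tensor_product
begin

text \<open>The universal property with the group and the map as explicit premises, for use with
  many different \<open>M\<close> and \<open>\<phi>\<close>.\<close>

lemma
  assumes "abelian_group M" "multilinear D Xs M \<phi>"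
  shows lift_pure: "xs \<in> listset Xs \<Longrightarrow> tensor_lift M \<phi> (pure xs) = \<phi> xs"
    and lift_additive: "tensor_lift M \<phi> \<in> additive_maps T M"
proof -
  have *: "multilinear_map D Xs M \<phi>"
    using assms by (simp add: multilinear_map_def multilinear_map_axioms_def tensor_product_axioms)
  show "xs \<in> listset Xs \<Longrightarrow> tensor_lift M \<phi> (pure xs) = \<phi> xs"
    by (rule multilinear_map.tensor_lift_pure[OF *])
  show "tensor_lift M \<phi> \<in> additive_maps T M"
    by (rule multilinear_map.tensor_lift_additive[OF *])
qed

end

lemma (in abelian_group) multilinear_finsum:
  assumes "tensor_product D Xs" and \<phi>: "\<And>i. i \<in> A \<Longrightarrow> multilinear D Xs G (\<phi> i)"
  shows "multilinear D Xs G (\<lambda>xs. \<Oplus>i\<in>A. \<phi> i xs)"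
proof (rule multilinearI)
  fix us x y vs
  assume xs: "us @ x # vs \<in> listset Xs" "us @ y # vs \<in> listset Xs"
  then have "(\<Oplus>i\<in>A. \<phi> i (us @ (x + y) # vs)) = (\<Oplus>i\<in>A. \<phi> i (us @ x # vs) \<oplus> \<phi> i (us @ y # vs))"
    by (intro finsum_cong') (auto simp: multilinear_add[OF \<phi>] multilinear_closed[OF \<phi>])
  then show "(\<Oplus>i\<in>A. \<phi> i (us @ (x + y) # vs)) =
      (\<Oplus>i\<in>A. \<phi> i (us @ x # vs)) \<oplus> (\<Oplus>i\<in>A. \<phi> i (us @ y # vs))"
    using xs by (simp add: finsum_addf Pi_iff multilinear_closed[OF \<phi>])
next
  fix us x c y vs
  assume *: "c \<in> D" "us @ x # y # vs \<in> listset Xs"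
  then have "us @ x # (c * y) # vs \<in> listset Xs"
    using tensor_product.listset_left[OF assms(1), of "us @ [x]" y vs c] by simp
  moreover from * have "\<phi> i (us @ (x * c) # y # vs) = \<phi> i (us @ x # (c * y) # vs)" if "i \<in> A" for i
    using multilinear_balanced[OF \<phi>[OF that]] by simp
  ultimately show "(\<Oplus>i\<in>A. \<phi> i (us @ (x * c) # y # vs)) = (\<Oplus>i\<in>A. \<phi> i (us @ x # (c * y) # vs))"
    by (intro finsum_cong') (auto simp: multilinear_closed[OF \<phi>])
qed (auto simp: multilinear_closed[OF \<phi>] intro!: finsum_closed)

section \<open>Bimodules of tensors\<close>

text \<open>The bimodule record and the group record share their additive part, and all notions
  built from it agree. Facts proved for \<open>tensor_group\<close> therefore carry over by
  rewriting.\<close>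

lemma tensor_bimodule_simps [simp]:
  "carrier (tensor_bimodule D Xs) = carrier (tensor_group D Xs)"
  "add (tensor_bimodule D Xs) = add (tensor_group D Xs)"
  "zero (tensor_bimodule D Xs) = zero (tensor_group D Xs)"
  by (simp_all add: tensor_bimodule_def Let_def)

lemma tensor_bimodule_derived_simps [simp]:
  "a_inv (tensor_bimodule D Xs) = a_inv (tensor_group D Xs)"
  "a_minus (tensor_bimodule D Xs) = a_minus (tensor_group D Xs)"
  "finsum (tensor_bimodule D Xs) = finsum (tensor_group D Xs)"
  "add_pow (tensor_bimodule D Xs) = (add_pow (tensor_group D Xs) :: int \<Rightarrow> _ \<Rightarrow> _)"
  by (simp_all add: fun_eq_iff a_inv_def a_minus_def finsum_def add_pow_def m_inv_def finprod_def
      int_pow_def nat_pow_def Let_def)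

lemma tensor_bimodule_abelian_group [simp]:
  "abelian_group (tensor_bimodule D Xs) \<longleftrightarrow> abelian_group (tensor_group D Xs)"
  unfolding abelian_group_def abelian_group_axioms_def abelian_monoid_def comm_group_def group_def
    group_axioms_def comm_monoid_def comm_monoid_axioms_def monoid_def Units_def
  by simp

lemma additive_maps_tensor_bimodule [simp]:
  "additive_maps (tensor_bimodule D Xs) M = additive_maps (tensor_group D Xs) M"
  "additive_maps N (tensor_bimodule D Xs) = additive_maps N (tensor_group D Xs)"
  by (simp_all add: additive_maps_def)

lemma multilinear_tensor_bimodule [simp]:
  "multilinear D Xs (tensor_bimodule D' Ys) = multilinear D Xs (tensor_group D' Ys)"
  by (simp add: multilinear_def fun_eq_iff)

lemma tensor_lift_tensor_bimodule [simp]: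
  "tensor_lift (tensor_bimodule D Xs) = tensor_lift (tensor_group D Xs)"
  by (simp add: tensor_lift_def fun_eq_iff)

lemma bimodule_hom_iff:
  "f \<in> bimodule_hom A M N \<longleftrightarrow> f \<in> additive_maps M N \<and>
     (\<forall>a\<in>A. \<forall>x\<in>carrier M. f (lact M a x) = lact N a (f x) \<and> f (ract M x a) = ract N (f x) a)"
  by (auto simp: bimodule_hom_def additive_maps_def)

lemma bimodule_homI:
  assumes "f \<in> additive_maps M N"
    and "\<And>a x. a \<in> A \<Longrightarrow> x \<in> carrier M \<Longrightarrow> f (lact M a x) = lact N a (f x)"
    and "\<And>a x. a \<in> A \<Longrightarrow> x \<in> carrier M \<Longrightarrow> f (ract M x a) = ract N (f x) a"
  shows "f \<in> bimodule_hom A M N"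
  using assms by (simp add: bimodule_hom_iff)

lemma bimodule_hom_additive: "f \<in> bimodule_hom A M N \<Longrightarrow> f \<in> additive_maps M N"
  by (simp add: bimodule_hom_iff)

lemma bimodule_hom_lact:
  "f \<in> bimodule_hom A M N \<Longrightarrow> a \<in> A \<Longrightarrow> x \<in> carrier M \<Longrightarrow> f (lact M a x) = lact N a (f x)"
  by (simp add: bimodule_hom_iff)

lemma bimodule_hom_ract:
  "f \<in> bimodule_hom A M N \<Longrightarrow> a \<in> A \<Longrightarrow> x \<in> carrier M \<Longrightarrow> f (ract M x a) = ract N (f x) a"
  by (simp add: bimodule_hom_iff)

lemma (in bimodule) lact_additive: "a \<in> A \<Longrightarrow> lact M a \<in> additive_maps M M"
  by (rule additive_mapsI) (simp_all add: lact_closed lact_add)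

lemma (in bimodule) ract_additive: "a \<in> A \<Longrightarrow> (\<lambda>x. ract M x a) \<in> additive_maps M M"
  by (rule additive_mapsI) (simp_all add: ract_closed ract_add)

context k_algebra
begin

lemma scalar_commute: "scale c 1 * x = x * scale c 1"
  by (simp add: scale_mult_left scale_mult_right)

end

text \<open>Tensors are balanced over \<open>D\<close>, and \<open>A\<close> acts on the outer
  factors. There are three uses: the terms of the complex (\<open>D = C\<close>,
  \<open>A = UNIV\<close>), \<open>C \<otimes> I \<otimes> C\<close> over k (\<open>D\<close> the
  scalars, \<open>A = C\<close>), and \<open>C \<otimes>\<^sub>C I\<close>
  (\<open>D = A = C\<close>). The shape of \<open>Xs\<close> forces at least two factors, so the two
  actions change different entries.\<close>

locale bimodule_tensor = tensor_product D Xs + k_algebra scale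
  for scale :: "'k::field \<Rightarrow> 'a::{ring, monoid_mult} \<Rightarrow> 'a" and D :: "'a set" and Xs :: "'a set list" +
  fixes A :: "'a set" and X Z :: "'a set" and Ys :: "'a set list"
  assumes Xs_eq: "Xs = X # Ys @ [Z]"
    and scalar_D: "scale c 1 \<in> D" and scalar_A: "scale c 1 \<in> A"
    and A_add: "a \<in> A \<Longrightarrow> b \<in> A \<Longrightarrow> a + b \<in> A" and A_mult: "a \<in> A \<Longrightarrow> b \<in> A \<Longrightarrow> a * b \<in> A"
    and outer_left: "a \<in> A \<Longrightarrow> x \<in> X \<Longrightarrow> a * x \<in> X"
    and outer_right: "a \<in> A \<Longrightarrow> x \<in> Z \<Longrightarrow> x * a \<in> Z"
begin

abbreviation B :: "('a, 'a tens) bimodule" where "B \<equiv> tensor_bimodule D Xs"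

lemma listset_cases:
  assumes "xs \<in> listset Xs"
  obtains x ys z where "xs = x # ys @ [z]" "x \<in> X" "z \<in> Z" "ys \<in> listset Ys"
  using assms unfolding listset_iff Xs_eq by (auto simp: list_all2_Cons2 list_all2_append2)

lemma listset_lmult: "xs \<in> listset Xs \<Longrightarrow> a \<in> A \<Longrightarrow> (a * hd xs) # tl xs \<in> listset Xs"
  unfolding listset_iff Xs_eq by (auto simp: list_all2_Cons2 outer_left)

lemma listset_rmult:
  assumes "xs \<in> listset Xs" "a \<in> A"
  shows "butlast xs @ [last xs * a] \<in> listset Xs"
  using assms(1)
proof (rule listset_cases)
  fix x ys z
  assume "xs = x # ys @ [z]" "x \<in> X" "z \<in> Z" "ys \<in> listset Ys"
  then show ?thesis
    unfolding listset_iff Xs_eq using assms(2)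
    by (simp add: butlast_append list_all2_appendI outer_right)
qed

text \<open>The split on \<open>us\<close> asks whether the entry on which \<open>a\<close> acts is
  the varied one, where distributivity or associativity helps, or a bystander.\<close>

lemma multilinear_lmult:
  assumes "multilinear D Xs M \<phi>" "a \<in> A"
  shows "multilinear D Xs M (\<lambda>xs. \<phi> ((a * hd xs) # tl xs))"
proof (rule multilinearI)
  fix us x y vs
  assume *: "us @ x # vs \<in> listset Xs" "us @ y # vs \<in> listset Xs"
  then show "\<phi> ((a * hd (us @ (x + y) # vs)) # tl (us @ (x + y) # vs)) =
      \<phi> ((a * hd (us @ x # vs)) # tl (us @ x # vs)) \<oplus>\<^bsub>M\<^esub> \<phi> ((a * hd (us @ y # vs)) # tl (us @ y # vs))"
    using listset_lmult[OF *(1) assms(2)] listset_lmult[OF *(2) assms(2)]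
      multilinear_add[OF assms(1), of "[]" "a * x" vs "a * y"]
      multilinear_add[OF assms(1), of "(a * hd us) # tl us" x vs y]
    by (cases us) (simp_all add: distrib_left)
next
  fix us x c y vs
  assume *: "c \<in> D" "us @ x # y # vs \<in> listset Xs"
  then show "\<phi> ((a * hd (us @ (x * c) # y # vs)) # tl (us @ (x * c) # y # vs)) =
      \<phi> ((a * hd (us @ x # (c * y) # vs)) # tl (us @ x # (c * y) # vs))"
    using listset_lmult[OF *(2) assms(2)]
      multilinear_balanced[OF assms(1) *(1), of "[]" "a * x" y vs]
      multilinear_balanced[OF assms(1) *(1), of "(a * hd us) # tl us" x y vs]
    by (cases us) (simp_all add: mult.assoc)
qed (use multilinear_closed[OF assms(1)] listset_lmult[OF _ assms(2)] in auto)

lemma multilinear_rmult: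
  assumes "multilinear D Xs M \<phi>" "a \<in> A"
  shows "multilinear D Xs M (\<lambda>xs. \<phi> (butlast xs @ [last xs * a]))"
proof (rule multilinearI)
  fix us x y vs
  assume *: "us @ x # vs \<in> listset Xs" "us @ y # vs \<in> listset Xs"
  then show "\<phi> (butlast (us @ (x + y) # vs) @ [last (us @ (x + y) # vs) * a]) =
      \<phi> (butlast (us @ x # vs) @ [last (us @ x # vs) * a]) \<oplus>\<^bsub>M\<^esub>
      \<phi> (butlast (us @ y # vs) @ [last (us @ y # vs) * a])"
    using listset_rmult[OF *(1) assms(2)] listset_rmult[OF *(2) assms(2)]
      multilinear_add[OF assms(1), of us "x * a" "[]" "y * a"]
      multilinear_add[OF assms(1), of us x "butlast vs @ [last vs * a]" y]
    by (cases vs rule: rev_cases) (simp_all add: butlast_append distrib_right)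
next
  fix us x c y vs
  assume *: "c \<in> D" "us @ x # y # vs \<in> listset Xs"
  then show "\<phi> (butlast (us @ (x * c) # y # vs) @ [last (us @ (x * c) # y # vs) * a]) =
      \<phi> (butlast (us @ x # (c * y) # vs) @ [last (us @ x # (c * y) # vs) * a])"
    using listset_rmult[OF *(2) assms(2)]
      multilinear_balanced[OF assms(1) *(1), of us x "y * a" "[]"]
      multilinear_balanced[OF assms(1) *(1), of us x y "butlast vs @ [last vs * a]"]
    by (cases vs rule: rev_cases) (simp_all add: butlast_append mult.assoc)
qed (use multilinear_closed[OF assms(1)] listset_rmult[OF _ assms(2)] in auto)

lemma lact_B: "lact B a = tensor_lift T (\<lambda>xs. pure ((a * hd xs) # tl xs))"
  by (simp add: tensor_bimodule_def Let_def)

lemma ract_B: "ract B q a = tensor_lift T (\<lambda>xs. pure (butlast xs @ [last xs * a])) q"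
  by (simp add: tensor_bimodule_def Let_def)

lemma lact_B_additive: "a \<in> A \<Longrightarrow> lact B a \<in> additive_maps T T"
  unfolding lact_B by (intro lift_additive abelian_group_T multilinear_lmult multilinear_pure)

lemma ract_B_additive: "a \<in> A \<Longrightarrow> (\<lambda>q. ract B q a) \<in> additive_maps T T"
  unfolding ract_B by (intro lift_additive abelian_group_T multilinear_rmult multilinear_pure)

lemma lact_pure: "a \<in> A \<Longrightarrow> xs \<in> listset Xs \<Longrightarrow> lact B a (pure xs) = pure ((a * hd xs) # tl xs)"
  unfolding lact_B by (intro lift_pure abelian_group_T multilinear_lmult multilinear_pure)

lemma ract_pure: "a \<in> A \<Longrightarrow> xs \<in> listset Xs \<Longrightarrow> ract B (pure xs) a = pure (butlast xs @ [last xs * a])"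
  unfolding ract_B by (intro lift_pure abelian_group_T multilinear_rmult multilinear_pure)

text \<open>A scalar moves through all factors, one at a time.\<close>

lemma pure_scalar:
  "us @ x # vs \<in> listset Xs \<Longrightarrow>
     pure (us @ (scale c 1 * x) # vs) = pure (butlast (us @ x # vs) @ [last (us @ x # vs) * scale c 1])"
proof (induction vs arbitrary: us x)
  case Nil
  then show ?case
    by (simp add: butlast_append scalar_commute)
next
  case (Cons v vs)
  have "pure (us @ (scale c 1 * x) # v # vs) = pure ((us @ [x]) @ (scale c 1 * v) # vs)"
    using pure_balanced[OF scalar_D Cons.prems, of c] by (simp add: scalar_commute)
  also have "\<dots> = pure (butlast ((us @ [x]) @ v # vs) @ [last ((us @ [x]) @ v # vs) * scale c 1])"
    using Cons.prems by (intro Cons.IH) simp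
  finally show ?case
    by simp
qed

lemmas hom_eq = tensor_hom_eq[OF abelian_group_T]

lemma lact_closed': "a \<in> A \<Longrightarrow> q \<in> carrier T \<Longrightarrow> lact B a q \<in> carrier T"
  by (rule additive_maps_closed[OF lact_B_additive])

lemma ract_closed': "a \<in> A \<Longrightarrow> q \<in> carrier T \<Longrightarrow> ract B q a \<in> carrier T"
  by (rule additive_maps_closed[OF ract_B_additive])

lemma additive_maps_sum:
  assumes "f \<in> additive_maps T T" "g \<in> additive_maps T T"
  shows "(\<lambda>q. f q \<oplus>\<^bsub>T\<^esub> g q) \<in> additive_maps T T"
  using assms by (auto simp: additive_maps_def Pi_iff T.a_ac)


text \<open>Both sides of each law are additive in the tensor, so pure tensors suffice. There the
  laws hold by arithmetic in one outer entry, except centrality, where the scalar has to travel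
  through all factors (\<open>pure_scalar\<close>).\<close>

lemma bimodule_B: "bimodule scale A B"
proof (intro bimodule.intro bimodule_axioms.intro)
  show "abelian_group B"
    by (simp add: abelian_group_T)
next
  fix a q
  assume aq: "a \<in> A" "q \<in> carrier B"
  then show "lact B a q \<in> carrier B" "ract B q a \<in> carrier B"
    by (simp_all add: lact_closed' ract_closed')
  fix q'
  assume "q' \<in> carrier B"
  with aq show "lact B a (q \<oplus>\<^bsub>B\<^esub> q') = lact B a q \<oplus>\<^bsub>B\<^esub> lact B a q'"
    "ract B (q \<oplus>\<^bsub>B\<^esub> q') a = ract B q a \<oplus>\<^bsub>B\<^esub> ract B q' a"
    using additive_maps_add[OF lact_B_additive] additive_maps_add[OF ract_B_additive] by simp_all
next
  fix a b q
  assume ab: "a \<in> A" "b \<in> A" and q: "q \<in> carrier B"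
  have pq: "f q = g q" if "f \<in> additive_maps T T" "g \<in> additive_maps T T"
      "\<And>xs. xs \<in> listset Xs \<Longrightarrow> f (pure xs) = g (pure xs)" for f g
    using hom_eq[OF that] q by simp
  note ab' = A_add[OF ab] A_mult[OF ab]
  show "lact B (a + b) q = lact B a q \<oplus>\<^bsub>B\<^esub> lact B b q"
    unfolding tensor_bimodule_simps
  proof (rule pq)
    fix xs
    assume xs: "xs \<in> listset Xs"
    show "lact B (a + b) (pure xs) = lact B a (pure xs) \<oplus>\<^bsub>T\<^esub> lact B b (pure xs)"
      using pure_add[of "[]" "a * hd xs" "tl xs" "b * hd xs"] xs ab ab'
      by (simp add: lact_pure listset_lmult distrib_right)
  qed (intro lact_B_additive additive_maps_sum ab ab')+
  show "ract B q (a + b) = ract B q a \<oplus>\<^bsub>B\<^esub> ract B q b"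
    unfolding tensor_bimodule_simps
  proof (rule pq)
    fix xs
    assume xs: "xs \<in> listset Xs"
    show "ract B (pure xs) (a + b) = ract B (pure xs) a \<oplus>\<^bsub>T\<^esub> ract B (pure xs) b"
      using pure_add[of "butlast xs" "last xs * a" "[]" "last xs * b"] xs ab ab'
      by (simp add: ract_pure listset_rmult distrib_left)
  qed (intro ract_B_additive additive_maps_sum ab ab')+
  show "lact B (a * b) q = lact B a (lact B b q)"
    by (rule pq)
      (use ab ab' in \<open>simp_all add: lact_pure listset_lmult mult.assoc lact_B_additive
        additive_maps_comp[OF lact_B_additive lact_B_additive]\<close>)
  show "ract B q (a * b) = ract B (ract B q a) b"
    by (rule pq)
      (use ab ab' in \<open>simp_all add: ract_pure listset_rmult mult.assoc ract_B_additive
        additive_maps_comp[OF ract_B_additive ract_B_additive]\<close>)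
  show "ract B (lact B a q) b = lact B a (ract B q b)"
  proof (rule pq)
    fix xs
    assume xs: "xs \<in> listset Xs"
    then obtain x ys z where "xs = x # ys @ [z]"
      by (rule listset_cases)
    then show "ract B (lact B a (pure xs)) b = lact B a (ract B (pure xs) b)"
      using xs ab listset_lmult[OF xs ab(1)] listset_rmult[OF xs ab(2)]
      by (simp add: lact_pure ract_pure butlast_append)
  qed (intro additive_maps_comp[OF lact_B_additive ract_B_additive]
      additive_maps_comp[OF ract_B_additive lact_B_additive] ab)+
next
  fix q
  assume q: "q \<in> carrier B"
  have pq: "f q = g q" if "f \<in> additive_maps T T" "g \<in> additive_maps T T"
      "\<And>xs. xs \<in> listset Xs \<Longrightarrow> f (pure xs) = g (pure xs)" for f g
    using hom_eq[OF that] q by simp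
  have ne: "xs \<noteq> []" if "xs \<in> listset Xs" for xs
    using that by (auto elim: listset_cases)
  have one: "1 \<in> A"
    using scalar_A[of 1] by simp
  show "lact B 1 q = q"
    by (rule pq[OF lact_B_additive[OF one] additive_maps_id]) (simp add: lact_pure one ne)
  show "ract B q 1 = q"
    by (rule pq[OF ract_B_additive[OF one] additive_maps_id]) (simp add: ract_pure one ne)
  fix c
  show "lact B (scale c 1) q = ract B q (scale c 1)"
  proof (rule pq[OF lact_B_additive[OF scalar_A] ract_B_additive[OF scalar_A]])
    fix xs
    assume xs: "xs \<in> listset Xs"
    then show "lact B (scale c 1) (pure xs) = ract B (pure xs) (scale c 1)"
      using pure_scalar[of "[]" "hd xs" "tl xs" c] ne[OF xs] by (simp add: lact_pure ract_pure scalar_A)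
  qed
qed


lemma additive_bimodule_hom:
  assumes "bimodule scale A N" "f \<in> additive_maps T N"
    and "\<And>a xs. a \<in> A \<Longrightarrow> xs \<in> listset Xs \<Longrightarrow> f (pure ((a * hd xs) # tl xs)) = lact N a (f (pure xs))"
    and "\<And>a xs. a \<in> A \<Longrightarrow> xs \<in> listset Xs \<Longrightarrow>
      f (pure (butlast xs @ [last xs * a])) = ract N (f (pure xs)) a"
  shows "f \<in> bimodule_hom A B N"
proof -
  interpret N: bimodule scale A N
    by fact
  show ?thesis
  proof (rule bimodule_homI)
    show "f \<in> additive_maps B N"
      using assms(2) by simp
    fix a q
    assume a: "a \<in> A" and q: "q \<in> carrier B"
    then have q': "q \<in> carrier T"
      by simp
    show "f (lact B a q) = lact N a (f q)"
      by (rule tensor_hom_eq[OF N.abelian_group_axioms _ _ _ q'])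
        (simp_all add: additive_maps_comp[OF lact_B_additive[OF a] assms(2)]
          additive_maps_comp[OF assms(2) N.lact_additive[OF a]] lact_pure[OF a] assms(3)[OF a])
    show "f (ract B q a) = ract N (f q) a"
      by (rule tensor_hom_eq[OF N.abelian_group_axioms _ _ _ q'])
        (simp_all add: additive_maps_comp[OF ract_B_additive[OF a] assms(2)]
          additive_maps_comp[OF assms(2) N.ract_additive[OF a]] ract_pure[OF a] assms(4)[OF a])
  qed
qed

lemma lift_bimodule_hom:
  assumes "bimodule scale A N" "multilinear D Xs N \<phi>"
    and "\<And>a xs. a \<in> A \<Longrightarrow> xs \<in> listset Xs \<Longrightarrow> \<phi> ((a * hd xs) # tl xs) = lact N a (\<phi> xs)"
    and "\<And>a xs. a \<in> A \<Longrightarrow> xs \<in> listset Xs \<Longrightarrow> \<phi> (butlast xs @ [last xs * a]) = ract N (\<phi> xs) a"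
  shows "tensor_lift N \<phi> \<in> bimodule_hom A B N"
proof -
  have N: "abelian_group N"
    using assms(1) by (simp add: bimodule_def)
  show ?thesis
    using assms(3,4)
    by (intro additive_bimodule_hom lift_additive assms(1,2) N)
      (simp_all add: lift_pure[OF N assms(2)] listset_lmult listset_rmult)
qed

end

section \<open>Alternating sums\<close>

context abelian_group
begin

abbreviation alternating_sum :: "nat \<Rightarrow> (nat \<Rightarrow> 'a) \<Rightarrow> 'a" where
  "alternating_sum n f \<equiv> (\<Oplus>i\<in>{0..n}. [((- 1) ^ i :: int)] \<cdot> f i)"

lemma a_inv_zero: "\<ominus> \<zero> = \<zero>"
proof -
  have "\<ominus> \<zero> = \<zero> \<oplus> \<ominus> \<zero>"
    by (rule l_zero[OF a_inv_closed[OF zero_closed], symmetric])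
  then show ?thesis
    by (simp only: r_neg[OF zero_closed])
qed

lemma finsum_a_inv: "f \<in> A \<rightarrow> carrier G \<Longrightarrow> (\<Oplus>i\<in>A. \<ominus> f i) = \<ominus> (\<Oplus>i\<in>A. f i)"
proof (induction A rule: infinite_finite_induct)
  case (insert i A)
  then show ?case
    by (simp add: Pi_iff finsum_insert minus_add)
qed (simp_all add: finsum_infinite a_inv_zero)

lemma alternating_sum_0: "f 0 \<in> carrier G \<Longrightarrow> alternating_sum 0 f = f 0"
  by (simp add: finsum_insert[of "{}"] int_mult_one)

text \<open>Shifting the index flips every sign. Peeling from the front suits the homotopy, which
  inserts its new factors there.\<close>

lemma alternating_sum_Suc:
  assumes "\<And>i. i \<le> Suc n \<Longrightarrow> f i \<in> carrier G"
  shows "alternating_sum (Suc n) f = f 0 \<ominus> alternating_sum n (\<lambda>i. f (Suc i))"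
proof -
  have "alternating_sum (Suc n) f = (\<Oplus>i\<in>{0..n}. [((- 1) ^ Suc i :: int)] \<cdot> f (Suc i)) \<oplus> f 0"
    using assms finsum_Suc2[of "\<lambda>i. [((- 1) ^ i :: int)] \<cdot> f i" n]
    by (simp add: atLeast0AtMost Pi_iff int_mult_closed int_mult_one)
  also have "(\<Oplus>i\<in>{0..n}. [((- 1) ^ Suc i :: int)] \<cdot> f (Suc i)) = (\<Oplus>i\<in>{0..n}. \<ominus> ([((- 1) ^ i :: int)] \<cdot> f (Suc i)))"
    using assms by (intro finsum_cong') (auto simp: int_mult_uminus intro!: int_mult_closed)
  also have "\<dots> = \<ominus> alternating_sum n (\<lambda>i. f (Suc i))"
    using assms by (intro finsum_a_inv) (auto intro: int_mult_closed)
  finally show ?thesis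
    using assms by (simp add: minus_eq a_comm Pi_iff int_mult_closed)
qed

lemma alternating_sum_closed:
  "(\<And>i. i \<le> n \<Longrightarrow> f i \<in> carrier G) \<Longrightarrow> alternating_sum n f \<in> carrier G"
  by (intro finsum_closed) (auto intro: int_mult_closed)

lemma alternating_sum_cong:
  "(\<And>i. i \<le> n \<Longrightarrow> f i = g i) \<Longrightarrow> (\<And>i. i \<le> n \<Longrightarrow> g i \<in> carrier G) \<Longrightarrow>
     alternating_sum n f = alternating_sum n g"
  by (intro finsum_cong') (auto intro: int_mult_closed)

text \<open>The bookkeeping of d h + h d: \<open>a\<close> and \<open>b\<close> are the two leading
  terms of d h, \<open>c\<close> is the leading term of h d, and the common tail \<open>s\<close>
  occurs in them with opposite signs.\<close>

lemma homotopy_cancel: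
  assumes "a \<in> carrier G" "b \<in> carrier G" "c \<in> carrier G" "s \<in> carrier G"
  shows "(a \<ominus> (b \<ominus> s)) \<oplus> (c \<ominus> s) = (a \<ominus> b) \<oplus> c"
proof -
  have "a \<ominus> (b \<ominus> s) = (a \<ominus> b) \<oplus> s"
    using assms by (simp add: minus_eq minus_add a_assoc minus_minus)
  moreover have "s \<oplus> (c \<ominus> s) = c"
    using assms by (simp add: minus_eq a_lcomm[of s c] r_neg)
  ultimately show ?thesis
    using assms by (simp add: a_assoc)
qed

end

lemma (in additive_map) alternating_sum:
  assumes "\<And>i. i \<le> n \<Longrightarrow> g i \<in> carrier M"
  shows "f (M.alternating_sum n g) = N.alternating_sum n (\<lambda>i. f (g i))"
proof -
  have "f (M.alternating_sum n g) = (\<Oplus>\<^bsub>N\<^esub>i\<in>{0..n}. f ([((- 1) ^ i :: int)] \<cdot>\<^bsub>M\<^esub> g i))"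
    using assms by (intro finsum) (auto intro: M.int_mult_closed)
  also have "\<dots> = N.alternating_sum n (\<lambda>i. f (g i))"
    using assms by (intro N.finsum_cong') (auto simp: int_mult closed intro!: N.int_mult_closed)
  finally show ?thesis .
qed

section \<open>Merging adjacent factors\<close>

lemma merge_at: "length us = i \<Longrightarrow> merge i (us @ a # b # vs) = us @ (a * b) # vs"
  by (auto simp: merge_def nth_append)

lemma merge_before: "Suc i < length us \<Longrightarrow> merge i (us @ vs) = merge i us @ vs"
  by (simp add: merge_def nth_append)

lemma merge_after: "length us \<le> i \<Longrightarrow> merge i (us @ vs) = us @ merge (i - length us) vs"
  by (auto simp: merge_def nth_append Suc_diff_le)

lemma merge_Cons: "merge (Suc i) (x # xs) = x # merge i xs"
  by (simp add: merge_def)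

lemma length_merge: "Suc i < length xs \<Longrightarrow> length (merge i xs) = length xs - 1"
  by (simp add: merge_def)

lemma nth_merge:
  assumes "Suc i < length xs" "Suc j < length xs"
  shows "merge i xs ! j = (if j < i then xs ! j else if j = i then xs ! i * xs ! Suc i else xs ! Suc j)"
  using assms by (auto simp: merge_def nth_append nth_Cons' Suc_diff_le)

lemma split_at:
  assumes "Suc i < length xs"
  obtains us a b vs where "xs = us @ a # b # vs" "length us = i"
  using assms Cons_nth_drop_Suc[of i xs] Cons_nth_drop_Suc[of "Suc i" xs]
  by (metis Suc_lessD append_take_drop_id length_take min.absorb4)

section \<open>The bar complex\<close>

text \<open>Entries 0 and n + 1 range over the whole algebra, so only the length and the inner
  entries are constrained. In this form membership after a merge is a computation with
  indices.\<close>

lemma bar_listset_iff: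
  "xs \<in> listset (bar_factors I n) \<longleftrightarrow> length xs = n + 2 \<and> (\<forall>i. 1 \<le> i \<longrightarrow> i \<le> n \<longrightarrow> xs ! i \<in> I)"
proof -
  have "bar_factors I n ! i = (if 1 \<le> i \<and> i \<le> n then I else UNIV)" if "i < n + 2" for i
    using that by (cases i) (auto simp: bar_factors_def nth_append)
  then show ?thesis
    unfolding listset_iff list_all2_conv_all_nth by (auto simp: bar_factors_def)
      (erule_tac x = i in allE, simp)
qed

context cleft_extension
begin

lemma subspace_C: "subspace C" and one_C: "1 \<in> C" and mult_C: "x \<in> C \<Longrightarrow> y \<in> C \<Longrightarrow> x * y \<in> C"
  using subalgebra_C by (auto simp: subalgebra_def)

lemma subspace_I: "subspace I" and mult_I_left: "x \<in> I \<Longrightarrow> l * x \<in> I"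
  and mult_I_right: "x \<in> I \<Longrightarrow> x * l \<in> I"
  using two_sided_ideal_I by (auto simp: two_sided_ideal_def)

lemma scalar_C: "scale c 1 \<in> C"
  by (rule subspace_scale[OF subspace_C one_C])

section \<open>The terms of the complex and the differential as a bimodule map\<close>

lemma bimodule_tensor_bar:
  "bimodule_tensor scale C (bar_factors I n) UNIV UNIV UNIV (replicate n I)"
proof unfold_locales
  fix X x y c
  assume X: "X \<in> set (bar_factors I n)" "x \<in> X"
  then have "X = UNIV \<or> X = I"
    by (auto simp: bar_factors_def)
  with X show "y \<in> X \<Longrightarrow> x + y \<in> X" "c * x \<in> X" "x * c \<in> X"
    by (auto simp: subspace_add[OF subspace_I] mult_I_left mult_I_right)
qed (auto simp: bar_factors_def scalar_C)

interpretation P: bimodule_tensor scale C "bar_factors I n" UNIV UNIV UNIV "replicate n I" for n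
  by (rule bimodule_tensor_bar)

abbreviation T :: "nat \<Rightarrow> 'a tens ring" where "T n \<equiv> tensor_group C (bar_factors I n)"
abbreviation tau :: "nat \<Rightarrow> 'a list \<Rightarrow> 'a tens" where "tau n \<equiv> pure_tensor C (bar_factors I n)"

text \<open>Interior merges stay inside the ideal; the two extreme merges produce a new outer entry,
  where every element is allowed.\<close>

lemma merge_listset:
  "xs \<in> listset (bar_factors I (Suc n)) \<Longrightarrow> i \<le> Suc n \<Longrightarrow> merge i xs \<in> listset (bar_factors I n)"
  by (auto simp: bar_listset_iff length_merge nth_merge mult_I_left)

text \<open>The cases compare the merged pair with the entries that vary. Away from them, additivity
  and balancing of the shorter tensor apply directly; where one varying entry is merged,
  distributivity or associativity comes first. If the two entries between which \<open>c\<close>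
  moves are merged with each other, associativity alone suffices.\<close>

lemma multilinear_merge:
  assumes i: "i \<le> Suc n"
  shows "multilinear C (bar_factors I (Suc n)) (T n) (\<lambda>xs. tau n (merge i xs))"
proof (rule multilinearI)
  fix us x y vs
  assume x: "us @ x # vs \<in> listset (bar_factors I (Suc n))"
    and y: "us @ y # vs \<in> listset (bar_factors I (Suc n))"
  note m = merge_listset[OF x i] merge_listset[OF y i]
  have len: "length us + length vs = n + 2"
    using x by (simp add: bar_listset_iff)
  consider "Suc i < length us" | us' u where "us = us' @ [u]" "length us' = i"
    | v vs' where "i = length us" "vs = v # vs'" | "length us < i"
    using i len by (cases us rule: rev_cases; cases vs) force+
  then show "tau n (merge i (us @ (x + y) # vs)) =
      tau n (merge i (us @ x # vs)) \<oplus>\<^bsub>T n\<^esub> tau n (merge i (us @ y # vs))"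
  proof cases
    case 1
    then show ?thesis
      using P.pure_add[of "merge i us" x vs n y] m by (simp add: merge_before)
  next
    case 2
    then show ?thesis
      using P.pure_add[of us' "u * x" vs n "u * y"] m by (simp add: merge_at distrib_left)
  next
    case 3
    then show ?thesis
      using P.pure_add[of us "x * v" vs' n "y * v"] m by (simp add: merge_at distrib_right)
  next
    case 4
    then have "Suc (length us) \<le> i"
      by simp
    with merge_after[of "us @ [z]" i vs for z] show ?thesis
      using P.pure_add[of us x "merge (i - Suc (length us)) vs" n y] m by simp
  qed
next
  fix us x c y vs
  assume c: "c \<in> C" and x: "us @ x # y # vs \<in> listset (bar_factors I (Suc n))"
  note m = merge_listset[OF x i]
  have len: "length us + length vs = n + 1"
    using x by (simp add: bar_listset_iff)
  consider "Suc i < length us" | us' u where "us = us' @ [u]" "length us' = i"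
    | "i = length us" | v vs' where "i = Suc (length us)" "vs = v # vs'" | "Suc (length us) < i"
    using i len by (cases us rule: rev_cases; cases vs) force+
  then show "tau n (merge i (us @ (x * c) # y # vs)) = tau n (merge i (us @ x # (c * y) # vs))"
  proof cases
    case 1
    then show ?thesis
      using P.pure_balanced[OF c, of "merge i us" x y vs n] m by (simp add: merge_before)
  next
    case 2
    then show ?thesis
      using P.pure_balanced[OF c, of us' "u * x" y vs n] m by (simp add: merge_at mult.assoc)
  next
    case 3
    then show ?thesis
      by (simp add: merge_at mult.assoc)
  next
    case 4
    then show ?thesis
      using P.pure_balanced[OF c, of us x "y * v" vs' n] m
        merge_at[of "us @ [z]" i a v vs' for z a] by (simp add: mult.assoc)
  next
    case 5
    then have "Suc (Suc (length us)) \<le> i"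
      by simp
    with merge_after[of "us @ [a, b]" i vs for a b] show ?thesis
      using P.pure_balanced[OF c, of us x y "merge (i - Suc (Suc (length us))) vs" n] m by simp
  qed
qed (use merge_listset[OF _ i] P.pure_closed in auto)

lemma bar_diff_Suc:
  "bar_diff C I (Suc n) = tensor_lift (T n) (\<lambda>xs. P.T.alternating_sum n (Suc n) (\<lambda>i. tau n (merge i xs)))"
  by (simp add: bar_diff_def bar_bimodule_def)

lemma multilinear_bar:
  "multilinear C (bar_factors I (Suc n)) (T n)
     (\<lambda>xs. P.T.alternating_sum n (Suc n) (\<lambda>i. tau n (merge i xs)))"
  by (intro P.T.multilinear_finsum P.tensor_product_axioms P.T.multilinear_int_mult multilinear_merge) simp

lemma bar_diff_additive: "bar_diff C I (Suc n) \<in> additive_maps (T (Suc n)) (T n)"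
  unfolding bar_diff_Suc by (intro P.lift_additive P.abelian_group_T multilinear_bar)

lemma bar_diff_tau:
  "xs \<in> listset (bar_factors I (Suc n)) \<Longrightarrow>
     bar_diff C I (Suc n) (tau (Suc n) xs) = P.T.alternating_sum n (Suc n) (\<lambda>i. tau n (merge i xs))"
  unfolding bar_diff_Suc by (intro P.lift_pure P.abelian_group_T multilinear_bar)


lemma merge_lmult: "Suc i < length xs \<Longrightarrow> merge i ((a * hd xs) # tl xs) = (a * hd (merge i xs)) # tl (merge i xs)"
  for a :: 'a
  by (rule split_at, assumption) (auto simp: merge_def mult.assoc neq_Nil_conv nth_append hd_append)

lemma merge_rmult:
  fixes a :: 'a
  assumes "Suc i < length xs"
  shows "merge i (butlast xs @ [last xs * a]) = butlast (merge i xs) @ [last (merge i xs) * a]"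
proof -
  obtain us u v vs where *: "xs = us @ u # v # vs" "length us = i"
    using assms by (rule split_at)
  then show ?thesis
    using merge_at[of us i u v vs] merge_at[of us i u v "butlast vs @ [last vs * a]"]
      merge_at[of us i u "v * a" "[]"]
    by (cases vs rule: rev_cases) (simp_all add: butlast_append mult.assoc)
qed

lemma bar_length: "xs \<in> listset (bar_factors I n) \<Longrightarrow> length xs = n + 2"
  by (simp add: bar_listset_iff)

lemma additive_map_T:
  "f \<in> additive_maps (T m) (T n) \<Longrightarrow> additive_map (T m) (T n) f"
  by (simp add: additive_map_def additive_map_axioms_def P.abelian_group_T)

text \<open>Every merge commutes with the outer actions, by associativity when it touches an end, so
  linearity holds summand by summand.\<close>

lemma bar_diff_hom:
  "bar_diff C I (Suc n) \<in> bimodule_hom UNIV (bar_bimodule C I (Suc n)) (bar_bimodule C I n)"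
proof -
  have "tensor_lift (P.B n) (\<lambda>xs. P.T.alternating_sum n (Suc n) (\<lambda>i. tau n (merge i xs))) \<in>
      bimodule_hom UNIV (P.B (Suc n)) (P.B n)"
  proof (rule P.lift_bimodule_hom[OF P.bimodule_B])
    fix a xs
    assume xs: "xs \<in> listset (bar_factors I (Suc n))"
    have m: "merge i xs \<in> listset (bar_factors I n)" "Suc i < length xs" if "i \<le> Suc n" for i
      using that merge_listset[OF xs] bar_length[OF xs] by simp_all
    interpret l: additive_map "T n" "T n" "lact (P.B n) a"
      by (intro additive_map_T P.lact_B_additive) simp
    interpret r: additive_map "T n" "T n" "\<lambda>q. ract (P.B n) q a"
      by (intro additive_map_T P.ract_B_additive) simp
    show "P.T.alternating_sum n (Suc n) (\<lambda>i. tau n (merge i ((a * hd xs) # tl xs))) =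
        lact (P.B n) a (P.T.alternating_sum n (Suc n) (\<lambda>i. tau n (merge i xs)))"
      using m by (subst l.alternating_sum)
        (auto intro!: P.T.alternating_sum_cong P.pure_closed l.closed simp: P.lact_pure merge_lmult
          simp flip: P.lact_pure)
    show "P.T.alternating_sum n (Suc n) (\<lambda>i. tau n (merge i (butlast xs @ [last xs * a]))) =
        ract (P.B n) (P.T.alternating_sum n (Suc n) (\<lambda>i. tau n (merge i xs))) a"
      using m by (subst r.alternating_sum)
        (auto intro!: P.T.alternating_sum_cong P.pure_closed r.closed simp: merge_rmult P.ract_pure
          simp flip: P.ract_pure)
  qed (simp add: multilinear_bar)
  then show ?thesis
    by (simp add: bar_diff_Suc bar_bimodule_def)
qed

subsection \<open>The product map\<close>

lemma bimodule_UNIV: "bimodule scale UNIV (sub_bimodule UNIV)"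
proof -
  have "comm_group (add_monoid (sub_bimodule (UNIV :: 'a set)))"
    by (rule comm_groupI) (auto simp: sub_bimodule_def add.assoc add.commute intro: exI[of _ "- x" for x])
  then have "abelian_group (sub_bimodule (UNIV :: 'a set))"
    by (rule abelian_groupI_add_monoid)
  then show ?thesis
    by (simp add: bimodule_def bimodule_axioms_def sub_bimodule_def distrib_left distrib_right mult.assoc
        scalar_commute)
qed

lemmas abelian_group_UNIV = bimodule.axioms(1)[OF bimodule_UNIV]

lemma multilinear_product:
  "multilinear C (bar_factors I 0) (sub_bimodule (UNIV :: 'a set)) (\<lambda>xs. xs ! 0 * xs ! 1)"
proof (rule multilinearI)
  fix us x y and vs :: "'a list"
  assume "us @ x # vs \<in> listset (bar_factors I 0)"
  then have "length us + length vs = 1"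
    by (simp add: bar_listset_iff)
  then show "(us @ (x + y) # vs) ! 0 * (us @ (x + y) # vs) ! 1 =
      (us @ x # vs) ! 0 * (us @ x # vs) ! 1 \<oplus>\<^bsub>sub_bimodule UNIV\<^esub> (us @ y # vs) ! 0 * (us @ y # vs) ! 1"
    by (cases us; cases vs) (auto simp: sub_bimodule_def distrib_left distrib_right)
next
  fix us x c y and vs :: "'a list"
  assume "us @ x # y # vs \<in> listset (bar_factors I 0)"
  then have "us = [] \<and> vs = []"
    by (simp add: bar_listset_iff)
  then show "(us @ (x * c) # y # vs) ! 0 * (us @ (x * c) # y # vs) ! 1 =
      (us @ x # (c * y) # vs) ! 0 * (us @ x # (c * y) # vs) ! 1"
    by (simp add: mult.assoc)
qed (simp add: sub_bimodule_def)

lemma product_additive: "product_map \<in> additive_maps (T 0) (sub_bimodule UNIV)"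
  unfolding product_map_def by (intro P.lift_additive abelian_group_UNIV multilinear_product)

lemma product_tau: "product_map (tau 0 [x, y]) = x * y"
  unfolding product_map_def
  by (subst P.lift_pure[OF abelian_group_UNIV multilinear_product]) (simp_all add: bar_listset_iff)

lemma bar_0_cases:
  assumes "xs \<in> listset (bar_factors I 0)"
  obtains x y where "xs = [x, y]"
  using assms by (auto simp: bar_listset_iff length_Suc_conv)

lemma product_hom: "product_map \<in> bimodule_hom UNIV (P.B 0) (sub_bimodule UNIV)"
  by (rule P.additive_bimodule_hom[OF bimodule_UNIV product_additive])
    (auto elim!: bar_0_cases simp: product_tau sub_bimodule_def mult.assoc)

subsection \<open>The contracting homotopy\<close>

definition ideal_part :: "'a \<Rightarrow> 'a" where
  "ideal_part l = (SOME x. x \<in> I \<and> l - x \<in> C)"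

lemma ideal_part: "ideal_part l \<in> I" "l - ideal_part l \<in> C"
proof -
  obtain c x where "c \<in> C" "x \<in> I" "l = c + x"
    using sum_C_I by blast
  then have "\<exists>x. x \<in> I \<and> l - x \<in> C"
    by (intro exI[of _ x]) simp
  from someI_ex[OF this] show "ideal_part l \<in> I" "l - ideal_part l \<in> C"
    by (simp_all add: ideal_part_def)
qed

text \<open>Two candidates differ by an element of \<open>C \<inter> I\<close>. Later properties of
  the projection then follow by exhibiting a candidate.\<close>

lemma ideal_part_eqI:
  assumes "x \<in> I" "l - x \<in> C"
  shows "ideal_part l = x"
proof -
  have "x - ideal_part l \<in> I"
    using assms ideal_part subspace_diff[OF subspace_I] by blast
  moreover have "(l - ideal_part l) - (l - x) \<in> C"
    using assms ideal_part subspace_diff[OF subspace_C] by blast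
  ultimately have "x - ideal_part l \<in> C \<inter> I"
    by simp
  then show ?thesis
    by (simp add: inter_C_I)
qed

lemma ideal_part_add: "ideal_part (x + y) = ideal_part x + ideal_part y"
  using ideal_part[of x] ideal_part[of y] subspace_add[OF subspace_I]
    subspace_add[OF subspace_C, of "x - ideal_part x" "y - ideal_part y"]
  by (intro ideal_part_eqI) (auto simp: algebra_simps)

text \<open>Right linearity over \<open>C\<close> is what makes the homotopy balanced at the first
  tensor sign; it comes from \<open>C\<close> being a subalgebra and \<open>I\<close> an
  ideal.\<close>

lemma ideal_part_mult: "c \<in> C \<Longrightarrow> ideal_part (x * c) = ideal_part x * c"
  using ideal_part[of x] mult_C[of "x - ideal_part x" c]
  by (intro ideal_part_eqI) (auto simp: mult_I_right left_diff_distrib)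

lemma ideal_part_ideal: "x \<in> I \<Longrightarrow> ideal_part x = x"
  by (rule ideal_part_eqI) (simp_all add: subspace_0[OF subspace_C])

definition homotopy :: "nat \<Rightarrow> 'a tens \<Rightarrow> 'a tens" where
  "homotopy n = tensor_lift (T (Suc n)) (\<lambda>xs. tau (Suc n) (1 # ideal_part (hd xs) # tl xs))"

lemma homotopy_listset:
  "xs \<in> listset (bar_factors I n) \<Longrightarrow> 1 # ideal_part (hd xs) # tl xs \<in> listset (bar_factors I (Suc n))"
  by (cases xs) (auto simp: bar_listset_iff nth_Cons ideal_part(1) split: nat.split)

lemma multilinear_homotopy:
  "multilinear C (bar_factors I n) (T (Suc n)) (\<lambda>xs. tau (Suc n) (1 # ideal_part (hd xs) # tl xs))"
proof (rule multilinearI)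
  fix us x y vs
  assume x: "us @ x # vs \<in> listset (bar_factors I n)" and y: "us @ y # vs \<in> listset (bar_factors I n)"
  show "tau (Suc n) (1 # ideal_part (hd (us @ (x + y) # vs)) # tl (us @ (x + y) # vs)) =
      tau (Suc n) (1 # ideal_part (hd (us @ x # vs)) # tl (us @ x # vs)) \<oplus>\<^bsub>T (Suc n)\<^esub>
      tau (Suc n) (1 # ideal_part (hd (us @ y # vs)) # tl (us @ y # vs))"
    using homotopy_listset[OF x] homotopy_listset[OF y]
      P.pure_add[of "[1]" "ideal_part x" vs "Suc n" "ideal_part y"]
      P.pure_add[of "1 # ideal_part (hd us) # tl us" x vs "Suc n" y]
    by (cases us) (simp_all add: ideal_part_add)
next
  fix us x c y vs
  assume c: "c \<in> C" and x: "us @ x # y # vs \<in> listset (bar_factors I n)"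
  show "tau (Suc n) (1 # ideal_part (hd (us @ (x * c) # y # vs)) # tl (us @ (x * c) # y # vs)) =
      tau (Suc n) (1 # ideal_part (hd (us @ x # (c * y) # vs)) # tl (us @ x # (c * y) # vs))"
    using homotopy_listset[OF x]
      P.pure_balanced[OF c, of "[1]" "ideal_part x" y vs "Suc n"]
      P.pure_balanced[OF c, of "1 # ideal_part (hd us) # tl us" x y vs "Suc n"]
    by (cases us) (simp_all add: ideal_part_mult[OF c])
qed (use homotopy_listset P.pure_closed in auto)

lemma homotopy_additive: "homotopy n \<in> additive_maps (T n) (T (Suc n))"
  unfolding homotopy_def by (intro P.lift_additive P.abelian_group_T multilinear_homotopy)

lemma homotopy_tau:
  "xs \<in> listset (bar_factors I n) \<Longrightarrow>
     homotopy n (tau n xs) = tau (Suc n) (1 # ideal_part (hd xs) # tl xs)"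
  unfolding homotopy_def by (intro P.lift_pure P.abelian_group_T multilinear_homotopy)


text \<open>Write l = p + q with p in \<open>I\<close> and q in \<open>C\<close>. Since q crosses
  the tensor sign, 1 \<otimes> q x = q \<otimes> x, and the last two terms on the left differ
  exactly by q \<otimes> x, which completes p \<otimes> x to l \<otimes> x.\<close>

lemma homotopy_term:
  assumes "l # x # rest \<in> listset (bar_factors I (Suc n))"
  shows "tau (Suc n) (ideal_part l # x # rest) \<ominus>\<^bsub>T (Suc n)\<^esub> tau (Suc n) (1 # (ideal_part l * x) # rest)
      \<oplus>\<^bsub>T (Suc n)\<^esub> tau (Suc n) (1 # (l * x) # rest) = tau (Suc n) (l # x # rest)"
proof -
  let ?p = "ideal_part l" and ?q = "l - ideal_part l"
  have x: "x \<in> I"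
    using assms by (auto simp: bar_listset_iff)
  have mem: "a # b # rest \<in> listset (bar_factors I (Suc n))" if "b \<in> I" for a b
    using assms that by (auto simp: bar_listset_iff nth_Cons split: nat.splits)
  note mems = mem[OF x] mem[OF mult_I_left[OF x]]
  have "tau (Suc n) (1 # (l * x) # rest) =
      tau (Suc n) (1 # (?p * x) # rest) \<oplus>\<^bsub>T (Suc n)\<^esub> tau (Suc n) (1 # (?q * x) # rest)"
    using P.pure_add[of "[1]" "?p * x" rest "Suc n" "?q * x"] mems by (simp flip: distrib_right)
  also have "tau (Suc n) (1 # (?q * x) # rest) = tau (Suc n) (?q # x # rest)"
    using P.pure_balanced[OF ideal_part(2), of "[]" 1 x rest "Suc n" l] mems by simp
  finally have *: "tau (Suc n) (1 # (l * x) # rest) =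
      tau (Suc n) (1 # (?p * x) # rest) \<oplus>\<^bsub>T (Suc n)\<^esub> tau (Suc n) (?q # x # rest)" .
  have **: "tau (Suc n) (l # x # rest) = tau (Suc n) (?p # x # rest) \<oplus>\<^bsub>T (Suc n)\<^esub> tau (Suc n) (?q # x # rest)"
    using P.pure_add[of "[]" ?p "x # rest" "Suc n" ?q] mems by simp
  show ?thesis
    unfolding * ** using mems
    by (simp add: P.pure_closed P.T.minus_eq P.T.a_assoc P.T.r_neg2 P.T.r_neg1)
qed

lemma homotopy_eq_tau:
  assumes xs: "xs \<in> listset (bar_factors I (Suc n))"
  shows "bar_diff C I (Suc (Suc n)) (homotopy (Suc n) (tau (Suc n) xs)) \<oplus>\<^bsub>T (Suc n)\<^esub>
    homotopy n (bar_diff C I (Suc n) (tau (Suc n) xs)) = tau (Suc n) xs"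
proof -
  obtain l x rest where xs_eq: "xs = l # x # rest"
    using bar_length[OF xs] by (cases xs; cases "tl xs") auto
  let ?p = "ideal_part l"
  have x: "x \<in> I"
    using xs by (auto simp: bar_listset_iff xs_eq)
  have mem: "a # b # rest \<in> listset (bar_factors I (Suc n))" if "b \<in> I" for a b
    using xs that by (auto simp: bar_listset_iff xs_eq nth_Cons split: nat.splits)
  have mem': "1 # ?p # x # rest \<in> listset (bar_factors I (Suc (Suc n)))"
    using homotopy_listset[OF xs] by (simp add: xs_eq)
  have tail: "1 # ?p # merge i (x # rest) \<in> listset (bar_factors I (Suc n))" if "i \<le> n" for i
    using merge_listset[OF mem', of "Suc (Suc i)"] that by (simp add: merge_Cons)
  have h: "additive_map (T n) (T (Suc n)) (homotopy n)"
    by (intro additive_map_T homotopy_additive)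
  \<comment> \<open>The merges from \<open>x\<close> onwards, which occur in both
    composites.\<close>
  let ?S = "P.T.alternating_sum (Suc n) n (\<lambda>i. tau (Suc n) (1 # ?p # merge i (x # rest)))"
  have S: "?S \<in> carrier (T (Suc n))"
    using tail by (intro P.T.alternating_sum_closed P.pure_closed)
  have "bar_diff C I (Suc (Suc n)) (homotopy (Suc n) (tau (Suc n) xs)) =
      P.T.alternating_sum (Suc n) (Suc (Suc n)) (\<lambda>i. tau (Suc n) (merge i (1 # ?p # x # rest)))"
    using xs mem' by (simp add: homotopy_tau bar_diff_tau xs_eq)
  \<comment> \<open>Index 0 merges 1 with \<open>?p\<close>, and the next term to be peeled off
    merges \<open>?p\<close> with \<open>x\<close>; what remains is \<open>?S\<close>.\<close>
  also have "\<dots> = tau (Suc n) (?p # x # rest) \<ominus>\<^bsub>T (Suc n)\<^esub>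
      P.T.alternating_sum (Suc n) (Suc n) (\<lambda>i. tau (Suc n) (1 # merge i (?p # x # rest)))"
    using merge_listset[OF mem'] merge_at[of "[]" 0 1 ?p "x # rest"]
    by (subst P.T.alternating_sum_Suc) (simp_all add: P.pure_closed merge_Cons)
  also have "P.T.alternating_sum (Suc n) (Suc n) (\<lambda>i. tau (Suc n) (1 # merge i (?p # x # rest))) =
      tau (Suc n) (1 # (?p * x) # rest) \<ominus>\<^bsub>T (Suc n)\<^esub> ?S"
    using merge_listset[OF mem', of "Suc i" for i] merge_at[of "[]" 0 ?p x rest]
    by (subst P.T.alternating_sum_Suc) (simp_all add: P.pure_closed merge_Cons)
  finally have 1: "bar_diff C I (Suc (Suc n)) (homotopy (Suc n) (tau (Suc n) xs)) =
      tau (Suc n) (?p # x # rest) \<ominus>\<^bsub>T (Suc n)\<^esub> (tau (Suc n) (1 # (?p * x) # rest) \<ominus>\<^bsub>T (Suc n)\<^esub> ?S)" .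
  have mxs: "merge i xs \<in> listset (bar_factors I n)" if "i \<le> Suc n" for i
    by (rule merge_listset[OF xs that])
  have "homotopy n (bar_diff C I (Suc n) (tau (Suc n) xs)) =
      P.T.alternating_sum (Suc n) (Suc n) (\<lambda>i. homotopy n (tau n (merge i xs)))"
    unfolding bar_diff_tau[OF xs]
    using mxs by (intro additive_map.alternating_sum[OF h] P.pure_closed)
  also have "\<dots> = P.T.alternating_sum (Suc n) (Suc n)
      (\<lambda>i. tau (Suc n) (1 # ideal_part (hd (merge i xs)) # tl (merge i xs)))"
    using mxs homotopy_listset[OF mxs] by (intro P.T.alternating_sum_cong homotopy_tau P.pure_closed)
  \<comment> \<open>The first merge has head \<open>l * x\<close>, which lies in \<open>I\<close>
    and is fixed by the projection; all later merges keep \<open>l\<close> as their head and so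
    contribute \<open>?p\<close>.\<close>
  also have "\<dots> = tau (Suc n) (1 # (l * x) # rest) \<ominus>\<^bsub>T (Suc n)\<^esub> ?S"
    using homotopy_listset[OF mxs] merge_at[of "[]" 0 l x rest]
    by (subst P.T.alternating_sum_Suc)
      (simp_all add: P.pure_closed merge_Cons xs_eq ideal_part_ideal mult_I_left x)
  finally have 2: "homotopy n (bar_diff C I (Suc n) (tau (Suc n) xs)) =
      tau (Suc n) (1 # (l * x) # rest) \<ominus>\<^bsub>T (Suc n)\<^esub> ?S" .
  show ?thesis
    unfolding 1 2 using S mem[OF x] mem[OF mult_I_left[OF x]] homotopy_term[of l x rest n]
    by (simp add: P.T.homotopy_cancel P.pure_closed xs_eq)
qed

lemma homotopy_eq:
  assumes "q \<in> carrier (T (Suc n))"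
  shows "bar_diff C I (Suc (Suc n)) (homotopy (Suc n) q) \<oplus>\<^bsub>T (Suc n)\<^esub>
    homotopy n (bar_diff C I (Suc n) q) = q"
  by (rule P.hom_eq[OF _ _ _ assms])
    (intro P.additive_maps_sum additive_maps_comp[OF homotopy_additive bar_diff_additive]
      additive_maps_comp[OF bar_diff_additive homotopy_additive] additive_maps_id homotopy_eq_tau)+

lemma bar_diff_1:
  assumes "[l, x, z] \<in> listset (bar_factors I 1)"
  shows "bar_diff C I 1 (tau 1 [l, x, z]) = tau 0 [l * x, z] \<ominus>\<^bsub>T 0\<^esub> tau 0 [l, x * z]"
proof -
  have "bar_diff C I 1 (tau 1 [l, x, z]) = P.T.alternating_sum 0 (Suc 0) (\<lambda>i. tau 0 (merge i [l, x, z]))"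
    using bar_diff_tau[of "[l, x, z]" 0] assms by simp
  also have "\<dots> = tau 0 (merge 0 [l, x, z]) \<ominus>\<^bsub>T 0\<^esub> tau 0 (merge (Suc 0) [l, x, z])"
    using merge_listset[of "[l, x, z]" 0] assms
    by (subst P.T.alternating_sum_Suc) (simp_all add: P.T.alternating_sum_0 P.pure_closed)
  finally show ?thesis
    by (simp add: merge_def)
qed

text \<open>The same splitting l = p + q: d h contributes p \<otimes> z - 1 \<otimes> p z, while 1
  \<otimes> l z equals 1 \<otimes> p z + q \<otimes> z after q has crossed the tensor sign.\<close>

lemma homotopy_eq_0:
  assumes "q \<in> carrier (T 0)"
  shows "bar_diff C I 1 (homotopy 0 q) \<oplus>\<^bsub>T 0\<^esub> tau 0 [1, product_map q] = q"
proof (rule P.hom_eq[OF _ _ _ assms])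
  have "(\<lambda>z. tau 0 [1, z]) \<in> additive_maps (sub_bimodule UNIV) (T 0)"
    using P.pure_add[of "[1]" _ "[]" 0]
    by (intro additive_mapsI) (auto simp: sub_bimodule_def bar_listset_iff intro!: P.pure_closed)
  then show "(\<lambda>q. bar_diff C I 1 (homotopy 0 q) \<oplus>\<^bsub>T 0\<^esub> tau 0 [1, product_map q]) \<in> additive_maps (T 0) (T 0)"
    using additive_maps_comp[OF homotopy_additive bar_diff_additive, of 0]
    by (intro P.additive_maps_sum additive_maps_comp[OF product_additive]) auto
  show "(\<lambda>q. q) \<in> additive_maps (T 0) (T 0)"
    by (rule additive_maps_id)
  fix xs
  assume "xs \<in> listset (bar_factors I 0)"
  then obtain l z where xs: "xs = [l, z]"
    by (rule bar_0_cases)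
  let ?p = "ideal_part l" and ?q = "l - ideal_part l"
  have mem: "[a, b] \<in> listset (bar_factors I 0)" for a b
    by (simp add: bar_listset_iff)
  have mem1: "[1, ?p, z] \<in> listset (bar_factors I 1)"
    using homotopy_listset[OF mem, of l z] by simp
  have "homotopy 0 (tau 0 [l, z]) = tau 1 [1, ?p, z]"
    using homotopy_tau[OF mem, of l z] by simp
  then have 1: "bar_diff C I 1 (homotopy 0 (tau 0 [l, z])) = tau 0 [?p, z] \<ominus>\<^bsub>T 0\<^esub> tau 0 [1, ?p * z]"
    using bar_diff_1[OF mem1] by simp
  have 2: "tau 0 [1, l * z] = tau 0 [1, ?p * z] \<oplus>\<^bsub>T 0\<^esub> tau 0 [?q, z]"
    using P.pure_add[of "[1]" "?p * z" "[]" 0 "?q * z"] mem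
      P.pure_balanced[OF ideal_part(2), of "[]" 1 z "[]" 0 l] by (simp flip: distrib_right)
  have 3: "tau 0 [l, z] = tau 0 [?p, z] \<oplus>\<^bsub>T 0\<^esub> tau 0 [?q, z]"
    using P.pure_add[of "[]" ?p "[z]" 0 ?q] mem by simp
  show "bar_diff C I 1 (homotopy 0 (tau 0 xs)) \<oplus>\<^bsub>T 0\<^esub> tau 0 [1, product_map (tau 0 xs)] = tau 0 xs"
    unfolding xs 1 product_tau 2
    by (simp add: 3 P.pure_closed mem P.T.minus_eq P.T.a_assoc P.T.r_neg2 P.T.r_neg1)
qed

lemma product_bar_diff:
  assumes "q \<in> carrier (T 1)"
  shows "product_map (bar_diff C I 1 q) = 0"
proof -
  have "product_map (bar_diff C I 1 q) = \<zero>\<^bsub>sub_bimodule UNIV\<^esub>"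
  proof (rule tensor_product.tensor_hom_eq[OF P.tensor_product_axioms abelian_group_UNIV _ _ _ assms])
    show "(\<lambda>q. product_map (bar_diff C I 1 q)) \<in> additive_maps (T 1) (sub_bimodule UNIV)"
      using additive_maps_comp[OF bar_diff_additive product_additive] by simp
    show "(\<lambda>q. \<zero>\<^bsub>sub_bimodule UNIV\<^esub>) \<in> additive_maps (T 1) (sub_bimodule UNIV)"
      by (simp add: additive_maps_def sub_bimodule_def)
    fix xs
    assume xs: "xs \<in> listset (bar_factors I 1)"
    then obtain l x z where xs_eq: "xs = [l, x, z]"
      by (auto simp: bar_listset_iff length_Suc_conv numeral_3_eq_3)
    have mem: "[a, b] \<in> listset (bar_factors I 0)" for a b
      by (simp add: bar_listset_iff)
    interpret f: additive_map "T 0" "sub_bimodule (UNIV :: 'a set)" product_map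
      using product_additive
      by (simp add: additive_map_def additive_map_axioms_def P.abelian_group_T abelian_group_UNIV)
    have "bar_diff C I 1 (tau 1 xs) = tau 0 [l * x, z] \<ominus>\<^bsub>T 0\<^esub> tau 0 [l, x * z]"
      using bar_diff_1 xs by (simp add: xs_eq)
    then show "product_map (bar_diff C I 1 (tau 1 xs)) = \<zero>\<^bsub>sub_bimodule UNIV\<^esub>"
      by (simp add: f.diff P.pure_closed mem product_tau mult.assoc f.N.minus_eq f.N.r_neg
          sub_bimodule_def[of UNIV, THEN arg_cong[of _ _ carrier]])
  qed
  then show ?thesis
    by (simp add: sub_bimodule_def)
qed


section \<open>Square zero and exactness\<close>

lemma bar_listset_Cons:
  assumes "xs \<in> listset (bar_factors I (Suc n))"
  obtains l ys where "xs = l # ys" "hd ys \<in> I" "ys \<in> listset (bar_factors I n)"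
    "1 # ys \<in> listset (bar_factors I (Suc n))"
proof -
  obtain l ys where *: "xs = l # ys"
    using bar_length[OF assms] by (cases xs) auto
  with assms have "ys \<in> listset (bar_factors I n)" "1 # ys \<in> listset (bar_factors I (Suc n))"
    by (auto simp: bar_listset_iff nth_Cons split: nat.splits)
  moreover have "hd ys \<in> I"
    using assms * by (cases ys) (auto simp: bar_listset_iff)
  ultimately show thesis
    using * that by blast
qed

text \<open>In positive degrees the terms are generated, as left modules, by the image of the homotopy, where
  \<open>d d h = d (1 - h d) = d - (1 - h d) d = 0\<close> by induction on the degree.\<close>

lemma bar_diff_bar_diff_aux:
  assumes "\<And>ys. ys \<in> listset (bar_factors I (Suc n)) \<Longrightarrow>
    bar_diff C I (Suc n) (bar_diff C I (Suc (Suc n)) (homotopy (Suc n) (tau (Suc n) ys))) = \<zero>\<^bsub>T n\<^esub>"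
    and q: "q \<in> carrier (T (Suc (Suc n)))"
  shows "bar_diff C I (Suc n) (bar_diff C I (Suc (Suc n)) q) = \<zero>\<^bsub>T n\<^esub>"
proof (rule P.tensor_hom_eq[OF P.abelian_group_T _ _ _ q])
  show "(\<lambda>q. bar_diff C I (Suc n) (bar_diff C I (Suc (Suc n)) q)) \<in> additive_maps (T (Suc (Suc n))) (T n)"
    by (rule additive_maps_comp[OF bar_diff_additive bar_diff_additive])
  show "(\<lambda>q. \<zero>\<^bsub>T n\<^esub>) \<in> additive_maps (T (Suc (Suc n))) (T n)"
    by (simp add: additive_maps_def)
  fix xs
  assume "xs \<in> listset (bar_factors I (Suc (Suc n)))"
  then obtain l ys where xs: "xs = l # ys" "hd ys \<in> I" "ys \<in> listset (bar_factors I (Suc n))"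
      "1 # ys \<in> listset (bar_factors I (Suc (Suc n)))"
    by (rule bar_listset_Cons)
  let ?w = "homotopy (Suc n) (tau (Suc n) ys)"
  have w: "?w \<in> carrier (T (Suc (Suc n)))"
    by (rule additive_maps_closed[OF homotopy_additive P.pure_closed[OF xs(3)]])
  \<comment> \<open>Dropping \<open>l\<close> turns the first factor from \<open>I\<close> into the
    outer entry of a shorter tensor. The projection fixes that entry, so the homotopy restores the
    factor with 1 in front, and \<open>l\<close> is recovered by the left action.\<close>
  have "tau (Suc (Suc n)) (1 # ys) = ?w"
    using xs bar_length[OF xs(3)] by (cases ys) (simp_all add: homotopy_tau ideal_part_ideal)
  moreover have "tau (Suc (Suc n)) xs = lact (P.B (Suc (Suc n))) l (tau (Suc (Suc n)) (1 # ys))"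
    using xs by (simp add: P.lact_pure)
  ultimately have "bar_diff C I (Suc n) (bar_diff C I (Suc (Suc n)) (tau (Suc (Suc n)) xs)) =
      lact (P.B n) l (bar_diff C I (Suc n) (bar_diff C I (Suc (Suc n)) ?w))"
    using bimodule_hom_lact[OF bar_diff_hom, of l ?w "Suc n"]
      bimodule_hom_lact[OF bar_diff_hom, of l "bar_diff C I (Suc (Suc n)) ?w" n]
      additive_maps_closed[OF bar_diff_additive w] w
    by (simp add: bar_bimodule_def)
  also have "\<dots> = \<zero>\<^bsub>T n\<^esub>"
    using additive_map.zero[OF additive_map_T[OF P.lact_B_additive[of l n]]] assms(1)[OF xs(3)] by simp
  finally show "bar_diff C I (Suc n) (bar_diff C I (Suc (Suc n)) (tau (Suc (Suc n)) xs)) = \<zero>\<^bsub>T n\<^esub>" .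
qed

text \<open>On a cycle the summand h d of the homotopy identity vanishes, so the homotopy gives an
  explicit preimage. This serves both exactness and the induction for d d = 0.\<close>

lemma bar_diff_homotopy:
  assumes "q \<in> carrier (T (Suc n))" "bar_diff C I (Suc n) q = \<zero>\<^bsub>T n\<^esub>"
  shows "bar_diff C I (Suc (Suc n)) (homotopy (Suc n) q) = q"
proof -
  have "homotopy n \<zero>\<^bsub>T n\<^esub> = \<zero>\<^bsub>T (Suc n)\<^esub>"
    by (rule additive_map.zero[OF additive_map_T[OF homotopy_additive]])
  moreover have "bar_diff C I (Suc (Suc n)) (homotopy (Suc n) q) \<in> carrier (T (Suc n))"
    using assms(1) by (intro additive_maps_closed[OF bar_diff_additive] additive_maps_closed[OF homotopy_additive])
  ultimately show ?thesis
    using homotopy_eq[OF assms(1)] assms(2) by simp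
qed

lemma bar_diff_homotopy_0:
  assumes "q \<in> carrier (T 0)" "product_map q = 0"
  shows "bar_diff C I 1 (homotopy 0 q) = q"
proof -
  have mem: "[a, b] \<in> listset (bar_factors I 0)" for a b
    by (simp add: bar_listset_iff)
  have "tau 0 [1, 0] = \<zero>\<^bsub>T 0\<^esub>"
    using P.pure_add[of "[1]" 0 "[]" 0 0] mem P.pure_closed[of "[1, 0]" 0] by simp
  moreover have "bar_diff C I 1 (homotopy 0 q) \<in> carrier (T 0)"
    using additive_maps_closed[OF bar_diff_additive additive_maps_closed[OF homotopy_additive assms(1)]]
    by simp
  ultimately show ?thesis
    using homotopy_eq_0[OF assms(1)] assms(2) by simp
qed

text \<open>Both cases need that d w is a cycle, in order to get d h d w = d w. In the base case
  this is associativity, in the form \<open>product_bar_diff\<close>; afterwards it is the induction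
  hypothesis.\<close>

lemma bar_diff_bar_diff:
  "q \<in> carrier (T (Suc (Suc n))) \<Longrightarrow> bar_diff C I (Suc n) (bar_diff C I (Suc (Suc n)) q) = \<zero>\<^bsub>T n\<^esub>"
proof (induction n arbitrary: q)
  case 0
  show ?case
  proof (rule bar_diff_bar_diff_aux[OF _ 0])
    fix ys
    assume ys: "ys \<in> listset (bar_factors I (Suc 0))"
    let ?w = "tau (Suc 0) ys"
    have w: "?w \<in> carrier (T (Suc 0))"
      by (rule P.pure_closed[OF ys])
    interpret d: additive_map "T (Suc 0)" "T 0" "bar_diff C I (Suc 0)"
      by (rule additive_map_T[OF bar_diff_additive])
    have hdw: "homotopy 0 (bar_diff C I (Suc 0) ?w) \<in> carrier (T (Suc 0))"
      by (rule additive_maps_closed[OF homotopy_additive d.closed[OF w]])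
    have dhw: "bar_diff C I (Suc (Suc 0)) (homotopy (Suc 0) ?w) \<in> carrier (T (Suc 0))"
      by (rule additive_maps_closed[OF bar_diff_additive additive_maps_closed[OF homotopy_additive w]])
    have "bar_diff C I (Suc 0) (homotopy 0 (bar_diff C I (Suc 0) ?w)) = bar_diff C I (Suc 0) ?w"
      using bar_diff_homotopy_0[OF d.closed[OF w]] product_bar_diff[of ?w] w by simp
    moreover have "bar_diff C I (Suc (Suc 0)) (homotopy (Suc 0) ?w) =
        ?w \<ominus>\<^bsub>T (Suc 0)\<^esub> homotopy 0 (bar_diff C I (Suc 0) ?w)"
      using homotopy_eq[OF w] hdw dhw by (intro P.T.diff_eqI) auto
    ultimately show "bar_diff C I (Suc 0) (bar_diff C I (Suc (Suc 0)) (homotopy (Suc 0) ?w)) = \<zero>\<^bsub>T 0\<^esub>"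
      using w hdw by (simp add: d.diff d.closed P.T.minus_eq P.T.r_neg)
  qed
next
  case (Suc n)
  show ?case
  proof (rule bar_diff_bar_diff_aux[OF _ Suc.prems])
    fix ys
    assume ys: "ys \<in> listset (bar_factors I (Suc (Suc n)))"
    let ?w = "tau (Suc (Suc n)) ys"
    have w: "?w \<in> carrier (T (Suc (Suc n)))"
      by (rule P.pure_closed[OF ys])
    interpret d: additive_map "T (Suc (Suc n))" "T (Suc n)" "bar_diff C I (Suc (Suc n))"
      by (rule additive_map_T[OF bar_diff_additive])
    have hdw: "homotopy (Suc n) (bar_diff C I (Suc (Suc n)) ?w) \<in> carrier (T (Suc (Suc n)))"
      by (rule additive_maps_closed[OF homotopy_additive d.closed[OF w]])
    have dhw: "bar_diff C I (Suc (Suc (Suc n))) (homotopy (Suc (Suc n)) ?w) \<in> carrier (T (Suc (Suc n)))"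
      by (rule additive_maps_closed[OF bar_diff_additive additive_maps_closed[OF homotopy_additive w]])
    have "bar_diff C I (Suc (Suc n)) (homotopy (Suc n) (bar_diff C I (Suc (Suc n)) ?w)) =
        bar_diff C I (Suc (Suc n)) ?w"
      by (rule bar_diff_homotopy[OF d.closed[OF w] Suc.IH[OF w]])
    moreover have "bar_diff C I (Suc (Suc (Suc n))) (homotopy (Suc (Suc n)) ?w) =
        ?w \<ominus>\<^bsub>T (Suc (Suc n))\<^esub> homotopy (Suc n) (bar_diff C I (Suc (Suc n)) ?w)"
      using homotopy_eq[OF w] hdw dhw by (intro P.T.diff_eqI) auto
    ultimately show "bar_diff C I (Suc (Suc n))
        (bar_diff C I (Suc (Suc (Suc n))) (homotopy (Suc (Suc n)) ?w)) = \<zero>\<^bsub>T (Suc n)\<^esub>"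
      using w hdw by (simp add: d.diff d.closed P.T.minus_eq P.T.r_neg)
  qed
qed

text \<open>One inclusion is d d = 0, the other the preimage supplied by the homotopy. The homotopy
  need not be linear for this, as only sets are compared.\<close>

lemma exact_bar:
  "a_kernel (bar_bimodule C I (Suc n)) (bar_bimodule C I n) (bar_diff C I (Suc n)) =
     bar_diff C I (Suc (Suc n)) ` carrier (bar_bimodule C I (Suc (Suc n)))"
proof -
  have "q \<in> bar_diff C I (Suc (Suc n)) ` carrier (T (Suc (Suc n)))"
    if "q \<in> carrier (T (Suc n))" "bar_diff C I (Suc n) q = \<zero>\<^bsub>T n\<^esub>" for q
    using bar_diff_homotopy[OF that] additive_maps_closed[OF homotopy_additive that(1)]
    by (metis image_eqI)
  then show ?thesis
    using bar_diff_bar_diff additive_maps_closed[OF bar_diff_additive]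
    by (auto simp: bar_bimodule_def a_kernel_def')
qed

subsection \<open>The kernel of the product map\<close>

lemma K1_simps:
  "carrier (K1 C) = {q \<in> carrier (T 0). product_map q = 0}"
  "add (K1 C) = add (T 0)" "zero (K1 C) = zero (T 0)"
  "lact (K1 C) = lact (bar_bimodule C I 0)" "ract (K1 C) = ract (bar_bimodule C I 0)"
  by (simp_all add: K1_def Let_def a_kernel_def' bar_bimodule_def bar_factors_def)
    (simp add: sub_bimodule_def)

text \<open>The product map is additive and linear on both sides, so its kernel is closed under
  negatives and both actions; the laws are inherited from the ambient tensor bimodule.\<close>

lemma bimodule_K1: "bimodule scale UNIV (K1 C)"
proof -
  interpret B: bimodule scale UNIV "bar_bimodule C I 0"
    unfolding bar_bimodule_def by (rule P.bimodule_B)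
  have B: "carrier (bar_bimodule C I 0) = carrier (T 0)" "add (bar_bimodule C I 0) = add (T 0)"
    by (simp_all add: bar_bimodule_def)
  interpret f: additive_map "T 0" "sub_bimodule (UNIV :: 'a set)" product_map
    using product_additive
    by (simp add: additive_map_def additive_map_axioms_def P.abelian_group_T abelian_group_UNIV)
  have add: "product_map (x \<oplus>\<^bsub>T 0\<^esub> y) = product_map x + product_map y"
    if "x \<in> carrier (T 0)" "y \<in> carrier (T 0)" for x y
    using f.add[OF that] by (simp add: sub_bimodule_def)
  have act: "product_map (lact (bar_bimodule C I 0) a x) = a * product_map x"
    "product_map (ract (bar_bimodule C I 0) x a) = product_map x * a" if "x \<in> carrier (T 0)" for a x
    using bimodule_hom_lact[OF product_hom, of a x] bimodule_hom_ract[OF product_hom, of a x] that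
    by (simp_all add: bar_bimodule_def sub_bimodule_def)
  have zero: "product_map \<zero>\<^bsub>T 0\<^esub> = 0"
    using f.zero by (simp add: sub_bimodule_def)
  have "comm_group (add_monoid (K1 C))"
  proof (rule comm_groupI)
    fix x
    assume x: "x \<in> carrier (add_monoid (K1 C))"
    then have x': "x \<in> carrier (T 0)" "product_map x = 0"
      by (simp_all add: K1_simps)
    then have "product_map (\<ominus>\<^bsub>T 0\<^esub> x) = 0"
      using add[of x "\<ominus>\<^bsub>T 0\<^esub> x"] zero by (simp add: P.T.r_neg)
    then show "\<exists>y\<in>carrier (add_monoid (K1 C)). y \<otimes>\<^bsub>add_monoid (K1 C)\<^esub> x = \<one>\<^bsub>add_monoid (K1 C)\<^esub>"
      using x' by (intro bexI[of _ "\<ominus>\<^bsub>T 0\<^esub> x"]) (simp_all add: K1_simps P.T.l_neg)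
  qed (auto simp: K1_simps sub_bimodule_def P.T.a_ac)
  then have "abelian_group (K1 C)"
    by (rule abelian_groupI_add_monoid)
  moreover have "bimodule_axioms scale UNIV (K1 C)"
    using B.lact_closed B.ract_closed B.lact_add B.ract_add B.add_lact B.add_ract B.mult_lact
      B.mult_ract B.one_lact B.one_ract B.lact_ract B.central
    by (intro bimodule_axioms.intro) (auto simp: K1_simps B act)
  ultimately show ?thesis
    by (rule bimodule.intro)
qed

lemma bar_diff_hom_K1: "bar_diff C I 1 \<in> bimodule_hom UNIV (bar_bimodule C I 1) (K1 C)"
  using bar_diff_hom[of 0] product_bar_diff
  by (auto simp: bimodule_hom_def K1_simps bar_bimodule_def)

lemma bar_diff_onto_K1: "bar_diff C I 1 ` carrier (bar_bimodule C I 1) = carrier (K1 C)"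
proof -
  have "q \<in> bar_diff C I 1 ` carrier (T 1)" if "q \<in> carrier (T 0)" "product_map q = 0" for q
    using bar_diff_homotopy_0[OF that] additive_maps_closed[OF homotopy_additive that(1)]
    by (metis One_nat_def image_eqI)
  then show ?thesis
    using product_bar_diff additive_maps_closed[OF bar_diff_additive, of _ 0]
    by (auto simp: bar_bimodule_def K1_simps)
qed

text \<open>\<open>K1 C\<close> has the zero element of the ambient group, so shrinking the target
  of the first differential leaves its kernel unchanged.\<close>

lemma exact_K1:
  "a_kernel (bar_bimodule C I 1) (K1 C) (bar_diff C I 1) = bar_diff C I 2 ` carrier (bar_bimodule C I 2)"
  using exact_bar[of 0] by (simp add: a_kernel_def' K1_simps bar_bimodule_def numeral_2_eq_2)

end

section \<open>Linear sections\<close>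

text \<open>Bimodules carry no separate k-action: a scalar acts through its multiple of the unit,
  here from the right, and \<open>central\<close> makes the side immaterial.\<close>

locale k_bimodule = bimodule + k_algebra scale +
  assumes scalar_in: "scale c 1 \<in> A"
begin

abbreviation smult :: "'c \<Rightarrow> 'a \<Rightarrow> 'c" where "smult x c \<equiv> ract M x (scale c 1)"

lemma smult_closed: "x \<in> carrier M \<Longrightarrow> smult x c \<in> carrier M"
  by (rule ract_closed[OF scalar_in])

lemma smult_add: "x \<in> carrier M \<Longrightarrow> smult x (c + d) = smult x c \<oplus> smult x d"
  by (simp add: scale_left_distrib add_ract scalar_in)

lemma smult_smult: "x \<in> carrier M \<Longrightarrow> smult (smult x c) d = smult x (c * d)"
  using mult_ract[OF scalar_in[of c] scalar_in[of d], of x]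
  by (simp add: scale_mult_left mult.commute)

lemma smult_1: "x \<in> carrier M \<Longrightarrow> ract M x 1 = x"
  by (rule one_ract)

lemma smult_0: "x \<in> carrier M \<Longrightarrow> ract M x 0 = \<zero>"
  using smult_add[of x 0 0] smult_closed[of x 0] by simp

lemma smult_minus_1: "x \<in> carrier M \<Longrightarrow> ract M x (- 1) = \<ominus> x"
  using smult_add[of x "- 1" 1] smult_closed[of x "- 1"]
  by (simp add: smult_0 smult_1 minus_equality[symmetric])

end

text \<open>A complement of the kernel is found by Zorn's lemma as a maximal k-subspace that meets
  the kernel in zero. Maximality forces it to map onto \<open>N\<close>, and inverting
  \<open>f\<close> on it gives the section.\<close>

lemma linear_section:
  assumes M: "k_bimodule scale A M" and N: "k_bimodule scale A N"
    and f: "f \<in> bimodule_hom A M N" and surj: "f ` carrier M = carrier N"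
  obtains s where "s \<in> additive_maps N M" "\<And>y. y \<in> carrier N \<Longrightarrow> f (s y) = y"
    "\<And>y c. y \<in> carrier N \<Longrightarrow> s (ract N y (scale c 1)) = ract M (s y) (scale c 1)"
proof -
  interpret M: k_bimodule scale A M by fact
  interpret N: k_bimodule scale A N by fact
  interpret f: additive_map M N f
    using bimodule_hom_additive[OF f]
    by (simp add: additive_map_def additive_map_axioms_def M.abelian_group_axioms N.abelian_group_axioms)
  have f_smult: "f (M.smult x c) = N.smult (f x) c" if "x \<in> carrier M" for x c
    by (rule bimodule_hom_ract[OF f M.scalar_in that])
  \<comment> \<open>The k-subspaces of \<open>M\<close> on which \<open>f\<close> has trivial
    kernel.\<close>
  define \<W> where "\<W> = {W. W \<subseteq> carrier M \<and> \<zero>\<^bsub>M\<^esub> \<in> W \<and> (\<forall>x\<in>W. \<forall>y\<in>W. x \<oplus>\<^bsub>M\<^esub> y \<in> W) \<and>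
    (\<forall>x\<in>W. \<forall>c. M.smult x c \<in> W) \<and> (\<forall>x\<in>W. f x = \<zero>\<^bsub>N\<^esub> \<longrightarrow> x = \<zero>\<^bsub>M\<^esub>)}"
  have "\<exists>W\<in>\<W>. \<forall>V\<in>\<W>. W \<subseteq> V \<longrightarrow> V = W"
  proof (rule subset_Zorn_nonempty)
    have "M.smult \<zero>\<^bsub>M\<^esub> c = \<zero>\<^bsub>M\<^esub>" for c
      using M.ract_add[OF M.scalar_in, of "\<zero>\<^bsub>M\<^esub>" "\<zero>\<^bsub>M\<^esub>" c] M.smult_closed[of "\<zero>\<^bsub>M\<^esub>" c] by simp
    then show "\<W> \<noteq> {}"
      by (auto simp: \<W>_def intro!: exI[of _ "{\<zero>\<^bsub>M\<^esub>}"])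
    fix \<C>
    assume \<C>: "\<C> \<noteq> {}" "subset.chain \<W> \<C>"
    have sub: "U \<in> \<W>" if "U \<in> \<C>" for U
      using \<C>(2) that by (auto simp: subset_chain_def)
    have \<W>D: "U \<subseteq> carrier M" "\<zero>\<^bsub>M\<^esub> \<in> U" "x \<in> U \<Longrightarrow> y \<in> U \<Longrightarrow> x \<oplus>\<^bsub>M\<^esub> y \<in> U"
      "x \<in> U \<Longrightarrow> M.smult x c \<in> U" "x \<in> U \<Longrightarrow> f x = \<zero>\<^bsub>N\<^esub> \<Longrightarrow> x = \<zero>\<^bsub>M\<^esub>"
      if "U \<in> \<C>" for U x y c
      using sub[OF that] unfolding \<W>_def by blast+
    show "\<Union>\<C> \<in> \<W>"
      unfolding \<W>_def
    proof (intro CollectI conjI ballI allI impI)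
      fix x y
      assume "x \<in> \<Union>\<C>" "y \<in> \<Union>\<C>"
      then obtain U V where UV: "x \<in> U" "U \<in> \<C>" "y \<in> V" "V \<in> \<C>"
        by blast
      then have "U \<subseteq> V \<or> V \<subseteq> U"
        using \<C>(2) by (auto simp: subset_chain_def)
      then have "x \<oplus>\<^bsub>M\<^esub> y \<in> U \<or> x \<oplus>\<^bsub>M\<^esub> y \<in> V"
        using UV \<W>D(3) by blast
      with UV show "x \<oplus>\<^bsub>M\<^esub> y \<in> \<Union>\<C>"
        by blast
    next
      show "\<Union>\<C> \<subseteq> carrier M"
        by (rule Union_least[OF \<W>D(1)])
      obtain U where "U \<in> \<C>"
        using \<C>(1) by blast
      then show "\<zero>\<^bsub>M\<^esub> \<in> \<Union>\<C>"
        using \<W>D(2) by blast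
    next
      fix x c
      assume "x \<in> \<Union>\<C>"
      then obtain U where U: "U \<in> \<C>" "x \<in> U"
        by blast
      show "M.smult x c \<in> \<Union>\<C>"
        by (rule UnionI[OF U(1) \<W>D(4)[OF U]])
    next
      fix x
      assume "x \<in> \<Union>\<C>" "f x = \<zero>\<^bsub>N\<^esub>"
      then show "x = \<zero>\<^bsub>M\<^esub>"
        using \<W>D(5) by blast
    qed
  qed
  then obtain W where W: "W \<in> \<W>" and maximal: "\<And>V. V \<in> \<W> \<Longrightarrow> W \<subseteq> V \<Longrightarrow> V = W"
    by blast
  have W_M: "x \<in> carrier M" and W_add: "y \<in> W \<Longrightarrow> x \<oplus>\<^bsub>M\<^esub> y \<in> W" and W_smult: "M.smult x c \<in> W"
    and W_ker: "f x = \<zero>\<^bsub>N\<^esub> \<Longrightarrow> x = \<zero>\<^bsub>M\<^esub>" if "x \<in> W" for x y c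
    using W that unfolding \<W>_def by blast+
  have W_0: "\<zero>\<^bsub>M\<^esub> \<in> W"
    using W by (simp add: \<W>_def)
  have W_minus: "\<ominus>\<^bsub>M\<^esub> x \<in> W" if "x \<in> W" for x
    using W_smult[OF that, of "- 1"] by (simp add: M.smult_minus_1 W_M that)
  have inj: "inj_on f W"
  proof (rule inj_onI)
    fix x y
    assume xy: "x \<in> W" "y \<in> W" "f x = f y"
    have "x \<oplus>\<^bsub>M\<^esub> \<ominus>\<^bsub>M\<^esub> y = \<zero>\<^bsub>M\<^esub>"
      using xy by (intro W_ker W_add W_minus) (simp_all add: W_M f.add f.a_inv f.closed N.r_neg)
    then show "x = y"
      using xy M.minus_equality[of x "\<ominus>\<^bsub>M\<^esub> y"] by (simp add: W_M)
  qed
  have onto: "f ` W = carrier N"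
  proof (rule ccontr)
    assume "f ` W \<noteq> carrier N"
    then obtain n where n: "n \<in> carrier N" "n \<notin> f ` W"
      using W_M f.closed by blast
    then have "n \<in> f ` carrier M"
      using surj by simp
    then obtain m where m: "m \<in> carrier M" "f m = n"
      by blast
    \<comment> \<open>\<open>W\<close> enlarged by the line through a preimage of the missed element
      \<open>n\<close>; it will contradict maximality.\<close>
    define V where "V = {w \<oplus>\<^bsub>M\<^esub> M.smult m c |w c. w \<in> W}"
    have "V \<in> \<W>"
      unfolding \<W>_def
    proof (intro CollectI conjI ballI allI impI)
      show "V \<subseteq> carrier M"
        by (auto simp: V_def W_M M.smult_closed m)
      show "\<zero>\<^bsub>M\<^esub> \<in> V"
        unfolding V_def using W_0 M.smult_0[OF m(1)] by (intro CollectI exI[of _ "\<zero>\<^bsub>M\<^esub>"] exI[of _ 0]) simp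
    next
      fix x y
      assume "x \<in> V" "y \<in> V"
      then obtain w c v d where xy: "x = w \<oplus>\<^bsub>M\<^esub> M.smult m c" "y = v \<oplus>\<^bsub>M\<^esub> M.smult m d" "w \<in> W" "v \<in> W"
        by (auto simp: V_def)
      then have "x \<oplus>\<^bsub>M\<^esub> y = (w \<oplus>\<^bsub>M\<^esub> v) \<oplus>\<^bsub>M\<^esub> M.smult m (c + d)"
        by (simp add: M.smult_add m W_M M.smult_closed M.a_ac)
      then show "x \<oplus>\<^bsub>M\<^esub> y \<in> V"
        using xy W_add by (auto simp: V_def)
    next
      fix x d
      assume "x \<in> V"
      then obtain w c where x: "x = w \<oplus>\<^bsub>M\<^esub> M.smult m c" "w \<in> W"
        by (auto simp: V_def)
      then have "M.smult x d = M.smult w d \<oplus>\<^bsub>M\<^esub> M.smult m (c * d)"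
        by (simp add: M.ract_add M.scalar_in W_M M.smult_closed m M.smult_smult)
      then show "M.smult x d \<in> V"
        using x W_smult by (auto simp: V_def)
    next
      fix x
      assume "x \<in> V" and fx: "f x = \<zero>\<^bsub>N\<^esub>"
      then obtain w c where x: "x = w \<oplus>\<^bsub>M\<^esub> M.smult m c" "w \<in> W"
        by (auto simp: V_def)
      have eq: "f w \<oplus>\<^bsub>N\<^esub> N.smult n c = \<zero>\<^bsub>N\<^esub>"
        using fx x by (simp add: f.add W_M M.smult_closed m f_smult)
      \<comment> \<open>Over a field a nonzero \<open>c\<close> could be inverted, and a multiple of
        \<open>w\<close> would then be a preimage of \<open>n\<close> inside
        \<open>W\<close>.\<close>
      have "c = 0"
      proof (rule ccontr)
        assume c: "c \<noteq> 0"
        have "N.smult n c \<oplus>\<^bsub>N\<^esub> f w = \<zero>\<^bsub>N\<^esub>"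
          using eq n x by (simp add: N.a_comm N.smult_closed f.closed W_M)
        then have "f (\<ominus>\<^bsub>M\<^esub> w) = N.smult n c"
          using n x by (simp add: f.a_inv W_M N.minus_equality N.smult_closed f.closed)
        then have "f (M.smult (\<ominus>\<^bsub>M\<^esub> w) (inverse c)) = n"
          using x c n by (simp add: f_smult W_M N.smult_smult N.smult_1)
        then show False
          using n(2) W_smult[OF W_minus[OF x(2)]] by blast
      qed
      then show "x = \<zero>\<^bsub>M\<^esub>"
        using eq x W_ker[OF x(2)] by (simp add: N.smult_0 n M.smult_0 m f.closed W_M)
    qed
    moreover have "W \<subseteq> V"
    proof
      fix w
      assume "w \<in> W"
      then show "w \<in> V"
        unfolding V_def by (intro CollectI exI[of _ w] exI[of _ 0]) (simp add: M.smult_0 m W_M)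
    qed
    ultimately have "V = W"
      by (rule maximal)
    moreover have "m \<in> V"
      unfolding V_def using W_0
      by (intro CollectI exI[of _ "\<zero>\<^bsub>M\<^esub>"] exI[of _ 1]) (simp add: M.smult_1 m)
    ultimately show False
      using n(2) m(2) by blast
  qed
  let ?s = "inv_into W f"
  have s_W: "?s y \<in> W" and f_s: "f (?s y) = y" if "y \<in> carrier N" for y
    using that onto by (simp_all add: inv_into_into f_inv_into_f)
  have s_eqI: "?s y = x" if "x \<in> W" "f x = y" for x y
    using inv_into_f_eq[OF inj that] .
  show thesis
  proof
    show "?s \<in> additive_maps N M"
    proof (rule additive_mapsI)
      fix x y
      assume x: "x \<in> carrier N" and y: "y \<in> carrier N"
      show "?s x \<in> carrier M"
        by (rule W_M[OF s_W[OF x]])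
      show "?s (x \<oplus>\<^bsub>N\<^esub> y) = ?s x \<oplus>\<^bsub>M\<^esub> ?s y"
        using x y by (intro s_eqI W_add s_W) (simp_all add: f.add W_M s_W f_s)
    qed
    show "f (?s y) = y" if "y \<in> carrier N" for y
      by (rule f_s[OF that])
    show "?s (N.smult y c) = M.smult (?s y) c" if "y \<in> carrier N" for y c
    proof (rule s_eqI)
      show "M.smult (?s y) c \<in> W"
        by (rule W_smult[OF s_W[OF that]])
      show "f (M.smult (?s y) c) = N.smult y c"
        using f_smult[OF W_M[OF s_W[OF that]]] f_s[OF that] by simp
    qed
  qed
qed

section \<open>Dual bases\<close>

context cleft_extension
begin

text \<open>Maps out of the tensor product of \<open>C\<close>, \<open>I\<close>, \<open>C\<close>
  over k, in curried form: balancing is required for scalars only, not for elements of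
  \<open>C\<close>.\<close>

definition trilinear :: "('m, 'x) ring_scheme \<Rightarrow> ('a \<Rightarrow> 'a \<Rightarrow> 'a \<Rightarrow> 'm) \<Rightarrow> bool" where
  "trilinear M b \<longleftrightarrow>
     (\<forall>c\<in>C. \<forall>y\<in>I. \<forall>c'\<in>C. b c y c' \<in> carrier M) \<and>
     (\<forall>c\<in>C. \<forall>d\<in>C. \<forall>y\<in>I. \<forall>c'\<in>C. b (c + d) y c' = b c y c' \<oplus>\<^bsub>M\<^esub> b d y c') \<and>
     (\<forall>c\<in>C. \<forall>y\<in>I. \<forall>z\<in>I. \<forall>c'\<in>C. b c (y + z) c' = b c y c' \<oplus>\<^bsub>M\<^esub> b c z c') \<and>
     (\<forall>c\<in>C. \<forall>y\<in>I. \<forall>c'\<in>C. \<forall>d'\<in>C. b c y (c' + d') = b c y c' \<oplus>\<^bsub>M\<^esub> b c y d') \<and>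
     (\<forall>c\<in>C. \<forall>y\<in>I. \<forall>c'\<in>C. \<forall>k. b (c * scale k 1) y c' = b c (scale k 1 * y) c') \<and>
     (\<forall>c\<in>C. \<forall>y\<in>I. \<forall>c'\<in>C. \<forall>k. b c (y * scale k 1) c' = b c y (scale k 1 * c'))"

lemma trilinearI:
  assumes "\<And>c y c'. c \<in> C \<Longrightarrow> y \<in> I \<Longrightarrow> c' \<in> C \<Longrightarrow> b c y c' \<in> carrier M"
    and "\<And>c d y c'. c \<in> C \<Longrightarrow> d \<in> C \<Longrightarrow> y \<in> I \<Longrightarrow> c' \<in> C \<Longrightarrow> b (c + d) y c' = b c y c' \<oplus>\<^bsub>M\<^esub> b d y c'"
    and "\<And>c y z c'. c \<in> C \<Longrightarrow> y \<in> I \<Longrightarrow> z \<in> I \<Longrightarrow> c' \<in> C \<Longrightarrow> b c (y + z) c' = b c y c' \<oplus>\<^bsub>M\<^esub> b c z c'"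
    and "\<And>c y c' d'. c \<in> C \<Longrightarrow> y \<in> I \<Longrightarrow> c' \<in> C \<Longrightarrow> d' \<in> C \<Longrightarrow> b c y (c' + d') = b c y c' \<oplus>\<^bsub>M\<^esub> b c y d'"
    and "\<And>c y c' k. c \<in> C \<Longrightarrow> y \<in> I \<Longrightarrow> c' \<in> C \<Longrightarrow> b (c * scale k 1) y c' = b c (scale k 1 * y) c'"
    and "\<And>c y c' k. c \<in> C \<Longrightarrow> y \<in> I \<Longrightarrow> c' \<in> C \<Longrightarrow> b c (y * scale k 1) c' = b c y (scale k 1 * c')"
  shows "trilinear M b"
  unfolding trilinear_def by (intro conjI ballI allI assms)

lemma
  assumes "trilinear M b" "c \<in> C" "y \<in> I" "c' \<in> C"
  shows trilinear_closed: "b c y c' \<in> carrier M"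
    and trilinear_add1: "d \<in> C \<Longrightarrow> b (c + d) y c' = b c y c' \<oplus>\<^bsub>M\<^esub> b d y c'"
    and trilinear_add2: "z \<in> I \<Longrightarrow> b c (y + z) c' = b c y c' \<oplus>\<^bsub>M\<^esub> b c z c'"
    and trilinear_add3: "d' \<in> C \<Longrightarrow> b c y (c' + d') = b c y c' \<oplus>\<^bsub>M\<^esub> b c y d'"
    and trilinear_scalar1: "b (c * scale k 1) y c' = b c (scale k 1 * y) c'"
    and trilinear_scalar2: "b c (y * scale k 1) c' = b c y (scale k 1 * c')"
proof -
  note t = assms(1)[unfolded trilinear_def]
  show "b c y c' \<in> carrier M"
    using t[THEN conjunct1] assms(2-) by simp
  show "d \<in> C \<Longrightarrow> b (c + d) y c' = b c y c' \<oplus>\<^bsub>M\<^esub> b d y c'"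
    using t[THEN conjunct2, THEN conjunct1] assms(2-) by simp
  show "z \<in> I \<Longrightarrow> b c (y + z) c' = b c y c' \<oplus>\<^bsub>M\<^esub> b c z c'"
    using t[THEN conjunct2, THEN conjunct2, THEN conjunct1] assms(2-) by simp
  show "d' \<in> C \<Longrightarrow> b c y (c' + d') = b c y c' \<oplus>\<^bsub>M\<^esub> b c y d'"
    using t[THEN conjunct2, THEN conjunct2, THEN conjunct2, THEN conjunct1] assms(2-) by simp
  show "b (c * scale k 1) y c' = b c (scale k 1 * y) c'"
    using t[THEN conjunct2, THEN conjunct2, THEN conjunct2, THEN conjunct2, THEN conjunct1] assms(2-) by blast
  show "b c (y * scale k 1) c' = b c y (scale k 1 * c')"
    using t[THEN conjunct2, THEN conjunct2, THEN conjunct2, THEN conjunct2, THEN conjunct2] assms(2-) by blast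
qed

text \<open>The image of k in the algebra. Balancing over it makes tensor products over k an
  instance of the general construction.\<close>

abbreviation scalars :: "'a set" where "scalars \<equiv> range (\<lambda>k. scale k 1)"

lemma mem3: "xs \<in> listset [C, I, C] \<longleftrightarrow> (\<exists>c y c'. xs = [c, y, c'] \<and> c \<in> C \<and> y \<in> I \<and> c' \<in> C)"
  unfolding listset_iff by (auto simp: list_all2_Cons2)

lemma mem2: "xs \<in> listset [C, I] \<longleftrightarrow> (\<exists>c y. xs = [c, y] \<and> c \<in> C \<and> y \<in> I)"
  unfolding listset_iff by (auto simp: list_all2_Cons2)

lemma split3: "us @ x # vs = [a, b, c] \<longleftrightarrow>
    us = [] \<and> x = a \<and> vs = [b, c] \<or> us = [a] \<and> x = b \<and> vs = [c] \<or> us = [a, b] \<and> x = c \<and> vs = []"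
  by (auto simp: append_eq_Cons_conv)

lemma split2: "us @ x # vs = [a, b] \<longleftrightarrow> us = [] \<and> x = a \<and> vs = [b] \<or> us = [a] \<and> x = b \<and> vs = []"
  by (auto simp: append_eq_Cons_conv)

lemma trilinear_multilinear:
  assumes "trilinear M b"
  shows "multilinear scalars [C, I, C] M (\<lambda>xs. b (xs ! 0) (xs ! 1) (xs ! 2))"
proof (rule multilinearI)
  fix xs
  assume "xs \<in> listset [C, I, C]"
  then show "b (xs ! 0) (xs ! 1) (xs ! 2) \<in> carrier M"
    using trilinear_closed[OF assms] unfolding mem3 by auto
next
  fix us x y and vs :: "'a list"
  let ?b = "\<lambda>xs. b (xs ! 0) (xs ! 1) (xs ! 2)"
  assume x: "us @ x # vs \<in> listset [C, I, C]" and y: "us @ y # vs \<in> listset [C, I, C]"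
  from x obtain c1 y1 d1 where 1: "us @ x # vs = [c1, y1, d1]" "c1 \<in> C" "y1 \<in> I" "d1 \<in> C"
    unfolding mem3 by blast
  from y obtain c2 y2 d2 where 2: "us @ y # vs = [c2, y2, d2]" "c2 \<in> C" "y2 \<in> I" "d2 \<in> C"
    unfolding mem3 by blast
  from 1(1) consider "us = []" "x = c1" "vs = [y1, d1]" | "us = [c1]" "x = y1" "vs = [d1]"
    | "us = [c1, y1]" "x = d1" "vs = []"
    unfolding split3 by blast
  then show "?b (us @ (x + y) # vs) = ?b (us @ x # vs) \<oplus>\<^bsub>M\<^esub> ?b (us @ y # vs)"
    using 1(2-) 2
    by cases (simp_all add: trilinear_add1[OF assms] trilinear_add2[OF assms] trilinear_add3[OF assms])
next
  fix us x c y and vs :: "'a list"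
  let ?b = "\<lambda>xs. b (xs ! 0) (xs ! 1) (xs ! 2)"
  assume c: "c \<in> scalars" and "us @ x # y # vs \<in> listset [C, I, C]"
  then obtain c1 y1 d1 where 1: "us @ x # y # vs = [c1, y1, d1]" "c1 \<in> C" "y1 \<in> I" "d1 \<in> C"
    unfolding mem3 by blast
  from 1(1) consider "us = []" "x = c1" "y = y1" "vs = [d1]" | "us = [c1]" "x = y1" "y = d1" "vs = []"
    unfolding split3 by blast
  then show "?b (us @ (x * c) # y # vs) = ?b (us @ x # (c * y) # vs)"
    using 1(2-) c by cases (auto simp: trilinear_scalar1[OF assms] trilinear_scalar2[OF assms])
qed

lemma factor_closed:
  assumes "X = C \<or> X = I" "x \<in> X"
  shows "y \<in> X \<Longrightarrow> x + y \<in> X" "c \<in> C \<Longrightarrow> c * x \<in> X" "c \<in> C \<Longrightarrow> x * c \<in> X"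
  using assms subspace_add[OF subspace_C, of x y] subspace_add[OF subspace_I, of x y]
  by (auto simp: mult_C mult_I_left mult_I_right)

lemma bimodule_tensor_free: "bimodule_tensor scale scalars [C, I, C] C C C [I]"
proof unfold_locales
  fix X x y c
  assume "X \<in> set [C, I, C]" and x: "x \<in> X"
  then have X: "X = C \<or> X = I"
    by auto
  show "y \<in> X \<Longrightarrow> x + y \<in> X"
    by (rule factor_closed(1)[OF X x])
  show "c \<in> scalars \<Longrightarrow> c * x \<in> X" "c \<in> scalars \<Longrightarrow> x * c \<in> X"
    using factor_closed(2,3)[OF X x] scalar_C by auto
qed (auto simp: scalar_C mult_C subspace_add[OF subspace_C])

lemma bimodule_tensor_CI: "bimodule_tensor scale C [C, I] C C I []"
proof unfold_locales
  fix X x y c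
  assume "X \<in> set [C, I]" and x: "x \<in> X"
  then have X: "X = C \<or> X = I"
    by auto
  show "y \<in> X \<Longrightarrow> x + y \<in> X" "c \<in> C \<Longrightarrow> c * x \<in> X" "c \<in> C \<Longrightarrow> x * c \<in> X"
    using factor_closed[OF X x] by blast+
qed (simp_all add: scalar_C mult_C subspace_add[OF subspace_C] mult_I_right)

end

section \<open>Splitting the multiplication C \<otimes>_k I \<otimes>_k C \<rightarrow> I\<close>

context cleft_extension
begin

lemma trilinear_mult:
  assumes b: "b \<in> additive_maps (sub_bimodule I) M"
  shows "trilinear M (\<lambda>c y c'. b (c * y * c'))"
proof -
  have bcl: "b y \<in> carrier M" if "y \<in> I" for y
    using additive_maps_closed[OF b] that by (simp add: sub_bimodule_def)
  have badd: "b (y + z) = b y \<oplus>\<^bsub>M\<^esub> b z" if "y \<in> I" "z \<in> I" for y z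
    using additive_maps_add[OF b] that by (simp add: sub_bimodule_def)
  show ?thesis
    by (rule trilinearI)
      (simp_all add: bcl badd mult_I_left mult_I_right distrib_left distrib_right mult.assoc)
qed

interpretation F: bimodule_tensor scale scalars "[C, I, C]" C C C "[I]"
  by (rule bimodule_tensor_free)

interpretation N: bimodule_tensor scale C "[C, I]" C C I "[]"
  by (rule bimodule_tensor_CI)

text \<open>Under the isomorphism of \<open>C \<otimes>\<^sub>C I\<close> with \<open>I\<close> this
  is full multiplication; the left product stays unevaluated as a tensor over
  \<open>C\<close>.\<close>

definition mult_last :: "'a tens \<Rightarrow> 'a tens" where
  "mult_last = tensor_lift N.T (\<lambda>xs. N.pure [xs ! 0, xs ! 1 * xs ! 2])"

lemma mult_last_hom: "mult_last \<in> bimodule_hom C F.B N.B" (is ?hom)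
  and mult_last_pure: "c \<in> C \<Longrightarrow> y \<in> I \<Longrightarrow> c' \<in> C \<Longrightarrow> mult_last (F.pure [c, y, c']) = N.pure [c, y * c']"
proof -
  have add1: "N.pure [c + d, y] = N.pure [c, y] \<oplus>\<^bsub>N.T\<^esub> N.pure [d, y]"
    if "c \<in> C" "d \<in> C" "y \<in> I" for c d y
    using N.pure_add[of "[]" c "[y]" d] that by (simp add: mem2 del: listset.simps)
  have add2: "N.pure [c, y + z] = N.pure [c, y] \<oplus>\<^bsub>N.T\<^esub> N.pure [c, z]"
    if "c \<in> C" "z \<in> I" "y \<in> I" for c z y
    using N.pure_add[of "[c]" y "[]" z] that by (simp add: mem2 del: listset.simps)
  have "trilinear N.T (\<lambda>c y c'. N.pure [c, y * c'])"
  proof (rule trilinearI)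
    fix c y c'
    assume cy: "c \<in> C" "y \<in> I" "c' \<in> C"
    then show "N.pure [c, y * c'] \<in> carrier N.T"
      by (intro N.pure_closed) (simp add: mem2 mult_I_right del: listset.simps)
    show "N.pure [c + d, y * c'] = N.pure [c, y * c'] \<oplus>\<^bsub>N.T\<^esub> N.pure [d, y * c']" if "d \<in> C" for d
      using cy that by (simp add: add1 mult_I_right)
    show "N.pure [c, (y + z) * c'] = N.pure [c, y * c'] \<oplus>\<^bsub>N.T\<^esub> N.pure [c, z * c']" if "z \<in> I" for z
      using cy that by (simp add: add2 mult_I_right distrib_right)
    show "N.pure [c, y * (c' + d)] = N.pure [c, y * c'] \<oplus>\<^bsub>N.T\<^esub> N.pure [c, y * d]" if "d \<in> C" for d
      using cy that by (simp add: add2 mult_I_right distrib_left)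
    show "N.pure [c * scale k 1, y * c'] = N.pure [c, scale k 1 * y * c']" for k
      using N.pure_balanced[OF scalar_C, of "[]" c "y * c'" "[]" k] cy
      by (simp add: mem2 mult_I_right mult.assoc del: listset.simps)
    show "N.pure [c, y * scale k 1 * c'] = N.pure [c, y * (scale k 1 * c')]" for k
      by (simp add: mult.assoc)
  qed
  from trilinear_multilinear[OF this]
  have ml: "multilinear scalars [C, I, C] N.T (\<lambda>xs. N.pure [xs ! 0, xs ! 1 * xs ! 2])" .
  then have "tensor_lift N.B (\<lambda>xs. N.pure [xs ! 0, xs ! 1 * xs ! 2]) \<in> bimodule_hom C F.B N.B"
  proof (intro F.lift_bimodule_hom N.bimodule_B)
    fix a xs
    assume "a \<in> C" "xs \<in> listset [C, I, C]"
    then show "N.pure [((a * hd xs) # tl xs) ! 0, ((a * hd xs) # tl xs) ! 1 * ((a * hd xs) # tl xs) ! 2] =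
        lact N.B a (N.pure [xs ! 0, xs ! 1 * xs ! 2])"
      "N.pure [(butlast xs @ [last xs * a]) ! 0, (butlast xs @ [last xs * a]) ! 1 * (butlast xs @ [last xs * a]) ! 2] =
        ract N.B (N.pure [xs ! 0, xs ! 1 * xs ! 2]) a"
      by (auto simp: mem3 mem2 N.lact_pure N.ract_pure mult_I_right mult.assoc simp del: listset.simps)
  qed simp
  then show ?hom
    by (simp add: mult_last_def)
  show "mult_last (F.pure [c, y, c']) = N.pure [c, y * c']" if "c \<in> C" "y \<in> I" "c' \<in> C"
    unfolding mult_last_def using that by (subst F.lift_pure[OF N.abelian_group_T ml]) (simp_all add: mem3 del: listset.simps)
qed

lemma mult_last_onto:
  "mult_last ` carrier F.B = carrier N.B"
proof -
  interpret f: additive_map F.T N.T mult_last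
    using bimodule_hom_additive[OF mult_last_hom]
    by (simp add: additive_map_def additive_map_axioms_def F.abelian_group_T N.abelian_group_T)
  have "q \<in> mult_last ` carrier F.T" if "q \<in> carrier N.T" for q
    using that
  proof (induction rule: N.tensor_induct)
    case (pure xs)
    then obtain c y where xs: "xs = [c, y]" "c \<in> C" "y \<in> I"
      unfolding mem2 by blast
    show ?case
    proof (rule image_eqI)
      show "N.pure xs = mult_last (F.pure [c, y, 1])"
        using xs by (simp add: mult_last_pure one_C)
      show "F.pure [c, y, 1] \<in> carrier F.T"
        using xs by (intro F.pure_closed) (simp add: mem3 one_C del: listset.simps)
    qed
  next
    case zero
    show ?case
      by (intro image_eqI[of _ _ "\<zero>\<^bsub>F.T\<^esub>"]) (simp_all add: f.zero)
  next
    case (diff p q)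
    then obtain p' q' where "p' \<in> carrier F.T" "p = mult_last p'" "q' \<in> carrier F.T" "q = mult_last q'"
      by blast
    then show ?case
      by (intro image_eqI[of _ _ "p' \<ominus>\<^bsub>F.T\<^esub> q'"]) (simp_all add: f.diff)
  qed
  moreover have "mult_last q \<in> carrier N.T" if "q \<in> carrier F.T" for q
    by (rule f.closed[OF that])
  ultimately show ?thesis
    by (simp only: tensor_bimodule_simps) blast
qed

lemma multilinear_mult_CI:
  "multilinear C [C, I] (sub_bimodule I) (\<lambda>xs. xs ! 0 * xs ! 1)"
proof (rule multilinearI)
  fix xs
  assume "xs \<in> listset [C, I]"
  then show "xs ! 0 * xs ! 1 \<in> carrier (sub_bimodule I)"
    unfolding mem2 by (auto simp: sub_bimodule_def mult_I_left)
next
  fix us x y and vs :: "'a list"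
  assume "us @ x # vs \<in> listset [C, I]"
  then consider b where "us = []" "vs = [b]" | a where "us = [a]" "vs = []"
    unfolding mem2 split2 by blast
  then show "(us @ (x + y) # vs) ! 0 * (us @ (x + y) # vs) ! 1 =
      (us @ x # vs) ! 0 * (us @ x # vs) ! 1 \<oplus>\<^bsub>sub_bimodule I\<^esub> (us @ y # vs) ! 0 * (us @ y # vs) ! 1"
    by cases (simp_all add: sub_bimodule_def distrib_left distrib_right)
next
  fix us x c y and vs :: "'a list"
  assume "us @ x # y # vs \<in> listset [C, I]"
  then have "us = [] \<and> vs = []"
    unfolding mem2 split2 by blast
  then show "(us @ (x * c) # y # vs) ! 0 * (us @ (x * c) # y # vs) ! 1 =
      (us @ x # (c * y) # vs) ! 0 * (us @ x # (c * y) # vs) ! 1"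
    by (simp add: mult.assoc)
qed

text \<open>Projectivity splits the multiplication map from the free bimodule \<open>C \<otimes>\<^sub>k I \<otimes>\<^sub>k C\<close> to \<open>I\<close>;
  the module \<open>I\<close> is replaced by its copy \<open>C \<otimes>\<^sub>C I\<close>, which lives in the type of tensors.\<close>

lemma projective_section:
  assumes "projective_bimodule TYPE('a tens) scale C (sub_bimodule I)"
  obtains \<sigma> where "\<sigma> \<in> bimodule_hom C (sub_bimodule I) F.B"
    and "\<And>(M :: ('m, 'x) ring_scheme) b x. abelian_group M \<Longrightarrow> b \<in> additive_maps (sub_bimodule I) M \<Longrightarrow> x \<in> I \<Longrightarrow>
      tensor_lift M (\<lambda>xs. b (xs ! 0 * xs ! 1 * xs ! 2)) (\<sigma> x) = b x"
proof -
  have bI: "bimodule scale C (sub_bimodule I)"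
    using assms by (simp add: projective_bimodule_def)
  then have aI: "abelian_group (sub_bimodule I)"
    by (simp add: bimodule_def)
  have mem: "[1, x] \<in> listset [C, I]" if "x \<in> I" for x
    using that by (simp add: mem2 one_C del: listset.simps)
  \<comment> \<open>The isomorphism of \<open>I\<close> onto its copy; left linearity is the
    balancing a \<otimes> x = 1 \<otimes> a x.\<close>
  have g: "(\<lambda>x. N.pure [1, x]) \<in> bimodule_hom C (sub_bimodule I) N.B"
  proof (rule bimodule_homI)
    show "(\<lambda>x. N.pure [1, x]) \<in> additive_maps (sub_bimodule I) N.B"
    proof (rule additive_mapsI)
      fix x
      assume "x \<in> carrier (sub_bimodule I)"
      then have x: "x \<in> I"
        by (simp add: sub_bimodule_def)
      show "N.pure [1, x] \<in> carrier N.B"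
        unfolding tensor_bimodule_simps by (rule N.pure_closed[OF mem[OF x]])
      fix y
      assume "y \<in> carrier (sub_bimodule I)"
      then have y: "y \<in> I"
        by (simp add: sub_bimodule_def)
      show "N.pure [1, x \<oplus>\<^bsub>sub_bimodule I\<^esub> y] = N.pure [1, x] \<oplus>\<^bsub>N.B\<^esub> N.pure [1, y]"
        using N.pure_add[of "[1]" x "[]" y] mem[OF x] mem[OF y]
        by (simp add: sub_bimodule_def del: listset.simps)
    qed
    fix a x
    assume "a \<in> C" "x \<in> carrier (sub_bimodule I)"
    then have a: "a \<in> C" and x: "x \<in> I"
      by (simp_all add: sub_bimodule_def)
    have "N.pure [a, x] = N.pure [1, a * x]"
      using N.pure_balanced[OF a, of "[]" 1 x "[]"] mem[OF x]
      by (simp only: append_Nil mult_1_left mult_1_right simp_thms)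
    moreover have "lact N.B a (N.pure [1, x]) = N.pure [a, x]"
      using N.lact_pure[OF a mem[OF x]] by simp
    ultimately show "N.pure [1, lact (sub_bimodule I) a x] = lact N.B a (N.pure [1, x])"
      by (simp add: sub_bimodule_def)
    show "N.pure [1, ract (sub_bimodule I) x a] = ract N.B (N.pure [1, x]) a"
      using N.ract_pure[OF a mem[OF x]] by (simp add: sub_bimodule_def)
  qed
  have lifting: "\<exists>h\<in>bimodule_hom C (sub_bimodule I) M. \<forall>x\<in>carrier (sub_bimodule I). f (h x) = g x"
    if "bimodule scale C M" "bimodule scale C N" "f \<in> bimodule_hom C M N"
      "g \<in> bimodule_hom C (sub_bimodule I) N" "f ` carrier M = carrier N"
    for M N :: "('a, 'a tens) bimodule" and f g
    using assms that unfolding projective_bimodule_def by simp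
  obtain \<sigma> where \<sigma>: "\<sigma> \<in> bimodule_hom C (sub_bimodule I) F.B"
    "\<And>x. x \<in> carrier (sub_bimodule I) \<Longrightarrow> mult_last (\<sigma> x) = N.pure [1, x]"
    using lifting[OF F.bimodule_B N.bimodule_B mult_last_hom g mult_last_onto] by (elim bexE) simp
  \<comment> \<open>The identity \<Sum> c y c' = x, seen through an arbitrary additive
    \<open>b\<close>. In this form it can be applied when a lift is compared with the given
    map.\<close>
  have "tensor_lift M (\<lambda>xs. b (xs ! 0 * xs ! 1 * xs ! 2)) (\<sigma> x) = b x"
    if M: "abelian_group M" and b: "b \<in> additive_maps (sub_bimodule I) M" and x: "x \<in> I"
    for M :: "('m, 'x) ring_scheme" and b x
  proof -
    \<comment> \<open>The inverse of the isomorphism onto the copy, which brings the splitting back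
      to \<open>I\<close> itself.\<close>
    define \<mu> where "\<mu> = tensor_lift (sub_bimodule I) (\<lambda>xs. xs ! 0 * xs ! 1)"
    have \<mu>: "\<mu> \<in> additive_maps N.T (sub_bimodule I)"
      unfolding \<mu>_def by (rule N.lift_additive[OF aI multilinear_mult_CI])
    have \<mu>_pure: "\<mu> (N.pure [c, y]) = c * y" if "c \<in> C" "y \<in> I" for c y
      unfolding \<mu>_def using that by (subst N.lift_pure[OF aI multilinear_mult_CI]) (simp_all add: mem2 del: listset.simps)
    have f: "mult_last \<in> additive_maps F.T N.T"
      using bimodule_hom_additive[OF mult_last_hom] by simp
    from trilinear_multilinear[OF trilinear_mult[OF b]]
    have ml: "multilinear scalars [C, I, C] M (\<lambda>xs. b (xs ! 0 * xs ! 1 * xs ! 2))" .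
    have \<sigma>x: "\<sigma> x \<in> carrier F.T"
      using additive_maps_closed[OF bimodule_hom_additive[OF \<sigma>(1)]] x by (simp add: sub_bimodule_def)
    have "tensor_lift M (\<lambda>xs. b (xs ! 0 * xs ! 1 * xs ! 2)) (\<sigma> x) = b (\<mu> (mult_last (\<sigma> x)))"
    proof (rule F.tensor_hom_eq[OF M F.lift_additive[OF M ml] _ _ \<sigma>x])
      show "(\<lambda>q. b (\<mu> (mult_last q))) \<in> additive_maps F.T M"
        by (rule additive_maps_comp[OF additive_maps_comp[OF f \<mu>] b])
      fix xs
      assume "xs \<in> listset [C, I, C]"
      then obtain c y c' where xs: "xs = [c, y, c']" "c \<in> C" "y \<in> I" "c' \<in> C"
        unfolding mem3 by blast
      show "tensor_lift M (\<lambda>xs. b (xs ! 0 * xs ! 1 * xs ! 2)) (F.pure xs) = b (\<mu> (mult_last (F.pure xs)))"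
        using xs
        by (subst F.lift_pure[OF M ml])
          (simp_all add: mem3 mult_last_pure \<mu>_pure mult_I_right mult.assoc del: listset.simps)
    qed
    also have "mult_last (\<sigma> x) = N.pure [1, x]"
      using \<sigma>(2) x by (simp add: sub_bimodule_def)
    also have "\<mu> (N.pure [1, x]) = x"
      using \<mu>_pure[OF one_C x] by simp
    finally show ?thesis .
  qed
  with \<sigma>(1) show thesis
    by (rule that)
qed

end

text \<open>A bimodule map \<open>\<sigma> : I \<rightarrow> C \<otimes>\<^sub>k I \<otimes>\<^sub>k C\<close> enters only through \<open>expand M b x = \<Sum> b c y c'\<close>, where
  \<open>\<sigma> x = \<Sum> c \<otimes> y \<otimes> c'\<close>.\<close>

locale dual_basis = cleft_extension scale C I
  for scale :: "'k::field \<Rightarrow> 'a::{ring, monoid_mult} \<Rightarrow> 'a" and C I +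
  fixes \<sigma> :: "'a \<Rightarrow> 'a tens"
  assumes \<sigma>: "\<sigma> \<in> bimodule_hom C (sub_bimodule I) (tensor_bimodule scalars [C, I, C])"
begin

interpretation F: bimodule_tensor scale scalars "[C, I, C]" C C C "[I]"
  by (rule bimodule_tensor_free)

section \<open>The calculus of expansions along \<sigma>\<close>

definition expand :: "('m, 'x) ring_scheme \<Rightarrow> ('a \<Rightarrow> 'a \<Rightarrow> 'a \<Rightarrow> 'm) \<Rightarrow> 'a \<Rightarrow> 'm" where
  "expand M b x = tensor_lift M (\<lambda>xs. b (xs ! 0) (xs ! 1) (xs ! 2)) (\<sigma> x)"

lemma \<sigma>_closed: "x \<in> I \<Longrightarrow> \<sigma> x \<in> carrier F.T"
  using additive_maps_closed[OF bimodule_hom_additive[OF \<sigma>], of x] by (simp add: sub_bimodule_def)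

lemma \<sigma>_add: "x \<in> I \<Longrightarrow> y \<in> I \<Longrightarrow> \<sigma> (x + y) = \<sigma> x \<oplus>\<^bsub>F.T\<^esub> \<sigma> y"
  using additive_maps_add[OF bimodule_hom_additive[OF \<sigma>], of x y] by (simp add: sub_bimodule_def)

lemma \<sigma>_left: "x \<in> I \<Longrightarrow> c \<in> C \<Longrightarrow> \<sigma> (c * x) = lact F.B c (\<sigma> x)"
  using bimodule_hom_lact[OF \<sigma>, of c x] by (simp add: sub_bimodule_def)

lemma \<sigma>_right: "x \<in> I \<Longrightarrow> c \<in> C \<Longrightarrow> \<sigma> (x * c) = ract F.B (\<sigma> x) c"
  using bimodule_hom_ract[OF \<sigma>, of c x] by (simp add: sub_bimodule_def)

lemma lift3_pure:
  assumes "abelian_group M" "trilinear M b" "c \<in> C" "y \<in> I" "c' \<in> C"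
  shows "tensor_lift M (\<lambda>xs. b (xs ! 0) (xs ! 1) (xs ! 2)) (F.pure [c, y, c']) = b c y c'"
  using assms(3-)
  by (subst F.lift_pure[OF assms(1) trilinear_multilinear[OF assms(2)]])
    (simp_all add: mem3 del: listset.simps)

lemma lift3_additive:
  "abelian_group M \<Longrightarrow> trilinear M b \<Longrightarrow>
     tensor_lift M (\<lambda>xs. b (xs ! 0) (xs ! 1) (xs ! 2)) \<in> additive_maps F.T M"
  by (intro F.lift_additive trilinear_multilinear)

lemma hom_eq3:
  assumes "abelian_group M" "f \<in> additive_maps F.T M" "g \<in> additive_maps F.T M"
    and "\<And>c y c'. c \<in> C \<Longrightarrow> y \<in> I \<Longrightarrow> c' \<in> C \<Longrightarrow> f (F.pure [c, y, c']) = g (F.pure [c, y, c'])"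
    and "q \<in> carrier F.T"
  shows "f q = g q"
proof (rule F.tensor_hom_eq[OF assms(1-3) _ assms(5)])
  fix xs
  assume "xs \<in> listset [C, I, C]"
  then obtain c y c' where "xs = [c, y, c']" "c \<in> C" "y \<in> I" "c' \<in> C"
    unfolding mem3 by blast
  then show "f (F.pure xs) = g (F.pure xs)"
    using assms(4) by simp
qed

lemma expand_closed:
  "abelian_group M \<Longrightarrow> trilinear M b \<Longrightarrow> x \<in> I \<Longrightarrow> expand M b x \<in> carrier M"
  unfolding expand_def by (intro additive_maps_closed[OF lift3_additive] \<sigma>_closed)

lemma expand_add:
  "abelian_group M \<Longrightarrow> trilinear M b \<Longrightarrow> x \<in> I \<Longrightarrow> y \<in> I \<Longrightarrow>
     expand M b (x + y) = expand M b x \<oplus>\<^bsub>M\<^esub> expand M b y"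
  unfolding expand_def by (simp only: \<sigma>_add additive_maps_add[OF lift3_additive] \<sigma>_closed)

lemma expand_eqI:
  assumes "abelian_group M" "trilinear M b" "trilinear M b'"
    and "\<And>c y c'. c \<in> C \<Longrightarrow> y \<in> I \<Longrightarrow> c' \<in> C \<Longrightarrow> b c y c' = b' c y c'"
    and "x \<in> I"
  shows "expand M b x = expand M b' x"
  unfolding expand_def
  by (rule hom_eq3[OF assms(1) lift3_additive[OF assms(1,2)] lift3_additive[OF assms(1,3)] _ \<sigma>_closed[OF assms(5)]])
    (simp only: lift3_pure[OF assms(1,2)] lift3_pure[OF assms(1,3)] assms(4))

lemma trilinear_left: "trilinear M b \<Longrightarrow> d \<in> C \<Longrightarrow> trilinear M (\<lambda>c. b (d * c))"
  by (rule trilinearI)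
    (simp_all add: trilinear_closed trilinear_add1 trilinear_add2 trilinear_add3 trilinear_scalar1
      trilinear_scalar2 mult_C distrib_left flip: mult.assoc)

lemma trilinear_right: "trilinear M b \<Longrightarrow> d \<in> C \<Longrightarrow> trilinear M (\<lambda>c y c'. b c y (c' * d))"
  by (rule trilinearI)
    (simp_all add: trilinear_closed trilinear_add1 trilinear_add2 trilinear_add3 trilinear_scalar1
      trilinear_scalar2 mult_C distrib_right mult.assoc)

text \<open>Left linearity of \<sigma> over \<open>C\<close>: the element \<open>d\<close> ends up
  on the left entry of the value, from where a form can pass it to the preceding tensor factor.
  \<open>expand_right\<close> does the same for the following factor.\<close>

lemma expand_left:
  assumes "abelian_group M" "trilinear M b" "d \<in> C" "x \<in> I"
  shows "expand M b (d * x) = expand M (\<lambda>c. b (d * c)) x"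
proof -
  note t = trilinear_left[OF assms(2,3)]
  show ?thesis
    unfolding expand_def \<sigma>_left[OF assms(4,3)]
  proof (rule hom_eq3[OF assms(1) _ lift3_additive[OF assms(1) t] _ \<sigma>_closed[OF assms(4)]])
    show "(\<lambda>q. tensor_lift M (\<lambda>xs. b (xs ! 0) (xs ! 1) (xs ! 2)) (lact F.B d q)) \<in> additive_maps F.T M"
      by (rule additive_maps_comp[OF F.lact_B_additive[OF assms(3)] lift3_additive[OF assms(1,2)]])
    fix c y c'
    assume cy: "c \<in> C" "y \<in> I" "c' \<in> C"
    then have "lact F.B d (F.pure [c, y, c']) = F.pure [d * c, y, c']"
      using assms(3) by (subst F.lact_pure) (simp_all add: mem3 del: listset.simps)
    then show "tensor_lift M (\<lambda>xs. b (xs ! 0) (xs ! 1) (xs ! 2)) (lact F.B d (F.pure [c, y, c'])) =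
        tensor_lift M (\<lambda>xs. b (d * xs ! 0) (xs ! 1) (xs ! 2)) (F.pure [c, y, c'])"
      using lift3_pure[OF assms(1,2) mult_C[OF assms(3) cy(1)] cy(2,3)] lift3_pure[OF assms(1) t cy]
      by (simp only:)
  qed
qed

lemma expand_right:
  assumes "abelian_group M" "trilinear M b" "d \<in> C" "x \<in> I"
  shows "expand M b (x * d) = expand M (\<lambda>c y c'. b c y (c' * d)) x"
proof -
  note t = trilinear_right[OF assms(2,3)]
  show ?thesis
    unfolding expand_def \<sigma>_right[OF assms(4,3)]
  proof (rule hom_eq3[OF assms(1) _ lift3_additive[OF assms(1) t] _ \<sigma>_closed[OF assms(4)]])
    show "(\<lambda>q. tensor_lift M (\<lambda>xs. b (xs ! 0) (xs ! 1) (xs ! 2)) (ract F.B q d)) \<in> additive_maps F.T M"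
      by (rule additive_maps_comp[OF F.ract_B_additive[OF assms(3)] lift3_additive[OF assms(1,2)]])
    fix c y c'
    assume cy: "c \<in> C" "y \<in> I" "c' \<in> C"
    then have "ract F.B (F.pure [c, y, c']) d = F.pure [c, y, c' * d]"
      using assms(3) by (subst F.ract_pure) (simp_all add: mem3 del: listset.simps)
    then show "tensor_lift M (\<lambda>xs. b (xs ! 0) (xs ! 1) (xs ! 2)) (ract F.B (F.pure [c, y, c']) d) =
        tensor_lift M (\<lambda>xs. b (xs ! 0) (xs ! 1) (xs ! 2 * d)) (F.pure [c, y, c'])"
      using lift3_pure[OF assms(1,2) cy(1,2) mult_C[OF cy(3) assms(3)]] lift3_pure[OF assms(1) t cy]
      by (simp only:)
  qed
qed

lemma trilinear_comp:
  "trilinear M b \<Longrightarrow> f \<in> additive_maps M N \<Longrightarrow> trilinear N (\<lambda>c y c'. f (b c y c'))"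
  by (rule trilinearI)
    (simp_all add: additive_maps_closed trilinear_closed trilinear_add1 trilinear_add2 trilinear_add3
      additive_maps_add trilinear_scalar1 trilinear_scalar2)

lemma expand_comp:
  assumes "abelian_group M" "abelian_group N" "trilinear M b" "f \<in> additive_maps M N" "x \<in> I"
  shows "f (expand M b x) = expand N (\<lambda>c y c'. f (b c y c')) x"
proof -
  have t: "trilinear N (\<lambda>c y c'. f (b c y c'))"
    by (rule trilinear_comp[OF assms(3,4)])
  show ?thesis
    unfolding expand_def
    by (rule hom_eq3[OF assms(2) additive_maps_comp[OF lift3_additive[OF assms(1,3)] assms(4)]
          lift3_additive[OF assms(2) t] _ \<sigma>_closed[OF assms(5)]])
      (simp only: lift3_pure[OF assms(1,3)] lift3_pure[OF assms(2) t])
qed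

lemma trilinear_sum:
  assumes "abelian_group M" "trilinear M b" "trilinear M b'"
  shows "trilinear M (\<lambda>c y c'. b c y c' \<oplus>\<^bsub>M\<^esub> b' c y c')"
proof -
  interpret M: abelian_group M by fact
  note b = trilinear_closed[OF assms(2)] trilinear_add1[OF assms(2)] trilinear_add2[OF assms(2)]
    trilinear_add3[OF assms(2)] trilinear_scalar1[OF assms(2)] trilinear_scalar2[OF assms(2)]
  note b' = trilinear_closed[OF assms(3)] trilinear_add1[OF assms(3)] trilinear_add2[OF assms(3)]
    trilinear_add3[OF assms(3)] trilinear_scalar1[OF assms(3)] trilinear_scalar2[OF assms(3)]
  show ?thesis
    by (rule trilinearI) (simp_all add: b b' M.a_ac)
qed

lemma expand_sum:
  assumes "abelian_group M" "trilinear M b" "trilinear M b'" "x \<in> I"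
  shows "expand M (\<lambda>c y c'. b c y c' \<oplus>\<^bsub>M\<^esub> b' c y c') x = expand M b x \<oplus>\<^bsub>M\<^esub> expand M b' x"
proof -
  interpret M: abelian_group M by fact
  have t: "trilinear M (\<lambda>c y c'. b c y c' \<oplus>\<^bsub>M\<^esub> b' c y c')"
    by (rule trilinear_sum[OF assms(1-3)])
  have "(\<lambda>q. tensor_lift M (\<lambda>xs. b (xs ! 0) (xs ! 1) (xs ! 2)) q \<oplus>\<^bsub>M\<^esub>
      tensor_lift M (\<lambda>xs. b' (xs ! 0) (xs ! 1) (xs ! 2)) q) \<in> additive_maps F.T M"
    using lift3_additive[OF assms(1,2)] lift3_additive[OF assms(1,3)]
    by (intro additive_mapsI) (simp_all add: additive_maps_closed additive_maps_add M.a_ac)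
  then show ?thesis
    unfolding expand_def
    by (rule hom_eq3[OF assms(1) lift3_additive[OF assms(1) t] _ _ \<sigma>_closed[OF assms(4)]])
      (simp only: lift3_pure[OF assms(1,2)] lift3_pure[OF assms(1,3)] lift3_pure[OF assms(1) t])
qed

text \<open>For additivity in an entry other than the expanded one: there the form varies and the
  argument of the expansion stays.\<close>

lemma expand_sum_eqI:
  assumes "abelian_group M" "trilinear M b" "trilinear M b1" "trilinear M b2"
    and "\<And>c y c'. c \<in> C \<Longrightarrow> y \<in> I \<Longrightarrow> c' \<in> C \<Longrightarrow> b c y c' = b1 c y c' \<oplus>\<^bsub>M\<^esub> b2 c y c'"
    and "x \<in> I"
  shows "expand M b x = expand M b1 x \<oplus>\<^bsub>M\<^esub> expand M b2 x"
  using expand_eqI[OF assms(1,2) trilinear_sum[OF assms(1,3,4)] assms(5,6)] expand_sum[OF assms(1,3,4,6)]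
  by simp

end

section \<open>Projectivity\<close>

context dual_basis
begin

interpretation P: bimodule_tensor scale C "bar_factors I n" UNIV UNIV UNIV "replicate n I" for n
  by (rule bimodule_tensor_bar)

lemma last2_mem:
  assumes "us @ [x, l] \<in> listset (bar_factors I (Suc n))"
  shows "x \<in> I"
proof -
  have "length us = Suc n" "(us @ [x, l]) ! Suc n \<in> I"
    using assms by (auto simp: bar_listset_iff)
  then show ?thesis
    by (metis nth_append_length)
qed

lemma last2_cases:
  assumes "xs \<in> listset (bar_factors I (Suc n))"
  obtains us x l where "xs = us @ [x, l]" "x \<in> I"
proof -
  have "Suc (Suc n) < length xs"
    using bar_length[OF assms] by simp
  then obtain us x l vs where *: "xs = us @ x # l # vs" "length us = Suc n"
    by (rule split_at)
  then have xs: "xs = us @ [x, l]"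
    using bar_length[OF assms] by simp
  moreover have "x \<in> I"
    using assms xs last2_mem[of us x l n] by simp
  ultimately show thesis
    by (rule that)
qed

lemma last2_update:
  assumes "us @ [x, l] \<in> listset (bar_factors I n)" "us \<noteq> []" "y \<in> I"
  shows "us @ [y, l'] \<in> listset (bar_factors I n)"
proof -
  have n: "n = length us"
    using bar_length[OF assms(1)] by simp
  have "us ! i \<in> I" if "1 \<le> i" "i < length us" for i
    using assms(1) that n by (auto simp: bar_listset_iff nth_append split: if_splits dest!: spec[of _ i])
  then show ?thesis
    using assms(3) n by (auto simp: bar_listset_iff nth_append nth_Cons split: nat.splits)
qed

lemma first2_mem: "l # x # rest \<in> listset (bar_factors I (Suc n)) \<Longrightarrow> x \<in> I"
  by (auto simp: bar_listset_iff dest!: spec[of _ 1])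

lemma first2_cases:
  assumes "xs \<in> listset (bar_factors I (Suc n))"
  obtains l x rest where "xs = l # x # rest" "x \<in> I" "rest \<noteq> []"
proof -
  obtain l x rest where xs: "xs = l # x # rest" "rest \<noteq> []"
    using bar_length[OF assms] by (cases xs; cases "tl xs"; cases "tl (tl xs)") auto
  with assms first2_mem[of l x rest n] that[OF xs(1) _ xs(2)] show thesis
    by simp
qed

lemma first2_update:
  "l # x # rest \<in> listset (bar_factors I (Suc n)) \<Longrightarrow> y \<in> I \<Longrightarrow> l' # y # rest \<in> listset (bar_factors I (Suc n))"
  by (auto simp: bar_listset_iff nth_Cons split: nat.splits)

subsection \<open>Lifting through the last factor\<close>

text \<open>The summand of r for one term d \<otimes> z \<otimes> d' of \<sigma> x_n, with
  \<open>G\<close> in the role of s g. Since \<open>G\<close> is only additive and k-linear, its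
  argument ends in 1, and d' l acts outside on the value.\<close>

definition last_form ::
  "('a, 'u) bimodule \<Rightarrow> ('a tens \<Rightarrow> 'u) \<Rightarrow> nat \<Rightarrow> 'a list \<Rightarrow> 'a \<Rightarrow> 'a \<Rightarrow> 'a \<Rightarrow> 'a \<Rightarrow> 'u" where
  "last_form M G n us l = (\<lambda>d z d'. ract M (G (tau (Suc n) (us @ [d * z, 1]))) (d' * l))"

definition last_lift :: "('a, 'u) bimodule \<Rightarrow> ('a tens \<Rightarrow> 'u) \<Rightarrow> nat \<Rightarrow> 'a tens \<Rightarrow> 'u" where
  "last_lift M G n =
     tensor_lift M (\<lambda>xs. expand M (last_form M G n (butlast (butlast xs)) (last xs)) (last (butlast xs)))"

context
  fixes M :: "('a, 'u) bimodule" and G :: "'a tens \<Rightarrow> 'u" and n :: nat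
  assumes M: "bimodule scale UNIV M" and G: "G \<in> additive_maps (T (Suc n)) M"
    and G_scalar: "\<And>q k. q \<in> carrier (T (Suc n)) \<Longrightarrow> G (ract (P.B (Suc n)) q (scale k 1)) = ract M (G q) (scale k 1)"
begin

interpretation M: bimodule scale UNIV M
  by (rule M)

abbreviation "bar \<equiv> listset (bar_factors I (Suc n))"

lemma last_form_trilinear:
  assumes "us @ [x, l] \<in> bar"
  shows "trilinear M (last_form M G n us l)"
proof -
  have mem: "us @ [y, l'] \<in> bar" if "y \<in> I" for y l'
    using last2_update[OF assms _ that] assms by (cases us) (auto simp: bar_listset_iff)
  let ?G = "\<lambda>y. G (tau (Suc n) (us @ [y, 1]))"
  have G_closed: "?G y \<in> carrier M" if "y \<in> I" for y
    by (rule additive_maps_closed[OF G P.pure_closed[OF mem[OF that]]])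
  have G_add: "?G (y + z) = ?G y \<oplus>\<^bsub>M\<^esub> ?G z" if "y \<in> I" "z \<in> I" for y z
    using P.pure_add[of us y "[1]" "Suc n" z] additive_maps_add[OF G] that by (simp add: mem P.pure_closed)
  \<comment> \<open>The one place where k-linearity of \<open>G\<close> enters: a scalar between z
    and d' leaves the argument of \<open>G\<close> and becomes part of the action on its
    value.\<close>
  have G_sc: "?G (y * scale k 1) = ract M (?G y) (scale k 1)" if "y \<in> I" for y k
  proof -
    have "tau (Suc n) (us @ [y * scale k 1, 1]) = ract (P.B (Suc n)) (tau (Suc n) (us @ [y, 1])) (scale k 1)"
      using P.pure_balanced[OF scalar_C, of us y 1 "[]" "Suc n" k] P.ract_pure[OF _ mem[OF that], of "scale k 1" 1]
        mem[OF that] by (simp add: butlast_append)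
    then show ?thesis
      using G_scalar[OF P.pure_closed[OF mem[OF that]]] by simp
  qed
  show ?thesis
    unfolding last_form_def
  proof (rule trilinearI)
    fix c y c'
    assume cy: "c \<in> C" "y \<in> I" "c' \<in> C"
    note c = mult_I_left[OF cy(2), of c]
    show "ract M (?G (c * y)) (c' * l) \<in> carrier M"
      by (intro M.ract_closed G_closed c) simp
    show "ract M (?G ((c + d) * y)) (c' * l) = ract M (?G (c * y)) (c' * l) \<oplus>\<^bsub>M\<^esub> ract M (?G (d * y)) (c' * l)" for d
      using cy by (simp add: distrib_right G_add mult_I_left M.ract_add G_closed)
    show "ract M (?G (c * (y + z))) (c' * l) = ract M (?G (c * y)) (c' * l) \<oplus>\<^bsub>M\<^esub> ract M (?G (c * z)) (c' * l)"
      if "z \<in> I" for z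
      using cy that by (simp add: distrib_left G_add mult_I_left M.ract_add G_closed)
    show "ract M (?G (c * y)) ((c' + d) * l) = ract M (?G (c * y)) (c' * l) \<oplus>\<^bsub>M\<^esub> ract M (?G (c * y)) (d * l)" for d
      using c by (simp add: distrib_right M.add_ract G_closed)
    show "ract M (?G (c * scale k 1 * y)) (c' * l) = ract M (?G (c * (scale k 1 * y))) (c' * l)" for k
      by (simp only: mult.assoc)
    show "ract M (?G (c * (y * scale k 1))) (c' * l) = ract M (?G (c * y)) (scale k 1 * c' * l)" for k
      using G_sc[OF c, of k] M.mult_ract[of "scale k 1" "c' * l" "?G (c * y)"] G_closed[OF c]
      by (simp only: mult.assoc UNIV_I simp_thms)
  qed
qed

lemma last_form_add1:
  assumes "us @ x # vs @ [w, l] \<in> bar" "us @ y # vs @ [w, l] \<in> bar" "d \<in> C" "z \<in> I" "d' \<in> C"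
  shows "last_form M G n (us @ (x + y) # vs) l d z d' =
    last_form M G n (us @ x # vs) l d z d' \<oplus>\<^bsub>M\<^esub> last_form M G n (us @ y # vs) l d z d'"
proof -
  have mem: "us @ x # vs @ [d * z, 1] \<in> bar" "us @ y # vs @ [d * z, 1] \<in> bar"
    using last2_update[of "us @ x # vs" w l "Suc n" "d * z" 1] last2_update[of "us @ y # vs" w l "Suc n" "d * z" 1]
      assms by (simp_all add: mult_I_left)
  show ?thesis
    using P.pure_add[of us x "vs @ [d * z, 1]" "Suc n" y] mem P.pure_closed[OF mem(1)] P.pure_closed[OF mem(2)]
    by (simp add: last_form_def additive_maps_add[OF G] M.ract_add additive_maps_closed[OF G])
qed

lemma last_form_balanced:
  assumes c: "c \<in> C" and "us @ x # y # vs @ [w, l] \<in> bar" "z \<in> I"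
  shows "last_form M G n (us @ (x * c) # y # vs) l d z d' = last_form M G n (us @ x # (c * y) # vs) l d z d'"
proof -
  have mem: "us @ x # y # vs @ [d * z, 1] \<in> bar"
    using last2_update[of "us @ x # y # vs" w l "Suc n" "d * z" 1] assms by (simp add: mult_I_left)
  show ?thesis
    using P.pure_balanced[OF c, of us x y "vs @ [d * z, 1]" "Suc n"] mem by (simp add: last_form_def)
qed

text \<open>Balancing at the last tensor sign is right linearity of \<sigma> over \<open>C\<close>;
  at the sign before it, left linearity of \<sigma> together with balancing inside \<open>G\<close>;
  further left, balancing inside \<open>G\<close> alone. Additivity follows the same
  division.\<close>

lemma multilinear_last_lift:
  "multilinear C (bar_factors I (Suc n)) M
     (\<lambda>xs. expand M (last_form M G n (butlast (butlast xs)) (last xs)) (last (butlast xs)))" (is "multilinear _ _ _ ?\<rho>")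
proof (rule multilinearI)
  note A = M.abelian_group_axioms
  have \<rho>: "?\<rho> (us @ [x, l]) = expand M (last_form M G n us l) x" for us x l
    by (simp add: butlast_append)
  {
    fix xs
    assume xs: "xs \<in> bar"
    then obtain us x l where "xs = us @ [x, l]" "x \<in> I"
      by (rule last2_cases)
    with xs show "?\<rho> xs \<in> carrier M"
      using expand_closed[OF A last_form_trilinear] by (simp only: \<rho>)
  next
    fix us x y vs
    assume x: "us @ x # vs \<in> bar" and y: "us @ y # vs \<in> bar"
    have len: "length us + length vs = n + 2"
      using bar_length[OF x] by simp
    consider us' w where "us = us' @ [w]" "vs = []" | l where "vs = [l]" | vs' w l where "vs = vs' @ [w, l]"
    proof (cases vs rule: rev_cases)
      case Nil
      then show ?thesis
        using len that(1) by (cases us rule: rev_cases) auto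
    next
      case (snoc ws l)
      then show ?thesis
        using that(2,3) by (cases ws rule: rev_cases) auto
    qed
    then show "?\<rho> (us @ (x + y) # vs) = ?\<rho> (us @ x # vs) \<oplus>\<^bsub>M\<^esub> ?\<rho> (us @ y # vs)"
    proof cases
      case 1
      have mem: "us' @ [w, x] \<in> bar" "us' @ [w, y] \<in> bar"
        using x y 1 by simp_all
      have mem': "us' @ [w, x + y] \<in> bar" and w: "w \<in> I"
        using P.listset_add[OF x y] 1 last2_mem[OF mem(1)] by simp_all
      have ne: "us' \<noteq> []"
        using bar_length[OF mem(1)] by auto
      have "expand M (last_form M G n us' (x + y)) w = expand M (last_form M G n us' x) w \<oplus>\<^bsub>M\<^esub> expand M (last_form M G n us' y) w"
      proof (rule expand_sum_eqI[OF A last_form_trilinear[OF mem'] last_form_trilinear[OF mem(1)]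
            last_form_trilinear[OF mem(2)] _ w])
        fix d z d'
        assume "z \<in> I"
        then have "G (tau (Suc n) (us' @ [d * z, 1])) \<in> carrier M"
          using last2_update[OF mem(1) ne, of "d * z" 1]
          by (intro additive_maps_closed[OF G] P.pure_closed) (simp add: mult_I_left)
        then show "last_form M G n us' (x + y) d z d' = last_form M G n us' x d z d' \<oplus>\<^bsub>M\<^esub> last_form M G n us' y d z d'"
          by (simp add: last_form_def distrib_left M.add_ract)
      qed
      then show ?thesis
        using 1 \<rho>[of us' w] by simp
    next
      case 2
      then show ?thesis
        using expand_add[OF A last_form_trilinear[of us x l], of x y] x y last2_mem[of us x l n] last2_mem[of us y l n]
        by (simp only: \<rho> simp_thms)
    next
      case 3
      have mem: "(us @ x # vs') @ [w, l] \<in> bar" "(us @ y # vs') @ [w, l] \<in> bar"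
          "(us @ (x + y) # vs') @ [w, l] \<in> bar"
        using x y P.listset_add[OF x y] 3 by simp_all
      have "expand M (last_form M G n (us @ (x + y) # vs') l) w =
          expand M (last_form M G n (us @ x # vs') l) w \<oplus>\<^bsub>M\<^esub> expand M (last_form M G n (us @ y # vs') l) w"
        using mem
        by (intro expand_sum_eqI[OF A last_form_trilinear[OF mem(3)] last_form_trilinear[OF mem(1)]
            last_form_trilinear[OF mem(2)] _ last2_mem[OF mem(1)]] last_form_add1[of us x vs' w l y]) simp_all
      then show ?thesis
        using 3 \<rho>[of "us @ a # vs'" w l for a] by simp
    qed
  next
    fix us x c y vs
    assume c: "c \<in> C" and x: "us @ x # y # vs \<in> bar"
    have xc: "us @ (x * c) # y # vs \<in> bar" and cy: "us @ x # (c * y) # vs \<in> bar"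
      using P.listset_right[OF x c] P.listset_left[of "us @ [x]" y vs "Suc n" c] x c by simp_all
    consider "vs = []" | l where "vs = [l]" | vs' w l where "vs = vs' @ [w, l]"
      by (metis append_butlast_last_id append_assoc append_Cons append_Nil)
    then show "?\<rho> (us @ (x * c) # y # vs) = ?\<rho> (us @ x # (c * y) # vs)"
    proof cases
      case 1
      have mem: "us @ [x, y] \<in> bar"
        using x 1 by simp
      \<comment> \<open>Multiplying the expanded factor by \<open>c\<close> turns d' into d' c, and
        (d' c) y = d' (c y) hands \<open>c\<close> to the last entry.\<close>
      have "(\<lambda>d z d'. last_form M G n us y d z (d' * c)) = last_form M G n us (c * y)"
        by (simp add: last_form_def mult.assoc)
      then have "expand M (last_form M G n us y) (x * c) = expand M (last_form M G n us (c * y)) x"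
        using expand_right[OF A last_form_trilinear[OF mem] c last2_mem[OF mem]] by simp
      then show ?thesis
        using 1 by (simp only: \<rho>)
    next
      case 2
      have mem: "(us @ [x]) @ [y, l] \<in> bar" "(us @ [x * c]) @ [y, l] \<in> bar"
        using x xc 2 by simp_all
      have "expand M (last_form M G n (us @ [x]) l) (c * y) = expand M (\<lambda>d. last_form M G n (us @ [x]) l (c * d)) y"
        by (rule expand_left[OF A last_form_trilinear[OF mem(1)] c last2_mem[OF mem(1)]])
      also have "\<dots> = expand M (last_form M G n (us @ [x * c]) l) y"
      proof (rule expand_eqI[OF A trilinear_left[OF last_form_trilinear[OF mem(1)] c]
            last_form_trilinear[OF mem(2)] _ last2_mem[OF mem(1)]])
        fix d z d'
        assume "z \<in> I"
        then show "last_form M G n (us @ [x]) l (c * d) z d' = last_form M G n (us @ [x * c]) l d z d'"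
          using P.pure_balanced[OF c, of us x "d * z" "[1]" "Suc n"] last2_update[OF mem(1), of "d * z" 1]
          by (simp add: last_form_def mult_I_left mult.assoc)
      qed
      finally show ?thesis
        using 2 \<rho>[of "us @ [a]" b l for a b] by simp
    next
      case 3
      have mem: "(us @ (x * c) # y # vs') @ [w, l] \<in> bar" "(us @ x # (c * y) # vs') @ [w, l] \<in> bar"
        using xc cy 3 by simp_all
      have "expand M (last_form M G n (us @ (x * c) # y # vs') l) w = expand M (last_form M G n (us @ x # (c * y) # vs') l) w"
        using x 3
        by (intro expand_eqI[OF A last_form_trilinear[OF mem(1)] last_form_trilinear[OF mem(2)]
            _ last2_mem[OF mem(1)]] last_form_balanced[OF c]) simp_all
      then show ?thesis
        using 3 \<rho>[of "us @ a # b # vs'" w l for a b] by simp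
    qed
  }
qed

lemma last_lift_additive: "last_lift M G n \<in> additive_maps (T (Suc n)) M"
  unfolding last_lift_def by (rule P.lift_additive[OF M.abelian_group_axioms multilinear_last_lift])

lemma last_lift_tau:
  "us @ [x, l] \<in> bar \<Longrightarrow> last_lift M G n (tau (Suc n) (us @ [x, l])) = expand M (last_form M G n us l) x"
  unfolding last_lift_def
  by (subst P.lift_pure[OF M.abelian_group_axioms multilinear_last_lift]) (simp_all add: butlast_append)

text \<open>The last entry occurs only in the action of d' l on values of \<open>G\<close>, so right
  multiplication passes by associativity of the action, although \<open>G\<close> is not right
  linear over the whole algebra.\<close>

lemma last_lift_ract:
  assumes q: "q \<in> carrier (T (Suc n))"
  shows "last_lift M G n (ract (P.B (Suc n)) q a) = ract M (last_lift M G n q) a"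
proof (rule P.tensor_hom_eq[OF M.abelian_group_axioms _ _ _ q])
  note A = M.abelian_group_axioms
  show "(\<lambda>q. last_lift M G n (ract (P.B (Suc n)) q a)) \<in> additive_maps (T (Suc n)) M"
    by (rule additive_maps_comp[OF P.ract_B_additive last_lift_additive]) simp
  show "(\<lambda>q. ract M (last_lift M G n q) a) \<in> additive_maps (T (Suc n)) M"
    by (rule additive_maps_comp[OF last_lift_additive M.ract_additive]) simp
  fix xs
  assume xs: "xs \<in> bar"
  then obtain us x l where xs_eq: "xs = us @ [x, l]" and x: "x \<in> I"
    by (rule last2_cases)
  have mem: "us @ [x, l] \<in> bar"
    using xs xs_eq by simp
  have ne: "us \<noteq> []"
    using bar_length[OF mem] by auto
  have mem': "us @ [x, l * a] \<in> bar"
    by (rule last2_update[OF mem ne x])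
  have "ract M (expand M (last_form M G n us l) x) a = expand M (\<lambda>d z d'. ract M (last_form M G n us l d z d') a) x"
    by (rule expand_comp[OF A A last_form_trilinear[OF mem] M.ract_additive x]) simp
  also have "\<dots> = expand M (last_form M G n us (l * a)) x"
  proof (rule expand_eqI[OF A trilinear_comp[OF last_form_trilinear[OF mem] M.ract_additive]
        last_form_trilinear[OF mem'] _ x])
    fix d z d'
    assume "z \<in> I"
    then have "G (tau (Suc n) (us @ [d * z, 1])) \<in> carrier M"
      using last2_update[OF mem ne, of "d * z" 1]
      by (intro additive_maps_closed[OF G] P.pure_closed) (simp add: mult_I_left)
    then show "ract M (last_form M G n us l d z d') a = last_form M G n us (l * a) d z d'"
      using M.mult_ract[of "d' * l" a] by (simp add: last_form_def mult.assoc)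
  qed simp
  finally show "last_lift M G n (ract (P.B (Suc n)) (tau (Suc n) xs) a) = ract M (last_lift M G n (tau (Suc n) xs)) a"
    using P.ract_pure[OF _ mem, of a] last_lift_tau[OF mem] last_lift_tau[OF mem']
    by (simp add: xs_eq butlast_append)
qed

end

subsection \<open>Lifting through the first factor\<close>

text \<open>The mirror image of \<open>last_form\<close>: the argument of \<open>r\<close> begins
  with 1, and l c acts outside. The map \<open>r\<close> is now right linear over the whole algebra,
  but not left linear.\<close>

definition first_form ::
  "('a, 'u) bimodule \<Rightarrow> ('a tens \<Rightarrow> 'u) \<Rightarrow> nat \<Rightarrow> 'a \<Rightarrow> 'a list \<Rightarrow> 'a \<Rightarrow> 'a \<Rightarrow> 'a \<Rightarrow> 'u" where
  "first_form M r n l rest = (\<lambda>c y c'. lact M (l * c) (r (tau (Suc n) (1 # (y * c') # rest))))"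

definition first_lift :: "('a, 'u) bimodule \<Rightarrow> ('a tens \<Rightarrow> 'u) \<Rightarrow> nat \<Rightarrow> 'a tens \<Rightarrow> 'u" where
  "first_lift M r n = tensor_lift M (\<lambda>xs. expand M (first_form M r n (hd xs) (tl (tl xs))) (hd (tl xs)))"

context
  fixes M :: "('a, 'u) bimodule" and r :: "'a tens \<Rightarrow> 'u" and n :: nat
  assumes M: "bimodule scale UNIV M" and r: "r \<in> additive_maps (T (Suc n)) M"
    and r_ract: "\<And>q a. q \<in> carrier (T (Suc n)) \<Longrightarrow> r (ract (P.B (Suc n)) q a) = ract M (r q) a"
begin

interpretation M: bimodule scale UNIV M
  by (rule M)

abbreviation (input) "bar1 \<equiv> listset (bar_factors I (Suc n))"

lemma r_closed: "xs \<in> bar1 \<Longrightarrow> r (tau (Suc n) xs) \<in> carrier M"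
  by (intro additive_maps_closed[OF r] P.pure_closed)

lemma first_form_trilinear:
  assumes "l # x # rest \<in> bar1"
  shows "trilinear M (first_form M r n l rest)"
proof -
  have mem: "l' # y # rest \<in> bar1" if "y \<in> I" for y l'
    by (rule first2_update[OF assms that])
  let ?r = "\<lambda>y. r (tau (Suc n) (1 # y # rest))"
  have r_cl: "?r y \<in> carrier M" if "y \<in> I" for y
    by (rule r_closed[OF mem[OF that]])
  have r_add: "?r (y + z) = ?r y \<oplus>\<^bsub>M\<^esub> ?r z" if "y \<in> I" "z \<in> I" for y z
    using P.pure_add[of "[1]" y rest "Suc n" z] additive_maps_add[OF r] that by (simp add: mem P.pure_closed)
  \<comment> \<open>Only right linearity of \<open>r\<close> is at hand. A scalar on the left is
    therefore carried to the right end of the tensor by centrality, taken out of \<open>r\<close>,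
    and carried back to the left in \<open>M\<close>.\<close>
  have r_sc: "?r (scale k 1 * y) = lact M (scale k 1) (?r y)" if "y \<in> I" for y k
  proof -
    interpret B: bimodule scale UNIV "P.B (Suc n)"
      by (rule P.bimodule_B)
    have q: "tau (Suc n) (1 # y # rest) \<in> carrier (T (Suc n))"
      by (rule P.pure_closed[OF mem[OF that]])
    have "tau (Suc n) (1 # (scale k 1 * y) # rest) = lact (P.B (Suc n)) (scale k 1) (tau (Suc n) (1 # y # rest))"
      using P.pure_balanced[OF scalar_C, of "[]" 1 y rest "Suc n" k] mem[OF that] P.lact_pure[OF _ mem[OF that]]
      by simp
    also have "\<dots> = ract (P.B (Suc n)) (tau (Suc n) (1 # y # rest)) (scale k 1)"
      using B.central q by simp
    finally show ?thesis
      using r_ract[OF q] M.central[OF r_cl[OF that]] by simp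
  qed
  show ?thesis
    unfolding first_form_def
  proof (rule trilinearI)
    fix c y c'
    assume cy: "c \<in> C" "y \<in> I" "c' \<in> C"
    note c = mult_I_right[OF cy(2), of c']
    show "lact M (l * c) (?r (y * c')) \<in> carrier M"
      by (intro M.lact_closed r_cl c) simp
    show "lact M (l * (c + d)) (?r (y * c')) = lact M (l * c) (?r (y * c')) \<oplus>\<^bsub>M\<^esub> lact M (l * d) (?r (y * c'))" for d
      using r_cl[OF c] by (simp add: distrib_left M.add_lact)
    show "lact M (l * c) (?r ((y + z) * c')) = lact M (l * c) (?r (y * c')) \<oplus>\<^bsub>M\<^esub> lact M (l * c) (?r (z * c'))"
      if "z \<in> I" for z
      using cy that by (simp add: distrib_right r_add mult_I_right M.lact_add r_cl)
    show "lact M (l * c) (?r (y * (c' + d))) = lact M (l * c) (?r (y * c')) \<oplus>\<^bsub>M\<^esub> lact M (l * c) (?r (y * d))" for d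
      using cy by (simp add: distrib_left r_add mult_I_right M.lact_add r_cl)
    show "lact M (l * (c * scale k 1)) (?r (y * c')) = lact M (l * c) (?r (scale k 1 * y * c'))" for k
      using r_sc[OF c, of k] M.mult_lact[of "l * c" "scale k 1" "?r (y * c')"] r_cl[OF c]
      by (simp only: mult.assoc UNIV_I simp_thms)
    show "lact M (l * c) (?r (y * scale k 1 * c')) = lact M (l * c) (?r (y * (scale k 1 * c')))" for k
      by (simp only: mult.assoc)
  qed
qed

text \<open>Balancing at the first tensor sign is left linearity of \<sigma> over \<open>C\<close>,
  at the second its right linearity with balancing inside \<open>r\<close>, and further right
  balancing inside \<open>r\<close> alone.\<close>

lemma multilinear_first_lift:
  "multilinear C (bar_factors I (Suc n)) M
     (\<lambda>xs. expand M (first_form M r n (hd xs) (tl (tl xs))) (hd (tl xs)))" (is "multilinear _ _ _ ?\<theta>")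
proof (rule multilinearI)
  note A = M.abelian_group_axioms
  fix xs
  assume xs: "xs \<in> bar1"
  then obtain l x rest where "xs = l # x # rest" "x \<in> I"
    by (rule first2_cases)
  with xs show "?\<theta> xs \<in> carrier M"
    using expand_closed[OF A first_form_trilinear] by simp
next
  note A = M.abelian_group_axioms
  fix us x y vs
  assume x: "us @ x # vs \<in> bar1" and y: "us @ y # vs \<in> bar1"
  have len: "length us + length vs = n + 2"
    using bar_length[OF x] by simp
  consider w rest where "us = []" "vs = w # rest" | l where "us = [l]" | l w us' where "us = l # w # us'"
    using len by (cases us; cases "tl us"; cases vs) auto
  then show "?\<theta> (us @ (x + y) # vs) = ?\<theta> (us @ x # vs) \<oplus>\<^bsub>M\<^esub> ?\<theta> (us @ y # vs)"
  proof cases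
    case 1
    have mem: "x # w # rest \<in> bar1" "y # w # rest \<in> bar1" "(x + y) # w # rest \<in> bar1"
      using x y P.listset_add[OF x y] 1 by simp_all
    have w: "w \<in> I"
      by (rule first2_mem[OF mem(1)])
    have "expand M (first_form M r n (x + y) rest) w = expand M (first_form M r n x rest) w \<oplus>\<^bsub>M\<^esub> expand M (first_form M r n y rest) w"
    proof (rule expand_sum_eqI[OF A first_form_trilinear[OF mem(3)] first_form_trilinear[OF mem(1)]
          first_form_trilinear[OF mem(2)] _ w])
      fix c z c'
      assume "z \<in> I"
      then have "r (tau (Suc n) (1 # (z * c') # rest)) \<in> carrier M"
        by (intro r_closed first2_update[OF mem(1)] mult_I_right)
      then show "first_form M r n (x + y) rest c z c' = first_form M r n x rest c z c' \<oplus>\<^bsub>M\<^esub> first_form M r n y rest c z c'"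
        by (simp add: first_form_def distrib_right M.add_lact)
    qed
    then show ?thesis
      using 1 by simp
  next
    case 2
    then show ?thesis
      using expand_add[OF A first_form_trilinear[of l x vs], of x y] x y first2_mem[of l x vs n] first2_mem[of l y vs n]
      by simp
  next
    case 3
    have mem: "l # w # us' @ x # vs \<in> bar1" "l # w # us' @ y # vs \<in> bar1" "l # w # us' @ (x + y) # vs \<in> bar1"
      using x y P.listset_add[OF x y] 3 by simp_all
    have "expand M (first_form M r n l (us' @ (x + y) # vs)) w =
        expand M (first_form M r n l (us' @ x # vs)) w \<oplus>\<^bsub>M\<^esub> expand M (first_form M r n l (us' @ y # vs)) w"
    proof (rule expand_sum_eqI[OF A first_form_trilinear[OF mem(3)] first_form_trilinear[OF mem(1)]
          first_form_trilinear[OF mem(2)] _ first2_mem[OF mem(1)]])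
      fix c z c'
      assume "z \<in> I"
      then have z: "1 # (z * c') # us' @ x # vs \<in> bar1" "1 # (z * c') # us' @ y # vs \<in> bar1"
        using first2_update[OF mem(1)] first2_update[OF mem(2)] mult_I_right by blast+
      show "first_form M r n l (us' @ (x + y) # vs) c z c' =
          first_form M r n l (us' @ x # vs) c z c' \<oplus>\<^bsub>M\<^esub> first_form M r n l (us' @ y # vs) c z c'"
        using P.pure_add[of "1 # (z * c') # us'" x vs "Suc n" y] z P.pure_closed[OF z(1)] P.pure_closed[OF z(2)]
        by (simp add: first_form_def additive_maps_add[OF r] M.lact_add additive_maps_closed[OF r])
    qed
    then show ?thesis
      using 3 by simp
  qed
next
  note A = M.abelian_group_axioms
  fix us x c y vs
  assume c: "c \<in> C" and x: "us @ x # y # vs \<in> bar1"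
  have xc: "us @ (x * c) # y # vs \<in> bar1" and cy: "us @ x # (c * y) # vs \<in> bar1"
    using P.listset_right[OF x c] P.listset_left[of "us @ [x]" y vs "Suc n" c] x c by simp_all
  consider "us = []" | l where "us = [l]" | l w us' where "us = l # w # us'"
    by (cases us; cases "tl us") auto
  then show "?\<theta> (us @ (x * c) # y # vs) = ?\<theta> (us @ x # (c * y) # vs)"
  proof cases
    case 1
    have mem: "x # y # vs \<in> bar1"
      using x 1 by simp
    have "(\<lambda>d. first_form M r n x vs (c * d)) = first_form M r n (x * c) vs"
      by (simp add: first_form_def mult.assoc)
    then have "expand M (first_form M r n x vs) (c * y) = expand M (first_form M r n (x * c) vs) y"
      using expand_left[OF A first_form_trilinear[OF mem] c first2_mem[OF mem]] by simp
    then show ?thesis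
      using 1 by simp
  next
    case 2
    have mem: "l # x # y # vs \<in> bar1" "l # x # (c * y) # vs \<in> bar1"
      using x cy 2 by simp_all
    have "expand M (first_form M r n l (y # vs)) (x * c) = expand M (\<lambda>d z d'. first_form M r n l (y # vs) d z (d' * c)) x"
      by (rule expand_right[OF A first_form_trilinear[OF mem(1)] c first2_mem[OF mem(1)]])
    also have "\<dots> = expand M (first_form M r n l ((c * y) # vs)) x"
    proof (rule expand_eqI[OF A trilinear_right[OF first_form_trilinear[OF mem(1)] c]
          first_form_trilinear[OF mem(2)] _ first2_mem[OF mem(1)]])
      fix d z d'
      assume "z \<in> I"
      then show "first_form M r n l (y # vs) d z (d' * c) = first_form M r n l ((c * y) # vs) d z d'"
        using P.pure_balanced[OF c, of "[1]" "z * d'" y vs "Suc n"] first2_update[OF mem(1), of "z * d'" 1]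
        by (simp add: first_form_def mult_I_right mult.assoc)
    qed
    finally show ?thesis
      using 2 by simp
  next
    case 3
    have mem: "l # w # us' @ x # y # vs \<in> bar1" "l # w # us' @ (x * c) # y # vs \<in> bar1"
        "l # w # us' @ x # (c * y) # vs \<in> bar1"
      using x xc cy 3 by simp_all
    have "expand M (first_form M r n l (us' @ (x * c) # y # vs)) w = expand M (first_form M r n l (us' @ x # (c * y) # vs)) w"
    proof (rule expand_eqI[OF A first_form_trilinear[OF mem(2)] first_form_trilinear[OF mem(3)] _
          first2_mem[OF mem(1)]])
      fix d z d'
      assume "z \<in> I"
      then show "first_form M r n l (us' @ (x * c) # y # vs) d z d' = first_form M r n l (us' @ x # (c * y) # vs) d z d'"
        using P.pure_balanced[OF c, of "1 # (z * d') # us'" x y vs "Suc n"] first2_update[OF mem(1), of "z * d'" 1]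
        by (simp add: first_form_def mult_I_right)
    qed
    then show ?thesis
      using 3 by simp
  qed
qed

lemma first_lift_additive: "first_lift M r n \<in> additive_maps (T (Suc n)) M"
  unfolding first_lift_def by (rule P.lift_additive[OF M.abelian_group_axioms multilinear_first_lift])

lemma first_lift_tau:
  "l # x # rest \<in> bar1 \<Longrightarrow> first_lift M r n (tau (Suc n) (l # x # rest)) = expand M (first_form M r n l rest) x"
  unfolding first_lift_def
  by (subst P.lift_pure[OF M.abelian_group_axioms multilinear_first_lift]) simp_all

text \<open>Left multiplication meets only the outside action of l c. Right multiplication changes
  the nonempty \<open>rest\<close>, is taken out of \<open>r\<close> by its right linearity, and
  commutes with the left action on \<open>M\<close>.\<close>

lemma first_lift_hom: "first_lift M r n \<in> bimodule_hom UNIV (P.B (Suc n)) M"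
proof (rule P.additive_bimodule_hom[OF M first_lift_additive])
  note A = M.abelian_group_axioms
  fix a xs
  assume xs: "xs \<in> bar1"
  then obtain l x rest where xs_eq: "xs = l # x # rest" and x: "x \<in> I" and ne: "rest \<noteq> []"
    by (rule first2_cases)
  have mem: "l # x # rest \<in> bar1"
    using xs xs_eq by simp
  have z: "1 # (z * c') # rest \<in> bar1" if "z \<in> I" for z c'
    by (rule first2_update[OF mem mult_I_right[OF that]])
  have meml: "(a * l) # x # rest \<in> bar1"
    by (rule first2_update[OF mem x])
  have "lact M a (expand M (first_form M r n l rest) x) = expand M (\<lambda>c y c'. lact M a (first_form M r n l rest c y c')) x"
    by (rule expand_comp[OF A A first_form_trilinear[OF mem] M.lact_additive x]) simp
  also have "\<dots> = expand M (first_form M r n (a * l) rest) x"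
    by (rule expand_eqI[OF A trilinear_comp[OF first_form_trilinear[OF mem] M.lact_additive]
        first_form_trilinear[OF meml] _ x])
      (simp_all add: first_form_def mult.assoc M.mult_lact r_closed z)
  finally show "first_lift M r n (tau (Suc n) ((a * hd xs) # tl xs)) = lact M a (first_lift M r n (tau (Suc n) xs))"
    using first_lift_tau[OF mem] first_lift_tau[OF meml] by (simp add: xs_eq)
  let ?rest = "butlast rest @ [last rest * a]"
  have memr: "l # x # ?rest \<in> bar1"
    using P.listset_rmult[OF mem, of a] ne by simp
  have "ract M (expand M (first_form M r n l rest) x) a = expand M (\<lambda>c y c'. ract M (first_form M r n l rest c y c') a) x"
    by (rule expand_comp[OF A A first_form_trilinear[OF mem] M.ract_additive x]) simp
  also have "\<dots> = expand M (first_form M r n l ?rest) x"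
  proof (rule expand_eqI[OF A trilinear_comp[OF first_form_trilinear[OF mem] M.ract_additive]
        first_form_trilinear[OF memr] _ x])
    fix c y c'
    assume y: "y \<in> I"
    have "tau (Suc n) (1 # (y * c') # ?rest) = ract (P.B (Suc n)) (tau (Suc n) (1 # (y * c') # rest)) a"
      using P.ract_pure[OF _ z[OF y], of a c'] ne by simp
    then show "ract M (first_form M r n l rest c y c') a = first_form M r n l ?rest c y c'"
      using r_ract[OF P.pure_closed[OF z[OF y]]] M.lact_ract r_closed[OF z[OF y]]
      by (simp add: first_form_def)
  qed simp
  finally show "first_lift M r n (tau (Suc n) (butlast xs @ [last xs * a])) = ract M (first_lift M r n (tau (Suc n) xs)) a"
    using first_lift_tau[OF mem] first_lift_tau[OF memr] ne by (simp add: xs_eq)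
qed

end

subsection \<open>Projectivity of the terms of the complex\<close>

text \<open>The premise \<open>split\<close> says \<Sum> c y c' = x as seen by additive maps into
  \<open>N\<close>. It is used once for each end, with \<open>b\<close> sending y to the value of
  \<open>g\<close> on the tensor whose last, respectively first, factor from \<open>I\<close> is
  replaced by y. For \<open>n = 0\<close> both are the same factor.\<close>

lemma bar_lifting:
  fixes M N :: "('a, 'u) bimodule"
  assumes M: "bimodule scale UNIV M" and N: "bimodule scale UNIV N"
    and f: "f \<in> bimodule_hom UNIV M N" and surj: "f ` carrier M = carrier N"
    and g: "g \<in> bimodule_hom UNIV (bar_bimodule C I (Suc n)) N"
    and split: "\<And>b x. b \<in> additive_maps (sub_bimodule I) N \<Longrightarrow> x \<in> I \<Longrightarrow>
      expand N (\<lambda>c y c'. b (c * y * c')) x = b x"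
  shows "\<exists>h\<in>bimodule_hom UNIV (bar_bimodule C I (Suc n)) M. \<forall>q\<in>carrier (bar_bimodule C I (Suc n)). f (h q) = g q"
proof -
  interpret M: bimodule scale UNIV M by (rule M)
  interpret N: bimodule scale UNIV N by (rule N)
  let ?T = "T (Suc n)" and ?B = "P.B (Suc n)" and ?tau = "tau (Suc n)"
  let ?bar = "listset (bar_factors I (Suc n))"
  note AM = M.abelian_group_axioms and AN = N.abelian_group_axioms
  have f_add: "f \<in> additive_maps M N"
    by (rule bimodule_hom_additive[OF f])
  have g': "g \<in> bimodule_hom UNIV ?B N"
    using g by (simp add: bar_bimodule_def)
  have g_add: "g \<in> additive_maps ?T N"
    using bimodule_hom_additive[OF g'] by simp
  have g_ract: "g (ract ?B q a) = ract N (g q) a" and g_lact: "g (lact ?B a q) = lact N a (g q)"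
    if "q \<in> carrier ?T" for q a
    using bimodule_hom_ract[OF g', of a q] bimodule_hom_lact[OF g', of a q] that by simp_all
  have "k_bimodule scale UNIV M" "k_bimodule scale UNIV N"
    by (simp_all add: k_bimodule_def k_bimodule_axioms_def M N k_algebra_axioms)
  then obtain s where s: "s \<in> additive_maps N M" "\<And>y. y \<in> carrier N \<Longrightarrow> f (s y) = y"
    "\<And>y c. y \<in> carrier N \<Longrightarrow> s (ract N y (scale c 1)) = ract M (s y) (scale c 1)"
    using linear_section[OF _ _ f surj] by blast
  define G where "G = (\<lambda>q. s (g q))"
  have G: "G \<in> additive_maps ?T M"
    unfolding G_def by (rule additive_maps_comp[OF g_add s(1)])
  have G_scalar: "G (ract ?B q (scale k 1)) = ract M (G q) (scale k 1)" if "q \<in> carrier ?T" for q k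
    using that by (simp add: G_def g_ract s(3) additive_maps_closed[OF g_add])
  have fG: "f (G q) = g q" if "q \<in> carrier ?T" for q
    unfolding G_def by (rule s(2)[OF additive_maps_closed[OF g_add that]])
  define r where "r = last_lift M G n"
  have r: "r \<in> additive_maps ?T M"
    unfolding r_def by (rule last_lift_additive[OF M G G_scalar])
  have r_ract: "r (ract ?B q a) = ract M (r q) a" if "q \<in> carrier ?T" for q a
    unfolding r_def by (rule last_lift_ract[OF M G G_scalar that])
  have fr: "f (r q) = g q" if "q \<in> carrier ?T" for q
  proof (rule P.tensor_hom_eq[OF AN additive_maps_comp[OF r f_add] g_add _ that])
    fix xs
    assume "xs \<in> ?bar"
    then obtain us x l where xs: "xs = us @ [x, l]" and x: "x \<in> I" and mem: "us @ [x, l] \<in> ?bar"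
      using last2_cases by metis
    have ne: "us \<noteq> []"
      using bar_length[OF mem] by auto
    have mem': "us @ [y, l'] \<in> ?bar" if "y \<in> I" for y l'
      by (rule last2_update[OF mem ne that])
    note tri = last_form_trilinear[OF M G G_scalar mem]
    let ?b = "\<lambda>y. g (?tau (us @ [y, l]))"
    have b: "?b \<in> additive_maps (sub_bimodule I) N"
    proof (rule additive_mapsI)
      fix y z
      assume "y \<in> carrier (sub_bimodule I)"
      then have y: "y \<in> I"
        by (simp add: sub_bimodule_def)
      show "?b y \<in> carrier N"
        by (rule additive_maps_closed[OF g_add P.pure_closed[OF mem'[OF y]]])
      assume "z \<in> carrier (sub_bimodule I)"
      then have z: "z \<in> I"
        by (simp add: sub_bimodule_def)
      show "?b (y \<oplus>\<^bsub>sub_bimodule I\<^esub> z) = ?b y \<oplus>\<^bsub>N\<^esub> ?b z"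
        using P.pure_add[of us y "[l]" "Suc n" z] mem'[OF y] mem'[OF z]
        by (simp add: sub_bimodule_def additive_maps_add[OF g_add] P.pure_closed)
    qed
    have "f (r (?tau xs)) = f (expand M (last_form M G n us l) x)"
      unfolding r_def xs by (subst last_lift_tau[OF M G G_scalar mem]) simp_all
    also have "\<dots> = expand N (\<lambda>c y c'. f (last_form M G n us l c y c')) x"
      by (rule expand_comp[OF AM AN tri f_add x])
    \<comment> \<open>Applying \<open>f\<close> undoes s, and \<open>g\<close> is right linear, so
      c' l returns into the argument of \<open>g\<close>; balancing then passes c' to the factor c
      y.\<close>
    also have "\<dots> = expand N (\<lambda>c y c'. ?b (c * y * c')) x"
    proof (rule expand_eqI[OF AN trilinear_comp[OF tri f_add] trilinear_mult[OF b] _ x])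
      fix c y c'
      assume y: "c \<in> C" "y \<in> I" "c' \<in> C"
      note cy = mult_I_left[OF y(2), of c]
      have q: "?tau (us @ [c * y, 1]) \<in> carrier ?T"
        by (rule P.pure_closed[OF mem'[OF cy]])
      have "f (last_form M G n us l c y c') = ract N (g (?tau (us @ [c * y, 1]))) (c' * l)"
        unfolding last_form_def
        by (simp add: bimodule_hom_ract[OF f] additive_maps_closed[OF G q] fG[OF q])
      also have "\<dots> = g (ract ?B (?tau (us @ [c * y, 1])) (c' * l))"
        by (rule g_ract[OF q, symmetric])
      also have "ract ?B (?tau (us @ [c * y, 1])) (c' * l) = ?tau (us @ [c * y, c' * l])"
        using P.ract_pure[OF _ mem'[OF cy], of "c' * l" 1] by (simp add: butlast_append)
      also have "\<dots> = ?tau (us @ [c * y * c', l])"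
        using P.pure_balanced[OF y(3), of us "c * y" l "[]" "Suc n"] mem'[OF cy] by simp
      finally show "f (last_form M G n us l c y c') = ?b (c * y * c')" .
    qed
    also have "\<dots> = g (?tau xs)"
      using split[OF b x] by (simp add: xs)
    finally show "f (r (?tau xs)) = g (?tau xs)" .
  qed
  define t where "t = first_lift M r n"
  have t: "t \<in> bimodule_hom UNIV ?B M"
    unfolding t_def by (rule first_lift_hom[OF M r r_ract])
  then have t_add: "t \<in> additive_maps ?T M"
    using bimodule_hom_additive[OF t] by simp
  have ft: "f (t q) = g q" if "q \<in> carrier ?T" for q
  proof (rule P.tensor_hom_eq[OF AN additive_maps_comp[OF t_add f_add] g_add _ that])
    fix xs
    assume "xs \<in> ?bar"
    then obtain l x rest where xs: "xs = l # x # rest" and x: "x \<in> I" and mem: "l # x # rest \<in> ?bar"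
      using first2_cases by metis
    have mem': "l' # y # rest \<in> ?bar" if "y \<in> I" for y l'
      by (rule first2_update[OF mem that])
    note tri = first_form_trilinear[OF M r r_ract mem]
    let ?b = "\<lambda>y. g (?tau (l # y # rest))"
    have b: "?b \<in> additive_maps (sub_bimodule I) N"
    proof (rule additive_mapsI)
      fix y z
      assume "y \<in> carrier (sub_bimodule I)"
      then have y: "y \<in> I"
        by (simp add: sub_bimodule_def)
      show "?b y \<in> carrier N"
        by (rule additive_maps_closed[OF g_add P.pure_closed[OF mem'[OF y]]])
      assume "z \<in> carrier (sub_bimodule I)"
      then have z: "z \<in> I"
        by (simp add: sub_bimodule_def)
      show "?b (y \<oplus>\<^bsub>sub_bimodule I\<^esub> z) = ?b y \<oplus>\<^bsub>N\<^esub> ?b z"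
        using P.pure_add[of "[l]" y rest "Suc n" z] mem'[OF y] mem'[OF z]
        by (simp add: sub_bimodule_def additive_maps_add[OF g_add] P.pure_closed)
    qed
    have "f (t (?tau xs)) = f (expand M (first_form M r n l rest) x)"
      unfolding t_def xs by (subst first_lift_tau[OF M r r_ract mem]) simp_all
    also have "\<dots> = expand N (\<lambda>c y c'. f (first_form M r n l rest c y c')) x"
      by (rule expand_comp[OF AM AN tri f_add x])
    \<comment> \<open>The mirror computation, resting on \<open>fr\<close>: the right linear map
      \<open>r\<close> already lifts \<open>g\<close>.\<close>
    also have "\<dots> = expand N (\<lambda>c y c'. ?b (c * y * c')) x"
    proof (rule expand_eqI[OF AN trilinear_comp[OF tri f_add] trilinear_mult[OF b] _ x])
      fix c y c'
      assume y: "c \<in> C" "y \<in> I" "c' \<in> C"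
      note cy = mult_I_right[OF y(2), of c']
      have q: "?tau (1 # (y * c') # rest) \<in> carrier ?T"
        by (rule P.pure_closed[OF mem'[OF cy]])
      have "f (first_form M r n l rest c y c') = lact N (l * c) (g (?tau (1 # (y * c') # rest)))"
        unfolding first_form_def
        by (simp add: bimodule_hom_lact[OF f] additive_maps_closed[OF r q] fr[OF q])
      also have "\<dots> = g (lact ?B (l * c) (?tau (1 # (y * c') # rest)))"
        by (rule g_lact[OF q, symmetric])
      also have "lact ?B (l * c) (?tau (1 # (y * c') # rest)) = ?tau ((l * c) # (y * c') # rest)"
        using P.lact_pure[OF _ mem'[OF cy], of "l * c" 1] by simp
      also have "\<dots> = ?tau (l # (c * y * c') # rest)"
        using P.pure_balanced[OF y(1), of "[]" l "y * c'" rest "Suc n"] mem'[OF cy] by (simp add: mult.assoc)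
      finally show "f (first_form M r n l rest c y c') = ?b (c * y * c')" .
    qed
    also have "\<dots> = g (?tau xs)"
      using split[OF b x] by (simp add: xs)
    finally show "f (t (?tau xs)) = g (?tau xs)" .
  qed
  show ?thesis
    using t ft by (auto simp: bar_bimodule_def)
qed

end

text \<open>The hypothesis tests \<open>I\<close> against bimodules in the type of tensors, the
  conclusion allows any type \<open>'u\<close>. The passage works because the hypothesis serves to
  produce \<sigma>, whose test modules consist of tensors, while lifts into modules over
  \<open>'u\<close> are then given by formulas in \<sigma>.\<close>

lemma (in cleft_extension) projective_bar:
  assumes "projective_bimodule TYPE('a tens) scale C (sub_bimodule I)"
  shows "projective_bimodule TYPE('u) scale UNIV (bar_bimodule C I (Suc n))"
  unfolding projective_bimodule_def
proof (intro conjI allI impI ballI)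
  show "bimodule scale UNIV (bar_bimodule C I (Suc n))"
    unfolding bar_bimodule_def by (rule bimodule_tensor.bimodule_B[OF bimodule_tensor_bar])
next
  fix M N :: "('a, 'u) bimodule" and f g
  assume *: "bimodule scale UNIV M" "bimodule scale UNIV N" "f \<in> bimodule_hom UNIV M N"
    "g \<in> bimodule_hom UNIV (bar_bimodule C I (Suc n)) N" "f ` carrier M = carrier N"
  note N = bimodule.axioms(1)[OF *(2)]
  show "\<exists>h\<in>bimodule_hom UNIV (bar_bimodule C I (Suc n)) M. \<forall>x\<in>carrier (bar_bimodule C I (Suc n)). f (h x) = g x"
  proof (rule projective_section[OF assms])
    fix \<sigma>
    assume \<sigma>: "\<sigma> \<in> bimodule_hom C (sub_bimodule I) (tensor_bimodule scalars [C, I, C])"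
      and split: "\<And>(K :: ('a, 'u) bimodule) b x. abelian_group K \<Longrightarrow> b \<in> additive_maps (sub_bimodule I) K \<Longrightarrow>
        x \<in> I \<Longrightarrow> tensor_lift K (\<lambda>xs. b (xs ! 0 * xs ! 1 * xs ! 2)) (\<sigma> x) = b x"
    interpret dual_basis scale C I \<sigma>
      by unfold_locales (rule \<sigma>)
    show ?thesis
      by (rule bar_lifting[OF *(1-3,5,4)]) (simp only: expand_def split[OF N])
  qed
qed

text \<open>Indices are shifted: the projective term of index n has n + 1 factors \<open>I\<close>,
  so the differential into it starts from n + 2 factors, and the differential out of one factor
  becomes the augmentation onto \<open>K1 C\<close>.\<close>

theorem proposition3p3:
  fixes scale :: "'k::field \<Rightarrow> 'a::{ring, monoid_mult} \<Rightarrow> 'a"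
    and C I :: "'a set"
  assumes "cleft_extension scale C I"
    and "projective_bimodule TYPE('a tens) scale C (sub_bimodule I)"
  shows "projective_resolution TYPE('u) scale UNIV (K1 C)
           (\<lambda>n. bar_bimodule C I (Suc n)) (\<lambda>n. bar_diff C I (Suc (Suc n))) (bar_diff C I 1)"
proof -
  interpret cleft_extension scale C I
    by fact
  show ?thesis
    unfolding projective_resolution_def One_nat_def
    using bar_diff_hom_K1 bar_diff_onto_K1 exact_K1
    by (intro conjI allI bimodule_K1 projective_bar[OF assms(2)] bar_diff_hom exact_bar)
      (simp_all add: numeral_2_eq_2)
qed

end
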